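(* Let $\mathcal{X},\mathcal{Y},\mathcal{V}$ be finite alphabets, let $P$ be a probability distribution on $\mathcal{X}$ with full support, and let $X^n=(X_1,\dots,X_n)$ be i.i.d. with distribution $P$. Let $d:\mathcal{X}\times\mathcal{Y}\to\mathbb{R}_+$ and $d_e:\mathcal{X}\times\mathcal{V}\to\mathbb{R}_+$ be (bounded) distortion functions, and let $D\ge D_{\min}:=\max_{x}\min_{y}d(x,y)$ and $D_e\ge D_{e,\min}:=\max_x\min_v d_e(x,v)$. Define $$E(P,D,D_e)=\lim_{n\to\infty}\ \max_{f_n}\ \min_{g_n}\ -\frac1n\log \Pr\Big(d_e\big(X^n,g_n(f_n(X^n))\big)\le D_e\Big),$$ where $f_n$ ranges over all (possibly randomized) maps from $\mathcal{X}^n$ to $\mathcal{Y}^n$ such that $d(X^n,f_n(X^n))\le D$ holds for every realization, and $g_n$ (which may depend on $f_n$ and $P$) ranges over all functions $\mathcal{Y}^n\to\mathcal{V}^n$. Then this limit exists and $$E(P,D,D_e)=\min_{Q}\ \big[D(Q\|P)+R(Q,D,D_e)\big],$$ where $Q$ ranges over all probability distributions on $\mathcal{X}$.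
   Context: All logarithms are base 2. $D(Q\|P)$ is the Kullback-Leibler divergence. For sequences, $d(x^n,y^n)=\frac1n\sum_{i=1}^n d(x_i,y_i)$ and $d_e(x^n,v^n)=\frac1n\sum_{i=1}^n d_e(x_i,v_i)$. A possibly randomized map $f_n$ is a conditional distribution of $Y^n\in\mathcal{Y}^n$ given $X^n$; the guesser observes $Y^n=f_n(X^n)$. For a joint distribution $P_{XY}$ on $\mathcal{X}\times\mathcal{Y}$, the conditional rate-distortion function is $$R(P_{XY},D_e)=\min_{P_{V|X,Y}:\ \mathbf{E}[d_e(X,V)]\le D_e} I(X;V|Y),$$ where $P_{V|X,Y}$ ranges over conditional distributions on $\mathcal{V}$ given $(X,Y)$. For a distribution $P_X$ on $\mathcal{X}$, $$R(P_X,D,D_e)=\max_{P_{Y|X}:\ \mathbf{E}[d(X,Y)]\le D} R(P_XP_{Y|X},D_e).$$ *)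

theory Defs
  imports "HOL-Probability.Probability"
begin

text \<open>
  Every minimum and maximum over an infinite set of maps or distributions is written with
  \<^const>\<open>Least\<close> and \<^const>\<open>Greatest\<close> applied to the set of attained values. Unlike
  \<^const>\<open>Inf\<close> and \<^const>\<open>Sup\<close>, these are unspecified when the extremum is not attained, so
  nothing can be derived about them without establishing attainment.
\<close>

definition avg_distortion :: "('a \<Rightarrow> 'b \<Rightarrow> real) \<Rightarrow> 'a list \<Rightarrow> 'b list \<Rightarrow> real" where
  "avg_distortion d xs ys = (\<Sum>i<length xs. d (xs ! i) (ys ! i)) / real (length xs)"

definition min_distortion :: "('a::finite \<Rightarrow> 'b::finite \<Rightarrow> real) \<Rightarrow> real" where
  "min_distortion d = (MAX a. MIN b. d a b)"

text \<open>The law of \<open>(A, B)\<close> when \<open>A\<close> has law \<open>p\<close> and \<open>K a\<close> is the conditional law of \<open>B\<close>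
  given \<open>A = a\<close>.\<close>

definition joint_pmf :: "'a pmf \<Rightarrow> ('a \<Rightarrow> 'b pmf) \<Rightarrow> ('a \<times> 'b) pmf" where
  "joint_pmf p K = bind_pmf p (\<lambda>a. map_pmf (Pair a) (K a))"

text \<open>\<open>I(X;V|Y)\<close> in bits, for \<open>((X, Y), V)\<close> distributed according to \<open>J\<close>.\<close>

definition cond_mutual_info :: "(('x::finite \<times> 'y::finite) \<times> 'v::finite) pmf \<Rightarrow> real" where
  "cond_mutual_info J =
     prob_space.conditional_mutual_information (measure_pmf J) 2
       (count_space UNIV) (count_space UNIV) (count_space UNIV)
       (\<lambda>((x, y), v). x) (\<lambda>((x, y), v). v) (\<lambda>((x, y), v). y)"

definition cond_rate_distortion ::
    "('x::finite \<Rightarrow> 'v::finite \<Rightarrow> real) \<Rightarrow> ('x \<times> 'y::finite) pmf \<Rightarrow> real \<Rightarrow> real" where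
  "cond_rate_distortion d\<^sub>e PXY D\<^sub>e =
     (LEAST r. \<exists>W :: 'x \<times> 'y \<Rightarrow> 'v pmf.
        measure_pmf.expectation (joint_pmf PXY W) (\<lambda>((x, y), v). d\<^sub>e x v) \<le> D\<^sub>e \<and>
        r = cond_mutual_info (joint_pmf PXY W))"

definition max_rate_distortion ::
    "('x::finite \<Rightarrow> 'y::finite \<Rightarrow> real) \<Rightarrow> ('x \<Rightarrow> 'v::finite \<Rightarrow> real) \<Rightarrow>
     'x pmf \<Rightarrow> real \<Rightarrow> real \<Rightarrow> real" where
  "max_rate_distortion d d\<^sub>e Q D D\<^sub>e =
     (GREATEST r. \<exists>K :: 'x \<Rightarrow> 'y pmf.
        measure_pmf.expectation (joint_pmf Q K) (\<lambda>(x, y). d x y) \<le> D \<and>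
        r = cond_rate_distortion d\<^sub>e (joint_pmf Q K) D\<^sub>e)"

text \<open>Note that \<^const>\<open>KL_divergence\<close> takes the reference measure first.\<close>

definition KL_div :: "'x pmf \<Rightarrow> 'x pmf \<Rightarrow> real" where
  "KL_div Q P = KL_divergence 2 (measure_pmf P) (measure_pmf Q)"

text \<open>Extended reals are needed because a guesser may have success probability \<open>0\<close>, which must
  count as exponent \<open>\<infinity>\<close>, whereas \<open>log 2 0 = 0\<close> in HOL.\<close>

definition neg_log2 :: "real \<Rightarrow> ereal" where
  "neg_log2 p = (if p = 0 then \<infinity> else ereal (- log 2 p))"

text \<open>Only the values of \<open>f\<close> and \<open>g\<close> on lists of length \<open>n\<close> matter.\<close>

definition randomized_maps ::
    "('x \<Rightarrow> 'y \<Rightarrow> real) \<Rightarrow> real \<Rightarrow> nat \<Rightarrow> ('x list \<Rightarrow> 'y list pmf) set" where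
  "randomized_maps d D n =
     {f. \<forall>xs. length xs = n \<longrightarrow>
          (\<forall>ys \<in> set_pmf (f xs). length ys = n \<and> avg_distortion d xs ys \<le> D)}"

definition guessers :: "nat \<Rightarrow> ('y list \<Rightarrow> 'v list) set" where
  "guessers n = {g. \<forall>ys. length ys = n \<longrightarrow> length (g ys) = n}"

definition success_prob ::
    "'x pmf \<Rightarrow> ('x \<Rightarrow> 'v \<Rightarrow> real) \<Rightarrow> real \<Rightarrow> nat \<Rightarrow>
     ('x list \<Rightarrow> 'y list pmf) \<Rightarrow> ('y list \<Rightarrow> 'v list) \<Rightarrow> real" where
  "success_prob P d\<^sub>e D\<^sub>e n f g =
     measure_pmf.prob (joint_pmf (replicate_pmf n P) f)
       {(xs, ys). avg_distortion d\<^sub>e xs (g ys) \<le> D\<^sub>e}"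

definition exponent_at ::
    "'x::finite pmf \<Rightarrow> ('x \<Rightarrow> 'y::finite \<Rightarrow> real) \<Rightarrow> ('x \<Rightarrow> 'v::finite \<Rightarrow> real) \<Rightarrow>
     real \<Rightarrow> real \<Rightarrow> nat \<Rightarrow> ereal" where
  "exponent_at P d d\<^sub>e D D\<^sub>e n =
     (GREATEST e. \<exists>f \<in> randomized_maps d D n. e =
        (LEAST e'. \<exists>g \<in> guessers n.
           e' = ereal (1 / real n) * neg_log2 (success_prob P d\<^sub>e D\<^sub>e n f g)))"

definition exponent ::
    "'x::finite pmf \<Rightarrow> ('x \<Rightarrow> 'y::finite \<Rightarrow> real) \<Rightarrow> ('x \<Rightarrow> 'v::finite \<Rightarrow> real) \<Rightarrow>
     real \<Rightarrow> real \<Rightarrow> ereal" where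
  "exponent P d d\<^sub>e D D\<^sub>e = lim (exponent_at P d d\<^sub>e D D\<^sub>e)"

end

theory Submission
  imports Defs "HOL-Real_Asymp.Real_Asymp" "HOL-Combinatorics.Multiset_Permutations"
begin

text \<open>
  The method of types. A type is a multiset, its type class is the set of its permutations, and
  Stirling's bounds give its cardinality as \<open>2 powr (n H)\<close> up to a polynomial factor.

  Both \<open>R(J, D\<^sub>e)\<close> and \<open>R(Q, D, D\<^sub>e)\<close> are optimal values of a uniformly continuous function over
  joint laws with prescribed marginal and bounded expected cost. Such a feasible set depends
  Lipschitz-continuously on the marginal, so optimal values are attained and uniformly continuous;
  and a feasible law with type marginal can be rounded to a feasible type by moving the rounding
  error to a symbol of least cost.

  Against any map, a guesser who draws \<open>v\<close> given \<open>y\<close> uniformly over conditional type classes hits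
  the optimal joint type with probability about \<open>2 powr (- n I(X;V|Y))\<close>. Conversely, if each \<open>x\<close>
  is mapped uniformly into the conditional type class of an optimal channel for its type, then
  given \<open>y\<close> the word \<open>x\<close> is uniform over a conditional type class, of which any \<open>v\<close> covers
  at most a fraction of about \<open>2 powr (- n R)\<close>. Summing over the polynomially many types leaves
  the least value of \<open>D(Q\<parallel>P) + R(Q, D, D\<^sub>e)\<close>.
\<close>

section \<open>Value functions of transport problems over finite alphabets\<close>

text \<open>The obstacle is that \<open>D\<close> and \<open>D\<^sub>e\<close> may equal their least
  admissible values. Then feasible laws can lack slack, so continuity in the marginal cannot come
  from mixing with a strictly feasible law; and since a map must respect \<open>D\<close> for every
  realization, a feasible law may not be replaced by a nearby type that is slightly infeasible.
  Hence displaced mass always goes to a cheapest symbol of its row, and the marginal is met exactly.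

  Joint laws with a fixed marginal replace channels: they form a compact set, and a channel's values
  at symbols of probability zero no longer matter.

  Both directions rest on one ratio of type class sizes, read in two ways: for fixed
  \<open>(x, y)\<close> it says how likely a random \<open>v\<close> fits, for fixed
  \<open>(y, v)\<close> what share of the \<open>x\<close> fits. Exact counting yields it, without
  covering or concentration arguments.

  At each fixed length the extrema must be attained as well. Guessers matter only on finitely many
  words, and randomized maps, viewed as probability tables, form a compact set.\<close>

lemma pmf_exists_finite:
  fixes f :: "'u::finite \<Rightarrow> real"
  assumes "\<And>u. 0 \<le> f u" "(\<Sum>u\<in>UNIV. f u) = 1"
  obtains p where "\<And>u. pmf p u = f u"
proof
  show "pmf (embed_pmf f) u = f u" for u
    using assms by (subst pmf_embed_pmf) (auto simp: nn_integral_count_space_finite)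
qed

lemma expectation_finite:
  fixes p :: "'u::finite pmf" and f :: "'u \<Rightarrow> real"
  shows "measure_pmf.expectation p f = (\<Sum>u\<in>UNIV. pmf p u * f u)"
  by (subst integral_measure_pmf_real[of UNIV]) (auto simp: mult.commute)

lemma pmf_map_finite:
  fixes p :: "'u::finite pmf"
  shows "pmf (map_pmf f p) a = (\<Sum>u\<in>f -` {a}. pmf p u)"
  by (simp add: pmf_map measure_measure_pmf_finite)

lemma pmf_map_fst_finite:
  fixes q :: "('a::finite \<times> 'b::finite) pmf"
  shows "pmf (map_pmf fst q) a = (\<Sum>b\<in>UNIV. pmf q (a, b))"
proof -
  have "fst -` {a} = Pair a ` (UNIV :: 'b set)" by auto
  then show ?thesis by (simp add: pmf_map_finite sum.reindex inj_on_def)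
qed

lemma sum_pmf_finite: "(\<Sum>u\<in>UNIV. pmf p u) = 1" for p :: "'u::finite pmf"
  by (rule sum_pmf_eq_1) auto

lemma sum_UNIV_prod: "(\<Sum>u\<in>UNIV. f u) = (\<Sum>a\<in>UNIV. \<Sum>b\<in>UNIV. f (a, b))"
  for f :: "'a::finite \<times> 'b::finite \<Rightarrow> 'c::comm_monoid_add"
  by (simp add: sum.cartesian_product flip: UNIV_Times_UNIV)

section \<open>Uniform continuity on the probability simplex\<close>

definition l1_dist :: "'u::finite pmf \<Rightarrow> 'u pmf \<Rightarrow> real" where
  "l1_dist p q = (\<Sum>u\<in>UNIV. \<bar>pmf p u - pmf q u\<bar>)"

text \<open>Uniform, because one modulus must serve all types of length \<open>n\<close> at
  once.\<close>

definition unif_cont :: "('u::finite pmf \<Rightarrow> real) \<Rightarrow> bool" where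
  "unif_cont \<Phi> \<longleftrightarrow> (\<forall>\<epsilon>>0. \<exists>\<delta>>0. \<forall>p q. l1_dist p q < \<delta> \<longrightarrow> \<bar>\<Phi> p - \<Phi> q\<bar> < \<epsilon>)"

lemma unif_contD:
  assumes "unif_cont \<Phi>" "\<epsilon> > 0"
  obtains \<delta> where "\<delta> > 0" "\<And>p q. l1_dist p q < \<delta> \<Longrightarrow> \<bar>\<Phi> p - \<Phi> q\<bar> < \<epsilon>"
  using assms unfolding unif_cont_def by blast

lemma l1_dist_nonneg: "0 \<le> l1_dist p q"
  by (simp add: l1_dist_def sum_nonneg)

lemma l1_dist_sym: "l1_dist p q = l1_dist q p"
  by (simp add: l1_dist_def abs_minus_commute)

lemma abs_pmf_diff_le_l1_dist: "\<bar>pmf p u - pmf q u\<bar> \<le> l1_dist p q"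
  unfolding l1_dist_def by (rule member_le_sum) auto

text \<open>Merging symbols only cancels differences: the triangle inequality within each fiber.
  Hence functionals of marginals inherit continuity.\<close>

lemma l1_dist_map_pmf: "l1_dist (map_pmf f p) (map_pmf f q) \<le> l1_dist p q"
proof -
  have "l1_dist (map_pmf f p) (map_pmf f q)
      = (\<Sum>a\<in>UNIV. \<bar>\<Sum>u\<in>f -` {a}. pmf p u - pmf q u\<bar>)"
    by (simp add: l1_dist_def pmf_map_finite sum_subtractf)
  also have "\<dots> \<le> (\<Sum>a\<in>UNIV. \<Sum>u\<in>f -` {a}. \<bar>pmf p u - pmf q u\<bar>)"
    by (intro sum_mono sum_abs)
  also have "\<dots> = (\<Sum>u\<in>UNIV. \<bar>pmf p u - pmf q u\<bar>)"
    using sum.group[of UNIV UNIV f "\<lambda>u. \<bar>pmf p u - pmf q u\<bar>"] by (simp add: vimage_def)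
  finally show ?thesis by (simp add: l1_dist_def)
qed

lemma unif_cont_map_pmf:
  assumes "unif_cont \<Phi>" shows "unif_cont (\<lambda>p. \<Phi> (map_pmf f p))"
  unfolding unif_cont_def
proof (intro allI impI)
  fix \<epsilon> :: real assume "\<epsilon> > 0"
  then obtain \<delta> where "\<delta> > 0" "\<And>p q. l1_dist p q < \<delta> \<Longrightarrow> \<bar>\<Phi> p - \<Phi> q\<bar> < \<epsilon>"
    using assms unif_contD by blast
  then show "\<exists>\<delta>>0. \<forall>p q. l1_dist p q < \<delta> \<longrightarrow> \<bar>\<Phi> (map_pmf f p) - \<Phi> (map_pmf f q)\<bar> < \<epsilon>"
    using l1_dist_map_pmf[of f] by (meson le_less_trans)
qed

lemma unif_cont_add:
  assumes "unif_cont \<Phi>" "unif_cont \<Psi>" shows "unif_cont (\<lambda>p. \<Phi> p + \<Psi> p)"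
  unfolding unif_cont_def
proof (intro allI impI)
  fix \<epsilon> :: real assume "\<epsilon> > 0"
  then have e: "\<epsilon>/2 > 0" by simp
  obtain \<delta>1 where d1: "\<delta>1 > 0" "\<And>p q. l1_dist p q < \<delta>1 \<Longrightarrow> \<bar>\<Phi> p - \<Phi> q\<bar> < \<epsilon>/2"
    using unif_contD[OF assms(1) e] by blast
  obtain \<delta>2 where d2: "\<delta>2 > 0" "\<And>p q. l1_dist p q < \<delta>2 \<Longrightarrow> \<bar>\<Psi> p - \<Psi> q\<bar> < \<epsilon>/2"
    using unif_contD[OF assms(2) e] by blast
  show "\<exists>\<delta>>0. \<forall>p q. l1_dist p q < \<delta> \<longrightarrow> \<bar>\<Phi> p + \<Psi> p - (\<Phi> q + \<Psi> q)\<bar> < \<epsilon>"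
  proof (intro exI[of _ "min \<delta>1 \<delta>2"] conjI allI impI)
    fix p q :: "'a pmf" assume "l1_dist p q < min \<delta>1 \<delta>2"
    then show "\<bar>\<Phi> p + \<Psi> p - (\<Phi> q + \<Psi> q)\<bar> < \<epsilon>"
      using d1(2)[of p q] d2(2)[of p q] by (simp add: abs_if split: if_splits)
  qed (use d1 d2 in auto)
qed

lemma unif_cont_uminus: "unif_cont \<Phi> \<Longrightarrow> unif_cont (\<lambda>p. - \<Phi> p)"
  by (simp add: unif_cont_def abs_minus_commute)

lemma unif_cont_diff:
  "unif_cont \<Phi> \<Longrightarrow> unif_cont \<Psi> \<Longrightarrow> unif_cont (\<lambda>p. \<Phi> p - \<Psi> p)"
  using unif_cont_add[of \<Phi> "\<lambda>p. - \<Psi> p"] unif_cont_uminus[of \<Psi>] by simp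

lemma unif_cont_sum:
  assumes "finite A" "\<And>i. i \<in> A \<Longrightarrow> unif_cont (\<Phi> i)"
  shows "unif_cont (\<lambda>p. \<Sum>i\<in>A. \<Phi> i p)"
  using assms
proof (induction A)
  case empty
  then show ?case by (auto simp: unif_cont_def intro: exI[of _ 1])
next
  case (insert i A)
  then show ?case by (simp add: unif_cont_add)
qed

lemma unif_cont_pmf:
  assumes "continuous_on {0..1} h"
  shows "unif_cont (\<lambda>p. h (pmf p u))"
  unfolding unif_cont_def
proof (intro allI impI)
  fix \<epsilon> :: real assume "\<epsilon> > 0"
  have "uniformly_continuous_on {0..1} h"
    using assms compact_uniformly_continuous by blast
  then obtain \<delta> where d: "\<delta> > 0"
    "\<And>s t. s \<in> {0..1} \<Longrightarrow> t \<in> {0..1} \<Longrightarrow> dist t s < \<delta> \<Longrightarrow> dist (h t) (h s) < \<epsilon>"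
    using \<open>\<epsilon> > 0\<close> unfolding uniformly_continuous_on_def by metis
  show "\<exists>\<delta>>0. \<forall>p q. l1_dist p q < \<delta> \<longrightarrow> \<bar>h (pmf p u) - h (pmf q u)\<bar> < \<epsilon>"
  proof (intro exI[of _ \<delta>] conjI allI impI)
    fix p q :: "'a pmf" assume *: "l1_dist p q < \<delta>"
    have "dist (pmf p u) (pmf q u) < \<delta>"
      using abs_pmf_diff_le_l1_dist[of p u q] * by (simp add: dist_real_def)
    then show "\<bar>h (pmf p u) - h (pmf q u)\<bar> < \<epsilon>"
      using d(2)[of "pmf q u" "pmf p u"] by (simp add: dist_real_def pmf_le_1)
  qed (use d in auto)
qed

text \<open>Listing the masses embeds laws into a finite-dimensional space, where \<open>S\<close>
  has a bounded and closed image, so compactness applies. Closedness is phrased by pointwise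
  convergence of masses, under which linear constraints pass to the limit.\<close>

lemma unif_cont_attains_inf:
  fixes S :: "'u::finite pmf set"
  assumes "unif_cont \<Phi>" "S \<noteq> {}"
    and closed: "\<And>s l. (\<And>n. s n \<in> S) \<Longrightarrow> (\<And>u. (\<lambda>n. pmf (s n) u) \<longlonglongrightarrow> pmf l u) \<Longrightarrow> l \<in> S"
  obtains p where "p \<in> S" "\<And>q. q \<in> S \<Longrightarrow> \<Phi> p \<le> \<Phi> q"
proof -
  define vec :: "'u pmf \<Rightarrow> real ^ 'u" where "vec p = (\<chi> u. pmf p u)" for p
  define V where "V = vec ` S"
  have inj: "p = q" if "vec p = vec q" for p q
    using that by (intro pmf_eqI) (metis vec_def vec_lambda_beta)
  have "bounded V"
  proof (rule boundedI)
    fix x assume "x \<in> V"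
    then obtain p where p: "x = vec p" by (auto simp: V_def)
    have "norm x \<le> (\<Sum>u\<in>UNIV. \<bar>x $ u\<bar>)" by (rule norm_le_l1_cart)
    also have "\<dots> = 1" by (simp add: p vec_def sum_pmf_finite)
    finally show "norm x \<le> 1" .
  qed
  moreover have "closed V"
    unfolding closed_sequential_limits
  proof (intro allI impI)
    fix x l assume xl: "(\<forall>n. x n \<in> V) \<and> x \<longlonglongrightarrow> l"
    then have "\<forall>n. \<exists>p\<in>S. x n = vec p" by (auto simp: V_def)
    then obtain s where s: "\<And>n. s n \<in> S" "\<And>n. x n = vec (s n)" by metis
    have lim: "(\<lambda>n. pmf (s n) u) \<longlonglongrightarrow> l $ u" for u
      using tendsto_vec_nth[of x l sequentially u] xl unfolding s vec_def by simp
    \<comment> \<open>No mass escapes on a finite alphabet, so the limit vector is again a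
      law.\<close>
    have "(\<lambda>n. \<Sum>u\<in>UNIV. pmf (s n) u) \<longlonglongrightarrow> (\<Sum>u\<in>UNIV. l $ u)"
      by (intro tendsto_sum lim)
    then have "(\<Sum>u\<in>UNIV. l $ u) = 1"
      by (simp add: sum_pmf_finite LIMSEQ_const_iff)
    moreover have "0 \<le> l $ u" for u
      by (rule LIMSEQ_le_const[OF lim]) auto
    ultimately obtain p where p: "\<And>u. pmf p u = l $ u"
      using pmf_exists_finite[of "\<lambda>u. l $ u"] by blast
    have "p \<in> S" using closed[of s p] s lim p by simp
    moreover have "l = vec p" by (simp add: vec_def p vec_eq_iff)
    ultimately show "l \<in> V" by (simp add: V_def)
  qed
  ultimately have "compact V" by (simp add: compact_eq_bounded_closed)
  define \<Psi> where "\<Psi> x = \<Phi> (inv vec x)" for x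
  have Psi: "\<Psi> (vec p) = \<Phi> p" for p
    unfolding \<Psi>_def by (metis inj inv_f_f injI)
  have "continuous_on V \<Psi>"
    unfolding continuous_on_iff
  proof (intro ballI allI impI)
    fix x and \<epsilon> :: real assume "x \<in> V" "\<epsilon> > 0"
    obtain \<delta> where d: "\<delta> > 0" "\<And>p q. l1_dist p q < \<delta> \<Longrightarrow> \<bar>\<Phi> p - \<Phi> q\<bar> < \<epsilon>"
      using unif_contD[OF assms(1) \<open>\<epsilon> > 0\<close>] by blast
    obtain p where p: "x = vec p" using \<open>x \<in> V\<close> by (auto simp: V_def)
    have c: "real CARD('u) > 0" by simp
    show "\<exists>d>0. \<forall>x'\<in>V. dist x' x < d \<longrightarrow> dist (\<Psi> x') (\<Psi> x) < \<epsilon>"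
    proof (intro exI[of _ "\<delta> / real CARD('u)"] conjI ballI impI)
      fix x' assume "x' \<in> V" and dist: "dist x' x < \<delta> / real CARD('u)"
      then obtain q where q: "x' = vec q" by (auto simp: V_def)
      have "l1_dist q p = (\<Sum>u\<in>UNIV. \<bar>(x' - x) $ u\<bar>)"
        by (simp add: l1_dist_def p q vec_def)
      also have "\<dots> \<le> (\<Sum>u\<in>(UNIV :: 'u set). norm (x' - x))"
        by (intro sum_mono component_le_norm_cart)
      also have "\<dots> = real CARD('u) * dist x' x" by (simp add: dist_norm)
      also have "\<dots> < \<delta>" using dist c by (simp add: field_simps)
      finally show "dist (\<Psi> x') (\<Psi> x) < \<epsilon>"
        using d(2) by (simp add: p q Psi dist_real_def)
    qed (use d c in auto)
  qed
  then obtain x where "x \<in> V" "\<And>y. y \<in> V \<Longrightarrow> \<Psi> x \<le> \<Psi> y"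
    using continuous_attains_inf[OF \<open>compact V\<close>] assms(2) by (metis V_def image_is_empty)
  then show ?thesis
    using that by (metis Psi V_def image_iff)
qed

section \<open>Laws with prescribed marginal and bounded expected cost\<close>

definition constrained :: "('a::finite \<Rightarrow> 'b::finite \<Rightarrow> real) \<Rightarrow> real \<Rightarrow> 'a pmf \<Rightarrow> ('a \<times> 'b) pmf set" where
  "constrained c B J = {q. map_pmf fst q = J \<and>
     measure_pmf.expectation q (\<lambda>(a, b). c a b) \<le> B}"

lemma expectation_pair_finite:
  fixes q :: "('a::finite \<times> 'b::finite) pmf"
  shows "measure_pmf.expectation q (\<lambda>(a, b). c a b) = (\<Sum>a\<in>UNIV. \<Sum>b\<in>UNIV. pmf q (a, b) * c a b)"
  by (simp add: expectation_finite sum_UNIV_prod)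

lemma ex_min_finite: "\<exists>b. \<forall>b'. f b \<le> f b'" for f :: "'b::finite \<Rightarrow> real"
proof -
  have "Min (range f) \<in> range f" by (rule Min_in) auto
  then obtain b where "Min (range f) = f b" by (meson imageE)
  then show ?thesis by (metis Min_le finite finite_imageI rangeI)
qed

text \<open>\<open>r\<close> is the part of \<open>q\<close> left in place; what row
  \<open>a\<close> still lacks goes to the single symbol \<open>m a\<close>. As much mass is added
  as was removed, whence the factor 2. The cost is written relative to \<open>c a (m a)\<close> so
  that, when \<open>m a\<close> is cheapest, it is visibly monotone in \<open>r\<close>.\<close>

lemma fill_up:
  fixes q :: "('a::finite \<times> 'b::finite) pmf" and m :: "'a \<Rightarrow> 'b"
  assumes r: "\<And>a b. 0 \<le> r a b" "\<And>a b. r a b \<le> pmf q (a, b)"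
    "\<And>a. (\<Sum>b\<in>UNIV. r a b) \<le> pmf J a"
  obtains q' where "\<And>a b. pmf q' (a, b) = r a b + (if b = m a then pmf J a - (\<Sum>b\<in>UNIV. r a b) else 0)"
    "map_pmf fst q' = J"
    "measure_pmf.expectation q' (\<lambda>(a, b). c a b) =
       (\<Sum>a\<in>UNIV. pmf J a * c a (m a)) + (\<Sum>a\<in>UNIV. \<Sum>b\<in>UNIV. r a b * (c a b - c a (m a)))"
    "l1_dist q q' \<le> 2 * (1 - (\<Sum>a\<in>UNIV. \<Sum>b\<in>UNIV. r a b))"
proof -
  define f where "f = (\<lambda>(a, b). r a b + (if b = m a then pmf J a - (\<Sum>b\<in>UNIV. r a b) else 0))"
  have f1: "(\<Sum>b\<in>UNIV. f (a, b)) = pmf J a" for a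
    by (simp add: f_def sum.distrib)
  have f0: "0 \<le> f u" for u
    using r by (auto simp: f_def split: prod.splits)
  have "(\<Sum>u\<in>UNIV. f u) = 1"
    by (simp add: sum_UNIV_prod f1 sum_pmf_finite)
  with f0 obtain q' where q': "\<And>u. pmf q' u = f u"
    using pmf_exists_finite by blast
  have m: "map_pmf fst q' = J"
    by (rule pmf_eqI) (simp add: pmf_map_fst_finite q' f1)
  have "measure_pmf.expectation q' (\<lambda>(a, b). c a b) =
       (\<Sum>a\<in>UNIV. (\<Sum>b\<in>UNIV. r a b * c a b) + (pmf J a - (\<Sum>b\<in>UNIV. r a b)) * c a (m a))"
    unfolding expectation_pair_finite q'
    by (intro sum.cong) (simp_all add: f_def distrib_right sum.distrib if_distrib[of "\<lambda>t. t * _"] cong: if_cong)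
  also have "\<dots> = (\<Sum>a\<in>UNIV. pmf J a * c a (m a)) + (\<Sum>a\<in>UNIV. \<Sum>b\<in>UNIV. r a b * (c a b - c a (m a)))"
    unfolding sum.distrib[symmetric]
    by (intro sum.cong) (simp_all add: algebra_simps sum_subtractf sum_distrib_left sum_distrib_right)
  finally have E: "measure_pmf.expectation q' (\<lambda>(a, b). c a b) = \<dots>" .
  have "l1_dist q q' \<le> (\<Sum>a\<in>UNIV. \<Sum>b\<in>UNIV. (pmf q (a, b) - r a b) + (if b = m a then pmf J a - (\<Sum>b\<in>UNIV. r a b) else 0))"
    unfolding l1_dist_def sum_UNIV_prod q'
  proof (intro sum_mono)
    fix a b show "\<bar>pmf q (a, b) - f (a, b)\<bar>
         \<le> pmf q (a, b) - r a b + (if b = m a then pmf J a - sum (r a) UNIV else 0)"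
      using r(2)[of a b] r(3)[of a] by (auto simp: f_def)
  qed
  also have "\<dots> = (\<Sum>u\<in>UNIV. pmf q u) - (\<Sum>a\<in>UNIV. \<Sum>b\<in>UNIV. r a b)
      + ((\<Sum>a\<in>UNIV. pmf J a) - (\<Sum>a\<in>UNIV. \<Sum>b\<in>UNIV. r a b))"
    unfolding sum.distrib sum_subtractf sum_UNIV_prod by (simp add: sum_subtractf)
  also have "\<dots> = 2 * (1 - (\<Sum>a\<in>UNIV. \<Sum>b\<in>UNIV. r a b))"
    by (simp add: sum_pmf_finite[of q] sum_pmf_finite[of J])
  finally have "l1_dist q q' \<le> \<dots>" .
  with m E q' show ?thesis
    using that by (auto simp: f_def)
qed

lemma sum_pmf_fst_finite:
  fixes q :: "('a::finite \<times> 'b::finite) pmf"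
  assumes "map_pmf fst q = J"
  shows "(\<Sum>b\<in>UNIV. pmf q (a, b)) = pmf J a"
  using pmf_map_fst_finite[of q a] assms by simp

text \<open>Rounding each mass down to a multiple of \<open>1 / n\<close> leaves in every row a
  remainder that is again such a multiple, because the marginal is. Sending it to a cheapest symbol
  cannot raise the cost, and each cell loses at most \<open>1 / n\<close>.\<close>

lemma constrained_round:
  fixes c :: "'a::finite \<Rightarrow> 'b::finite \<Rightarrow> real"
  assumes q: "q \<in> constrained c B J" and n: "n > 0"
    and J: "\<And>a. real n * pmf J a \<in> \<nat>"
  obtains q' where "q' \<in> constrained c B J" "\<And>u. real n * pmf q' u \<in> \<nat>"
    "l1_dist q q' \<le> 2 * real CARD('a \<times> 'b) / real n"
proof -
  have "\<exists>b. \<forall>b'. c a b \<le> c a b'" for a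
    by (rule ex_min_finite)
  then obtain m where m: "\<And>a b. c a (m a) \<le> c a b" by metis
  define r where "r a b = \<lfloor>real n * pmf q (a, b)\<rfloor> / real n" for a b
  have marg: "map_pmf fst q = J" and cost: "measure_pmf.expectation q (\<lambda>(a, b). c a b) \<le> B"
    using q by (auto simp: constrained_def)
  have r0: "0 \<le> r a b" for a b by (simp add: r_def)
  have r1: "r a b \<le> pmf q (a, b)" for a b
    using n of_int_floor_le[of "real n * pmf q (a, b)"] by (simp add: r_def field_simps)
  have r2: "(\<Sum>b\<in>UNIV. r a b) \<le> pmf J a" for a
    using sum_mono[of UNIV "r a" "\<lambda>b. pmf q (a, b)"] r1 sum_pmf_fst_finite[OF marg] by simp
  obtain q' where q': "\<And>a b. pmf q' (a, b) = r a b + (if b = m a then pmf J a - (\<Sum>b\<in>UNIV. r a b) else 0)"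
    "map_pmf fst q' = J"
    "measure_pmf.expectation q' (\<lambda>(a, b). c a b) =
       (\<Sum>a\<in>UNIV. pmf J a * c a (m a)) + (\<Sum>a\<in>UNIV. \<Sum>b\<in>UNIV. r a b * (c a b - c a (m a)))"
    "l1_dist q q' \<le> 2 * (1 - (\<Sum>a\<in>UNIV. \<Sum>b\<in>UNIV. r a b))"
    using fill_up[of r q J m c, OF r0 r1 r2] by blast
  have "(\<Sum>a\<in>UNIV. \<Sum>b\<in>UNIV. r a b * (c a b - c a (m a)))
      \<le> (\<Sum>a\<in>UNIV. \<Sum>b\<in>UNIV. pmf q (a, b) * (c a b - c a (m a)))"
    by (intro sum_mono mult_right_mono r1) (simp add: m)
  also have "\<dots> = measure_pmf.expectation q (\<lambda>(a, b). c a b) - (\<Sum>a\<in>UNIV. pmf J a * c a (m a))"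
    unfolding expectation_pair_finite sum_subtractf[symmetric]
    by (intro sum.cong) (simp_all add: right_diff_distrib sum_subtractf flip: sum_distrib_right sum_pmf_fst_finite[OF marg])
  finally have "measure_pmf.expectation q' (\<lambda>(a, b). c a b) \<le> B"
    using q'(3) cost by linarith
  then have "q' \<in> constrained c B J" using q'(2) by (simp add: constrained_def)
  moreover have "real n * pmf q' u \<in> \<nat>" for u
  proof (cases u)
    case (Pair a b)
    have rn: "real n * r a b = of_int \<lfloor>real n * pmf q (a, b)\<rfloor>" for a b
      using n by (simp add: r_def)
    have "real n * pmf q' u = of_int (\<lfloor>real n * pmf q (a, b)\<rfloor> + (if b = m a then
        \<lfloor>real n * pmf J a\<rfloor> - (\<Sum>b\<in>UNIV. \<lfloor>real n * pmf q (a, b)\<rfloor>) else 0))"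
      using J[of a] Pair q'(1)
      by (auto simp: algebra_simps sum_distrib_left Nats_def sum_distrib_left simp flip: rn)
    then have "real n * pmf q' u \<in> \<int>" by (metis Ints_of_int)
    then show ?thesis by (simp add: Nats_altdef2)
  qed
  moreover have "1 - (\<Sum>a\<in>UNIV. \<Sum>b\<in>UNIV. r a b) \<le> real CARD('a \<times> 'b) / real n"
  proof -
    have "pmf q (a, b) \<le> (\<lfloor>real n * pmf q (a, b)\<rfloor> + 1) / real n" for a b
      using n real_of_int_floor_add_one_ge[of "real n * pmf q (a, b)"]
      by (simp add: pos_le_divide_eq mult.commute)
    then have "pmf q (a, b) - r a b \<le> 1 / real n" for a b
      by (simp add: r_def add_divide_distrib algebra_simps)
    then have "(\<Sum>a\<in>UNIV. \<Sum>b\<in>UNIV. pmf q (a, b) - r a b)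
        \<le> (\<Sum>a\<in>(UNIV :: 'a set). \<Sum>b\<in>(UNIV :: 'b set). 1 / real n)"
      by (intro sum_mono)
    then show ?thesis
      using sum_pmf_finite[of q] by (simp add: sum_subtractf sum_UNIV_prod)
  qed
  then have "l1_dist q q' \<le> 2 * real CARD('a \<times> 'b) / real n"
    using q'(4) by simp
  ultimately show ?thesis using that by blast
qed

text \<open>Beyond the mass forced by the change of marginal, only mass on symbols of non-minimal cost is
  moved. That mass is at most the slack divided by the least positive gap, so the bound stays
  Lipschitz even when \<open>B\<close> is the least feasible cost.\<close>

lemma constrained_perturb:
  fixes c :: "'a::finite \<Rightarrow> 'b::finite \<Rightarrow> real"
  assumes B: "\<And>a. \<exists>b. c a b \<le> B"
  obtains C where "C > 0" "\<And>J J' q. q \<in> constrained c B J \<Longrightarrow>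
    \<exists>q' \<in> constrained c B J'. l1_dist q q' \<le> C * l1_dist J J'"
proof -
  have "\<exists>b. \<forall>b'. c a b \<le> c a b'" for a
    by (rule ex_min_finite)
  then obtain m where m: "\<And>a b. c a (m a) \<le> c a b" by metis
  have mB: "c a (m a) \<le> B" for a using B[of a] m by (meson order_trans)
  define gap where "gap a b = c a b - c a (m a)" for a b
  have gap0: "0 \<le> gap a b" for a b by (simp add: gap_def m)
  \<comment> \<open>The element 1 keeps the set nonempty when all symbols of each row cost the
    same.\<close>
  define G where "G = insert 1 {gap a b | a b. gap a b > 0}"
  have "G = insert 1 ((\<lambda>(a, b). gap a b) ` {(a, b). gap a b > 0})"
    by (auto simp: G_def)
  then have finG: "finite G" by simp
  define \<gamma> where "\<gamma> = Min G"
  have gamma: "\<gamma> > 0" "\<And>a b. gap a b > 0 \<Longrightarrow> \<gamma> \<le> gap a b"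
    using finG by (auto simp: \<gamma>_def G_def intro!: Min_le)
  define K where "K = (\<Sum>a\<in>UNIV. \<bar>c a (m a)\<bar>)"
  have K: "\<bar>c a (m a)\<bar> \<le> K" for a
    unfolding K_def by (rule member_le_sum) auto
  have K0: "K \<ge> 0" by (simp add: K_def sum_nonneg)
  \<comment> \<open>The 1 pays for rescaling rows, \<open>K / \<gamma>\<close> for mass moved off
    non-cheapest symbols, and the 2 for removing mass and adding it back.\<close>
  define C where "C = 2 * (1 + K / \<gamma>)"
  have "\<exists>q' \<in> constrained c B J'. l1_dist q q' \<le> C * l1_dist J J'"
    if q: "q \<in> constrained c B J" for J J' q
  proof -
    have marg: "map_pmf fst q = J" and cost: "measure_pmf.expectation q (\<lambda>(a, b). c a b) \<le> B"
      using q by (auto simp: constrained_def)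
    note sumq = sum_pmf_fst_finite[OF marg]
    \<comment> \<open>The slack: what the budget leaves above the least cost possible with that
      marginal. The excess cost of \<open>q\<close> is at most \<open>s J\<close> and has to be
      brought below \<open>s J'\<close>.\<close>
    define s where "s J = B - (\<Sum>a\<in>UNIV. pmf J a * c a (m a))" for J
    have s0: "s J \<ge> 0" for J
    proof -
      have "(\<Sum>a\<in>UNIV. pmf J a * c a (m a)) \<le> (\<Sum>a\<in>UNIV. pmf J a * B)"
        by (intro sum_mono mult_left_mono mB) simp
      then show ?thesis by (simp add: s_def sum_pmf_finite flip: sum_distrib_right)
    qed
    have sq: "(\<Sum>a\<in>UNIV. \<Sum>b\<in>UNIV. pmf q (a, b) * gap a b) \<le> s J"
    proof -
      have "(\<Sum>a\<in>UNIV. \<Sum>b\<in>UNIV. pmf q (a, b) * gap a b)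
        = measure_pmf.expectation q (\<lambda>(a, b). c a b) - (\<Sum>a\<in>UNIV. pmf J a * c a (m a))"
        unfolding expectation_pair_finite sum_subtractf[symmetric] gap_def
        by (intro sum.cong) (simp_all add: right_diff_distrib sum_subtractf flip: sum_distrib_right sumq)
      then show ?thesis using cost by (simp add: s_def)
    qed
    define \<Delta> where "\<Delta> = max 0 (s J - s J')"
    \<comment> \<open>The fraction of non-cheapest mass to move, just enough to scale an excess of
      \<open>s J\<close> down to \<open>s J'\<close>. If \<open>s J = 0\<close> then
      \<open>\<Delta> = 0\<close> too, so the division by zero is harmless.\<close>
    define \<theta> where "\<theta> = \<Delta> / s J"
    have lam: "0 \<le> \<theta>" "\<theta> \<le> 1" "\<theta> * s J = \<Delta>" "(1 - \<theta>) * s J \<le> s J'"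
    proof -
      show "0 \<le> \<theta>" using s0[of J] by (simp add: \<theta>_def \<Delta>_def)
      show "\<theta> \<le> 1" using s0[of J] s0[of J'] by (auto simp: \<theta>_def \<Delta>_def divide_le_eq_1)
      show *: "\<theta> * s J = \<Delta>"
        using s0[of J'] s0[of J] by (cases "s J = 0") (simp_all add: \<theta>_def \<Delta>_def)
      show "(1 - \<theta>) * s J \<le> s J'"
        unfolding left_diff_distrib * by (simp add: \<Delta>_def)
    qed
    have Del: "\<Delta> \<le> K * l1_dist J J'"
    proof -
      have "s J - s J' = (\<Sum>a\<in>UNIV. (pmf J' a - pmf J a) * c a (m a))"
        by (simp add: s_def left_diff_distrib sum_subtractf)
      also have "\<dots> \<le> (\<Sum>a\<in>UNIV. \<bar>pmf J a - pmf J' a\<bar> * K)"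
      proof (intro sum_mono)
        fix a
        have "(pmf J' a - pmf J a) * c a (m a) \<le> \<bar>pmf J' a - pmf J a\<bar> * \<bar>c a (m a)\<bar>"
          by (metis abs_ge_self abs_mult)
        also have "\<dots> \<le> \<bar>pmf J' a - pmf J a\<bar> * K"
          by (intro mult_left_mono K) simp
        finally show "(pmf J' a - pmf J a) * c a (m a) \<le> \<bar>pmf J a - pmf J' a\<bar> * K"
          by (simp add: abs_minus_commute)
      qed
      also have "\<dots> = K * l1_dist J J'" by (simp add: l1_dist_def sum_distrib_left mult.commute)
      finally show ?thesis
        using K0 l1_dist_nonneg[of J J'] by (auto simp: \<Delta>_def)
    qed
    \<comment> \<open>Row \<open>a\<close> is shrunk only as far as needed to fit under the new
      marginal, so it loses at most \<open>\<bar>pmf J a - pmf J' a\<bar>\<close>.\<close>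
    define \<mu> where "\<mu> a = min 1 (pmf J' a / pmf J a)" for a
    have mu: "0 \<le> \<mu> a" "\<mu> a \<le> 1" for a by (auto simp: \<mu>_def)
    define bad where "bad a b = (if gap a b > 0 then 1 else 0 :: real)" for a b
    define r where "r a b = pmf q (a, b) * \<mu> a * (1 - \<theta> * bad a b)" for a b
    have lb: "0 \<le> 1 - \<theta> * bad a b" "1 - \<theta> * bad a b \<le> 1" for a b
      using lam by (auto simp: bad_def)
    have r0: "0 \<le> r a b" for a b unfolding r_def using mu lb by simp
    have r1': "r a b \<le> pmf q (a, b) * \<mu> a" for a b
      unfolding r_def using mu lb by (intro mult_left_le) auto
    have r1: "r a b \<le> pmf q (a, b)" for a b
      using r1' mult_left_le[of "\<mu> a" "pmf q (a, b)"] mu by (meson order_trans pmf_nonneg)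
    have r2: "(\<Sum>b\<in>UNIV. r a b) \<le> pmf J' a" for a
    proof -
      have "(\<Sum>b\<in>UNIV. r a b) \<le> (\<Sum>b\<in>UNIV. pmf q (a, b) * \<mu> a)"
        by (intro sum_mono r1')
      also have "\<dots> = pmf J a * \<mu> a" by (simp only: sumq sum_distrib_right[symmetric])
      also have "\<dots> \<le> pmf J' a"
        using pmf_nonneg[of J a] pmf_nonneg[of J' a]
        by (cases "pmf J a = 0") (simp_all add: \<mu>_def min_def divide_le_eq_1 pos_divide_le_eq)
      finally show ?thesis .
    qed
    obtain q' where q': "map_pmf fst q' = J'"
      "measure_pmf.expectation q' (\<lambda>(a, b). c a b) =
         (\<Sum>a\<in>UNIV. pmf J' a * c a (m a)) + (\<Sum>a\<in>UNIV. \<Sum>b\<in>UNIV. r a b * (c a b - c a (m a)))"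
      "l1_dist q q' \<le> 2 * (1 - (\<Sum>a\<in>UNIV. \<Sum>b\<in>UNIV. r a b))"
      by (rule fill_up[of r q J' m c, OF r0 r1 r2])
    have "(\<Sum>a\<in>UNIV. \<Sum>b\<in>UNIV. r a b * (c a b - c a (m a)))
        \<le> (\<Sum>a\<in>UNIV. \<Sum>b\<in>UNIV. (1 - \<theta>) * (pmf q (a, b) * gap a b))"
    proof (intro sum_mono)
      fix a b
      have "r a b * gap a b \<le> pmf q (a, b) * (1 - \<theta> * bad a b) * gap a b"
        unfolding r_def using mu(2) gap0 lb(1)
        by (intro mult_right_mono) (simp_all add: mult_left_le)
      also have "\<dots> = (1 - \<theta>) * (pmf q (a, b) * gap a b)"
        using gap0[of a b] by (auto simp: bad_def)
      finally show "r a b * (c a b - c a (m a)) \<le> (1 - \<theta>) * (pmf q (a, b) * gap a b)"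
        by (simp add: gap_def)
    qed
    also have "\<dots> = (1 - \<theta>) * (\<Sum>a\<in>UNIV. \<Sum>b\<in>UNIV. pmf q (a, b) * gap a b)"
      by (simp add: sum_distrib_left)
    also have "\<dots> \<le> (1 - \<theta>) * s J" using sq lam by (intro mult_left_mono) auto
    also have "\<dots> \<le> s J'" by (rule lam)
    finally have "q' \<in> constrained c B J'"
      using q' by (simp add: constrained_def s_def)
    moreover have "l1_dist q q' \<le> C * l1_dist J J'"
    proof -
      have "1 - (\<Sum>a\<in>UNIV. \<Sum>b\<in>UNIV. r a b) = (\<Sum>a\<in>UNIV. \<Sum>b\<in>UNIV. pmf q (a, b) - r a b)"
        using sum_pmf_finite[of q] by (simp add: sum_subtractf sum_UNIV_prod)
      also have "\<dots> \<le> (\<Sum>a\<in>UNIV. \<Sum>b\<in>UNIV. pmf q (a, b) * (1 - \<mu> a) + \<theta> / \<gamma> * (pmf q (a, b) * gap a b))"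
      proof (intro sum_mono)
        fix a b
        have "\<mu> a * (\<theta> * bad a b) \<le> 1 * (\<theta> * bad a b)"
          using mu lam by (intro mult_right_mono) (auto simp: bad_def)
        moreover have "bad a b \<le> gap a b / \<gamma>"
          using gamma gap0[of a b] by (auto simp: bad_def)
        then have "\<theta> * bad a b \<le> \<theta> * (gap a b / \<gamma>)"
          using lam(1) by (rule mult_left_mono)
        ultimately have "\<mu> a * (\<theta> * bad a b) \<le> \<theta> / \<gamma> * gap a b" by simp
        then have "1 - \<mu> a * (1 - \<theta> * bad a b) \<le> 1 - \<mu> a + \<theta> / \<gamma> * gap a b"
          by (simp add: right_diff_distrib)
        then have "pmf q (a, b) * (1 - \<mu> a * (1 - \<theta> * bad a b))
            \<le> pmf q (a, b) * (1 - \<mu> a + \<theta> / \<gamma> * gap a b)"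
          by (rule mult_left_mono) simp
        then show "pmf q (a, b) - r a b \<le> pmf q (a, b) * (1 - \<mu> a) + \<theta> / \<gamma> * (pmf q (a, b) * gap a b)"
          by (simp add: r_def algebra_simps)
      qed
      also have "\<dots> = (\<Sum>a\<in>UNIV. pmf J a * (1 - \<mu> a)) + \<theta> / \<gamma> * (\<Sum>a\<in>UNIV. \<Sum>b\<in>UNIV. pmf q (a, b) * gap a b)"
        unfolding sum.distrib sumq[symmetric] sum_distrib_left sum_distrib_right ..
      also have "\<dots> \<le> l1_dist J J' + \<theta> / \<gamma> * s J"
      proof (intro add_mono mult_left_mono sq)
        show "(\<Sum>a\<in>UNIV. pmf J a * (1 - \<mu> a)) \<le> l1_dist J J'"
          unfolding l1_dist_def
        proof (intro sum_mono)
          fix a show "pmf J a * (1 - \<mu> a) \<le> \<bar>pmf J a - pmf J' a\<bar>"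
            by (cases "pmf J a = 0") (simp_all add: \<mu>_def min_def right_diff_distrib)
        qed
      qed (use lam gamma in auto)
      also have "\<theta> / \<gamma> * s J = \<Delta> / \<gamma>" using lam(3) by simp
      also have "\<dots> \<le> K * l1_dist J J' / \<gamma>"
        using Del gamma by (simp add: divide_right_mono)
      finally show ?thesis
        using q'(3) by (simp add: C_def distrib_right distrib_left)
    qed
    ultimately show ?thesis by blast
  qed
  moreover have "C > 0" using K0 gamma by (simp add: C_def add_pos_nonneg)
  ultimately show ?thesis using that by blast
qed

lemma constrained_nonempty:
  fixes c :: "'a::finite \<Rightarrow> 'b::finite \<Rightarrow> real"
  assumes "\<And>a. \<exists>b. c a b \<le> B"
  shows "constrained c B J \<noteq> {}"
proof -
  obtain m where m: "\<And>a. c a (m a) \<le> B" using assms by metis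
  have "measure_pmf.expectation (map_pmf (\<lambda>a. (a, m a)) J) (\<lambda>(a, b). c a b)
      = (\<Sum>a\<in>UNIV. pmf J a * c a (m a))"
    by (subst integral_map_pmf) (simp add: expectation_finite)
  also have "\<dots> \<le> (\<Sum>a\<in>UNIV. pmf J a * B)"
    by (intro sum_mono mult_left_mono m) simp
  also have "\<dots> = B" by (simp add: sum_pmf_finite flip: sum_distrib_right)
  finally have "map_pmf (\<lambda>a. (a, m a)) J \<in> constrained c B J"
    by (simp add: constrained_def map_pmf_comp)
  then show ?thesis by blast
qed

lemma constrained_closed:
  assumes s: "\<And>n. s n \<in> constrained c B J"
    and lim: "\<And>u. (\<lambda>n. pmf (s n) u) \<longlonglongrightarrow> pmf l u"
  shows "l \<in> constrained c B J"
proof -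
  have "pmf (map_pmf fst l) a = pmf J a" for a
  proof -
    have "(\<lambda>n. \<Sum>b\<in>UNIV. pmf (s n) (a, b)) \<longlonglongrightarrow> (\<Sum>b\<in>UNIV. pmf l (a, b))"
      by (intro tendsto_sum lim)
    moreover have "(\<Sum>b\<in>UNIV. pmf (s n) (a, b)) = pmf J a" for n
      using s[of n] by (simp add: constrained_def sum_pmf_fst_finite)
    ultimately show ?thesis by (simp add: LIMSEQ_const_iff pmf_map_fst_finite)
  qed
  then have "map_pmf fst l = J" by (rule pmf_eqI)
  moreover have "measure_pmf.expectation l (\<lambda>(a, b). c a b) \<le> B"
  proof (rule LIMSEQ_le_const2)
    show "(\<lambda>n. measure_pmf.expectation (s n) (\<lambda>(a, b). c a b))
        \<longlonglongrightarrow> measure_pmf.expectation l (\<lambda>(a, b). c a b)"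
      unfolding expectation_finite by (intro tendsto_intros lim)
    show "\<exists>N. \<forall>n\<ge>N. measure_pmf.expectation (s n) (\<lambda>(a, b). c a b) \<le> B"
      using s by (auto simp: constrained_def)
  qed
  ultimately show ?thesis by (simp add: constrained_def)
qed

section \<open>Optimal values: attainment and continuity\<close>

definition min_value ::
    "(('a::finite \<times> 'b::finite) pmf \<Rightarrow> real) \<Rightarrow> ('a \<Rightarrow> 'b \<Rightarrow> real) \<Rightarrow> real \<Rightarrow> 'a pmf \<Rightarrow> real" where
  "min_value \<Phi> c B J = Inf (\<Phi> ` constrained c B J)"

lemma min_value_attained:
  fixes c :: "'a::finite \<Rightarrow> 'b::finite \<Rightarrow> real"
  assumes "unif_cont \<Phi>" "\<And>a. \<exists>b. c a b \<le> B"
  obtains q where "q \<in> constrained c B J" "min_value \<Phi> c B J = \<Phi> q"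
    "\<And>q'. q' \<in> constrained c B J \<Longrightarrow> \<Phi> q \<le> \<Phi> q'"
proof -
  obtain q where q: "q \<in> constrained c B J" "\<And>q'. q' \<in> constrained c B J \<Longrightarrow> \<Phi> q \<le> \<Phi> q'"
    using unif_cont_attains_inf[OF assms(1) constrained_nonempty[of c B J, OF assms(2)]]
      constrained_closed by blast
  moreover have "Inf (\<Phi> ` constrained c B J) = \<Phi> q"
    using q by (intro cInf_eq_minimum) auto
  ultimately show ?thesis using that by (simp add: min_value_def)
qed

lemma min_value_le:
  fixes c :: "'a::finite \<Rightarrow> 'b::finite \<Rightarrow> real"
  assumes "unif_cont \<Phi>" "\<And>a. \<exists>b. c a b \<le> B" "q \<in> constrained c B J"
  shows "min_value \<Phi> c B J \<le> \<Phi> q"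
  using min_value_attained[of \<Phi> c B J, OF assms(1,2)] assms(3) by metis

text \<open>A minimizer for \<open>J\<close> is moved to a feasible law for \<open>J'\<close> at
  distance at most \<open>C * l1_dist J J'\<close>. As \<open>C\<close> is the same for all
  marginals the modulus is uniform, and exchanging the two marginals gives the other
  inequality.\<close>

lemma unif_cont_min_value:
  fixes c :: "'a::finite \<Rightarrow> 'b::finite \<Rightarrow> real"
  assumes \<Phi>: "unif_cont \<Phi>" and B: "\<And>a. \<exists>b. c a b \<le> B"
  shows "unif_cont (min_value \<Phi> c B)"
  unfolding unif_cont_def
proof (intro allI impI)
  fix \<epsilon> :: real assume "\<epsilon> > 0"
  obtain C where C: "C > 0" "\<And>J J' q. q \<in> constrained c B J \<Longrightarrow>
    \<exists>q' \<in> constrained c B J'. l1_dist q q' \<le> C * l1_dist J J'"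
    using constrained_perturb[of c B, OF B] by blast
  obtain \<delta> where d: "\<delta> > 0" "\<And>p q. l1_dist p q < \<delta> \<Longrightarrow> \<bar>\<Phi> p - \<Phi> q\<bar> < \<epsilon>"
    using unif_contD[OF \<Phi> \<open>\<epsilon> > 0\<close>] by blast
  have less: "min_value \<Phi> c B J' < min_value \<Phi> c B J + \<epsilon>" if dist: "l1_dist J J' < \<delta> / C" for J J'
  proof -
    obtain q where q: "q \<in> constrained c B J" "min_value \<Phi> c B J = \<Phi> q"
      using min_value_attained[of \<Phi> c B J, OF \<Phi> B] by metis
    then obtain q' where q': "q' \<in> constrained c B J'" "l1_dist q q' \<le> C * l1_dist J J'"
      using C(2) by blast
    have "l1_dist q q' < \<delta>"
      using q'(2) dist C(1) by (simp add: pos_less_divide_eq mult.commute)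
    then have "\<Phi> q' < \<Phi> q + \<epsilon>" using d(2)[of q q'] by linarith
    then show ?thesis
      using min_value_le[of \<Phi> c B q' J', OF \<Phi> B q'(1)] q(2) by linarith
  qed
  show "\<exists>\<delta>>0. \<forall>p q. l1_dist p q < \<delta> \<longrightarrow> \<bar>min_value \<Phi> c B p - min_value \<Phi> c B q\<bar> < \<epsilon>"
  proof (intro exI[of _ "\<delta> / C"] conjI allI impI)
    fix p q :: "'a pmf" assume "l1_dist p q < \<delta> / C"
    then show "\<bar>min_value \<Phi> c B p - min_value \<Phi> c B q\<bar> < \<epsilon>"
      using less[of p q] less[of q p] by (simp add: l1_dist_sym abs_less_iff)
  qed (use d C in auto)
qed

section \<open>Information measures\<close>

text \<open>Disintegration: the channel is the conditional law, and only its values on the support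
  of \<open>p\<close> matter. This turns optimization over channels into optimization over
  \<open>constrained\<close> sets.\<close>

lemma joint_pmf_iff_marginal:
  fixes q :: "('a \<times> 'b) pmf"
  shows "(\<exists>W. q = joint_pmf p W) \<longleftrightarrow> map_pmf fst q = p"
proof
  assume "\<exists>W. q = joint_pmf p W"
  then show "map_pmf fst q = p"
    by (auto simp: joint_pmf_def map_bind_pmf map_pmf_comp bind_return_pmf' map_pmf_const)
next
  assume p: "map_pmf fst q = p"
  define W where "W a = map_pmf snd (cond_pmf q (fst -` {a}))" for a
  have "q = bind_pmf p (\<lambda>a. cond_pmf q (fst -` {a}))"
  proof -
    have "bind_pmf p (\<lambda>a. cond_pmf q {u. fst u = a}) = q"
      using p by (intro bind_cond_pmf_cancel) (auto simp: measure_map_pmf vimage_def pmf.map_comp simp flip: p)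
    then show ?thesis by (simp add: vimage_def)
  qed
  also have "\<dots> = joint_pmf p W"
    unfolding joint_pmf_def
  proof (rule bind_pmf_cong)
    fix a assume "a \<in> set_pmf p"
    then obtain u where "u \<in> set_pmf q" "fst u = a" using p by auto
    then have "set_pmf q \<inter> fst -` {a} \<noteq> {}" by auto
    then have "set_pmf (cond_pmf q (fst -` {a})) \<subseteq> fst -` {a}"
      by (simp add: set_cond_pmf)
    then have "map_pmf (\<lambda>u. u) (cond_pmf q (fst -` {a})) = map_pmf (\<lambda>u. (a, snd u)) (cond_pmf q (fst -` {a}))"
      by (intro map_pmf_cong) auto
    then show "cond_pmf q (fst -` {a}) = map_pmf (Pair a) (W a)"
      by (simp add: W_def map_pmf_comp)
  qed simp
  finally show "\<exists>W. q = joint_pmf p W" by blast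
qed

section \<open>Entropy formulas and their continuity\<close>

definition entropy2 :: "'u::finite pmf \<Rightarrow> real" where
  "entropy2 p = - (\<Sum>u\<in>UNIV. pmf p u * log 2 (pmf p u))"

lemma KL_div_finite:
  fixes P Q :: "'u::finite pmf"
  assumes "set_pmf Q \<subseteq> set_pmf P"
  shows "KL_div Q P = (\<Sum>u\<in>UNIV. pmf Q u * log 2 (pmf Q u / pmf P u))"
proof -
  interpret sigma_finite_measure "count_space (UNIV :: 'u set)"
    by (rule sigma_finite_measure_count_space_finite) simp
  have "KL_div Q P = KL_divergence 2 (density (count_space UNIV) (pmf P)) (density (count_space UNIV) (pmf Q))"
    by (simp add: KL_div_def flip: measure_pmf_eq_density)
  also have "\<dots> = (\<integral>u. pmf Q u * log 2 (pmf Q u / pmf P u) \<partial>count_space UNIV)"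
    using assms by (intro KL_density_density) (auto simp: AE_count_space pmf_eq_0_set_pmf)
  also have "\<dots> = (\<Sum>u\<in>UNIV. pmf Q u * log 2 (pmf Q u / pmf P u))"
    by (simp add: lebesgue_integral_count_space_finite)
  finally show ?thesis .
qed

lemma count_space_pair: "count_space (UNIV :: 'a::finite set) \<Otimes>\<^sub>M count_space (UNIV :: 'b::finite set) = count_space UNIV"
  by (simp add: pair_measure_countable)

lemma measure_pmf_pair_measure:
  fixes p :: "'a::finite pmf" and q :: "'b::finite pmf"
  shows "measure_pmf p \<Otimes>\<^sub>M measure_pmf q = measure_pmf (pair_pmf p q)"
proof (rule pair_measure_eqI)
  show "emeasure (measure_pmf p) A * emeasure (measure_pmf q) B = emeasure (measure_pmf (pair_pmf p q)) (A \<times> B)"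
    for A B
    using measure_pmf_prob_product[of A B p q]
    by (simp add: measure_pmf.emeasure_eq_measure countable_finite ennreal_mult')
  have "sets (measure_pmf p \<Otimes>\<^sub>M measure_pmf q) = sets (count_space (UNIV :: 'a set) \<Otimes>\<^sub>M count_space (UNIV :: 'b set))"
    by (rule sets_pair_measure_cong) simp_all
  then show "sets (measure_pmf p \<Otimes>\<^sub>M measure_pmf q) = sets (measure_pmf (pair_pmf p q))"
    unfolding count_space_pair by simp
qed (unfold_locales)

lemma mutual_information_pmf:
  fixes f :: "'u \<Rightarrow> 'a::finite" and g :: "'u \<Rightarrow> 'b::finite"
  shows "prob_space.mutual_information (measure_pmf p) 2 (count_space UNIV) (count_space UNIV) f g
    = KL_div (map_pmf (\<lambda>u. (f u, g u)) p) (pair_pmf (map_pmf f p) (map_pmf g p))"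
proof -
  have d: "distr (measure_pmf p) (count_space UNIV) h = measure_pmf (map_pmf h p)" for h :: "'u \<Rightarrow> 'c"
    by (simp add: map_pmf_rep_eq)
  show ?thesis
    unfolding prob_space.mutual_information_def[OF prob_space_measure_pmf] count_space_pair d KL_div_def measure_pmf_pair_measure ..
qed

text \<open>The support of a joint law lies in the product of the supports of its marginals, so the
  finite sum formula holds unconditionally and its logarithm splits.\<close>

lemma KL_div_marginals:
  fixes q :: "('a::finite \<times> 'b::finite) pmf"
  shows "KL_div q (pair_pmf (map_pmf fst q) (map_pmf snd q))
    = entropy2 (map_pmf fst q) + entropy2 (map_pmf snd q) - entropy2 q"
proof -
  let ?p = "map_pmf fst q" and ?r = "map_pmf snd q"
  have "KL_div q (pair_pmf ?p ?r)
      = (\<Sum>u\<in>UNIV. pmf q u * log 2 (pmf q u / pmf (pair_pmf ?p ?r) u))"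
    by (rule KL_div_finite) force
  also have "\<dots> = (\<Sum>u\<in>UNIV. pmf q u * log 2 (pmf q u) - pmf q u * log 2 (pmf ?p (fst u)) - pmf q u * log 2 (pmf ?r (snd u)))"
  proof (intro sum.cong refl)
    fix u :: "'a \<times> 'b"
    show "pmf q u * log 2 (pmf q u / pmf (pair_pmf ?p ?r) u)
      = pmf q u * log 2 (pmf q u) - pmf q u * log 2 (pmf ?p (fst u)) - pmf q u * log 2 (pmf ?r (snd u))"
    proof (cases "pmf q u = 0")
      case False
      then have u: "u \<in> set_pmf q" by (simp add: set_pmf_iff)
      then have "fst u \<in> set_pmf ?p" "snd u \<in> set_pmf ?r" by auto
      then have "pmf ?p (fst u) > 0" "pmf ?r (snd u) > 0" "pmf q u > 0"
        using u by (simp_all only: pmf_positive_iff)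
      moreover have "pmf (pair_pmf ?p ?r) u = pmf ?p (fst u) * pmf ?r (snd u)"
        by (cases u) (simp add: pmf_pair)
      ultimately show ?thesis by (simp add: log_divide log_mult algebra_simps)
    qed simp
  qed
  also have "\<dots> = (\<Sum>u\<in>UNIV. pmf q u * log 2 (pmf q u)) - (\<Sum>u\<in>UNIV. pmf q u * log 2 (pmf ?p (fst u)))
      - (\<Sum>u\<in>UNIV. pmf q u * log 2 (pmf ?r (snd u)))"
    by (simp add: sum_subtractf)
  also have "(\<Sum>u\<in>UNIV. pmf q u * log 2 (pmf ?p (fst u))) = - entropy2 ?p"
    using expectation_finite[of ?p "\<lambda>a. log 2 (pmf ?p a)"]
      expectation_finite[of q "\<lambda>u. log 2 (pmf ?p (fst u))"]
    by (simp add: entropy2_def)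
  also have "(\<Sum>u\<in>UNIV. pmf q u * log 2 (pmf ?r (snd u))) = - entropy2 ?r"
    using expectation_finite[of ?r "\<lambda>a. log 2 (pmf ?r a)"]
      expectation_finite[of q "\<lambda>u. log 2 (pmf ?r (snd u))"]
    by (simp add: entropy2_def)
  finally show ?thesis by (simp add: entropy2_def)
qed

lemma entropy2_map_inj:
  fixes f :: "'u::finite \<Rightarrow> 'v::finite"
  assumes "bij f"
  shows "entropy2 (map_pmf f p) = entropy2 p"
proof -
  have inj: "inj f" using assms by (rule bij_is_inj)
  have "(\<Sum>v\<in>UNIV. pmf (map_pmf f p) v * log 2 (pmf (map_pmf f p) v))
     = (\<Sum>u\<in>UNIV. pmf (map_pmf f p) (f u) * log 2 (pmf (map_pmf f p) (f u)))"
    by (rule sum.reindex_bij_betw[symmetric]) (use assms in simp)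
  then show ?thesis by (simp add: entropy2_def pmf_map_inj' inj)
qed

text \<open>\<open>I(X;V|Y)\<close> is defined as \<open>I(X;V,Y) - I(X;Y)\<close>, in which the
  entropy of \<open>X\<close> cancels. The four remaining entropies are continuous up to the
  boundary of the simplex, and each will match the size of one type class.\<close>

lemma cond_mutual_info_entropy:
  fixes q :: "(('x::finite \<times> 'y::finite) \<times> 'v::finite) pmf"
  shows "cond_mutual_info q = entropy2 (map_pmf fst q) + entropy2 (map_pmf (\<lambda>((x, y), v). (y, v)) q)
    - entropy2 q - entropy2 (map_pmf (\<lambda>((x, y), v). y) q)"
proof -
  let ?X = "\<lambda>((x, y), v). x :: 'x" and ?Y = "\<lambda>((x, y), v). y :: 'y" and ?V = "\<lambda>((x, y), v). v :: 'v"
  have pairI: "KL_div (map_pmf (\<lambda>u. (f u, g u)) q) (pair_pmf (map_pmf f q) (map_pmf g q))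
     = entropy2 (map_pmf f q) + entropy2 (map_pmf g q) - entropy2 (map_pmf (\<lambda>u. (f u, g u)) q)"
    for f :: "_ \<Rightarrow> 'c::finite" and g :: "_ \<Rightarrow> 'd::finite"
    using KL_div_marginals[of "map_pmf (\<lambda>u. (f u, g u)) q"] by (simp add: map_pmf_comp)
  have "cond_mutual_info q =
      entropy2 (map_pmf (\<lambda>u. (?V u, ?Y u)) q) - entropy2 (map_pmf (\<lambda>u. (?X u, ?V u, ?Y u)) q)
      - entropy2 (map_pmf ?Y q) + entropy2 (map_pmf (\<lambda>u. (?X u, ?Y u)) q)"
    unfolding cond_mutual_info_def prob_space.conditional_mutual_information_def[OF prob_space_measure_pmf] count_space_pair
      mutual_information_pmf pairI by simp
  also have "entropy2 (map_pmf (\<lambda>u. (?V u, ?Y u)) q)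
      = entropy2 (map_pmf prod.swap (map_pmf (\<lambda>u. (?Y u, ?V u)) q))"
    by (simp add: map_pmf_comp)
  also have "\<dots> = entropy2 (map_pmf (\<lambda>u. (?Y u, ?V u)) q)"
    by (rule entropy2_map_inj) simp
  also have "entropy2 (map_pmf (\<lambda>u. (?X u, ?V u, ?Y u)) q) = entropy2 q"
    by (rule entropy2_map_inj) (auto intro!: bijI injI surjI[of _ "\<lambda>(x, v, y). ((x, y), v)"])
  finally show ?thesis by (simp add: case_prod_unfold)
qed

text \<open>The delicate point is 0, where the function tends to its value 0 from the right. This
  frees entropy from any condition on supports.\<close>

lemma continuous_on_xlogx: "continuous_on {0..1} (\<lambda>t. t * log 2 t)"
proof -
  have "continuous (at t within {0..1}) (\<lambda>t. t * log 2 t)" if t: "t \<in> {0..1}" for t :: real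
  proof (cases "t = 0")
    case True
    have "((\<lambda>t::real. t * log 2 t) \<longlongrightarrow> 0) (at_right 0)" by real_asymp
    then have "((\<lambda>t::real. t * log 2 t) \<longlongrightarrow> 0) (at 0 within {0..1})"
      by (simp add: at_within_Icc_at_right)
    then show ?thesis using True by (simp add: continuous_within)
  next
    case False
    then have "isCont (\<lambda>t. t * log 2 t) t" using t by (auto intro!: continuous_intros)
    then show ?thesis by (rule continuous_at_imp_continuous_at_within)
  qed
  then show ?thesis by (simp add: continuous_on_eq_continuous_within)
qed

lemma unif_cont_entropy2: "unif_cont entropy2"
proof -
  have "unif_cont (\<lambda>p. - (\<Sum>u\<in>UNIV. pmf p u * log 2 (pmf p u)))"
    by (intro unif_cont_uminus unif_cont_sum unif_cont_pmf[OF continuous_on_xlogx]) simp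
  then show ?thesis by (simp add: entropy2_def[abs_def])
qed

lemma unif_cont_cond_mutual_info: "unif_cont cond_mutual_info"
  unfolding cond_mutual_info_entropy[abs_def]
  by (intro unif_cont_diff unif_cont_add unif_cont_map_pmf unif_cont_entropy2)

text \<open>With full support of \<open>P\<close> the logarithm of every quotient splits, leaving a
  linear function of \<open>Q\<close> minus its entropy; hence continuity on the whole
  simplex.\<close>

lemma KL_div_entropy:
  fixes P Q :: "'u::finite pmf"
  assumes "set_pmf P = UNIV"
  shows "KL_div Q P = - entropy2 Q - (\<Sum>u\<in>UNIV. pmf Q u * log 2 (pmf P u))"
proof -
  have "pmf Q u * log 2 (pmf Q u / pmf P u) = pmf Q u * log 2 (pmf Q u) - pmf Q u * log 2 (pmf P u)" for u
  proof -
    have "pmf P u > 0" using assms by (metis UNIV_I pmf_positive_iff)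
    then show ?thesis
      using pmf_nonneg[of Q u] by (cases "pmf Q u = 0") (simp_all add: log_divide algebra_simps)
  qed
  then show ?thesis
    using KL_div_finite[of Q P] assms by (simp add: entropy2_def sum_subtractf)
qed

lemma unif_cont_KL_div:
  assumes "set_pmf P = UNIV" shows "unif_cont (\<lambda>Q. KL_div Q P)"
  unfolding KL_div_entropy[OF assms]
  by (intro unif_cont_diff unif_cont_uminus unif_cont_sum unif_cont_entropy2
      unif_cont_pmf[of "\<lambda>t. t * _"] continuous_intros) simp

section \<open>Types\<close>

lemma ln_fact_lower: "real n * ln (real n) - real n \<le> ln (fact n)"
proof (induction n)
  case 0
  then show ?case by simp
next
  case (Suc n)
  show ?case
  proof (cases "n = 0")
    case False
    have "ln (real (Suc n)) - ln (real n) = ln (real (Suc n) / real n)"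
      using False by (simp add: ln_divide_pos)
    also have "real (Suc n) / real n = 1 + 1 / real n" using False by (simp add: field_simps)
    also have "ln (1 + 1 / real n) \<le> 1 / real n"
      by (rule ln_add_one_self_le_self) simp
    finally have "real n * (ln (real (Suc n)) - ln (real n)) \<le> 1"
      using False by (simp add: field_simps)
    then have "real n * ln (real (Suc n)) \<le> real n * ln (real n) + 1"
      by (simp add: right_diff_distrib)
    moreover have "ln (fact (Suc n)) = ln (real (Suc n)) + ln (fact n)"
      unfolding fact_Suc by (subst ln_mult_pos) auto
    ultimately show ?thesis using Suc.IH by (simp add: algebra_simps)
  qed simp
qed

text \<open>The induction runs on the bound with \<open>n + 1\<close> inside the logarithm, where
  the step reduces to \<open>ln t \<le> t - 1\<close>. Passing from
  \<open>(n + 1) * ln (n + 1)\<close> to \<open>n * ln n\<close> then costs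
  \<open>ln (n + 1) + 1\<close>.\<close>

lemma ln_fact_upper: "ln (fact n) \<le> real n * ln (real n) - real n + ln (real n + 1) + 1"
proof -
  have "ln (fact n) \<le> (real n + 1) * ln (real n + 1) - real n"
  proof (induction n)
    case (Suc n)
    have "ln ((real n + 1) / (real n + 2)) \<le> (real n + 1) / (real n + 2) - 1"
      by (rule ln_le_minus_one) simp
    also have "\<dots> = - 1 / (real n + 2)" by (simp add: field_simps)
    also have "ln ((real n + 1) / (real n + 2)) = ln (real n + 1) - ln (real n + 2)"
      by (rule ln_divide_pos) simp_all
    finally have "(real n + 2) * (ln (real n + 1) - ln (real n + 2)) \<le> - 1"
      by (simp add: field_simps)
    moreover have "ln (fact (Suc n)) = ln (real n + 1) + ln (fact n)"
      unfolding fact_Suc by (subst ln_mult_pos) (auto simp: add.commute)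
    ultimately show ?case using Suc.IH by (simp add: algebra_simps)
  qed simp
  moreover have "real n * (ln (real n + 1) - ln (real n)) \<le> 1"
  proof (cases "n = 0")
    case False
    have "ln (real n + 1) - ln (real n) = ln ((real n + 1) / real n)"
      using False by (simp add: ln_divide_pos)
    also have "(real n + 1) / real n = 1 + 1 / real n" using False by (simp add: field_simps)
    also have "ln (1 + 1 / real n) \<le> 1 / real n"
      by (rule ln_add_one_self_le_self) simp
    finally show ?thesis
      using False by (simp add: field_simps)
  qed simp
  ultimately show ?thesis by (simp add: algebra_simps)
qed

text \<open>Permuting positions acts transitively on the words of the image type and carries fibers
  injectively into fibers, so all fibers have the same size. Conditional type classes are such
  fibers.\<close>

lemma card_map_fiber:
  fixes N :: "'a multiset" and f :: "'a \<Rightarrow> 'b"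
  assumes "ys \<in> permutations_of_multiset (image_mset f N)"
  shows "card {zs \<in> permutations_of_multiset N. map f zs = ys}
      * card (permutations_of_multiset (image_mset f N)) = card (permutations_of_multiset N)"
proof -
  define T where "T = permutations_of_multiset N"
  define fib where "fib ys = {zs \<in> T. map f zs = ys}" for ys
  have le: "card (fib ys) \<le> card (fib ys')"
    if "ys \<in> permutations_of_multiset (image_mset f N)" "ys' \<in> permutations_of_multiset (image_mset f N)" for ys ys'
  proof -
    have "mset ys' = mset ys" using that by (simp add: permutations_of_multiset_def)
    then obtain p where p: "p permutes {..<length ys}" "permute_list p ys = ys'"
      by (rule mset_eq_permutation)
    have "permute_list p ` fib ys \<subseteq> fib ys'"
    proof safe
      fix zs assume zs: "zs \<in> fib ys"
      then have l: "p permutes {..<length zs}" using p by (auto simp: fib_def)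
      show "permute_list p zs \<in> fib ys'"
        using zs l p by (auto simp: fib_def T_def permutations_of_multiset_def permute_list_map)
    qed
    moreover have "inj_on (permute_list p) (fib ys)"
    proof (rule inj_onI)
      fix zs zs' assume zs: "zs \<in> fib ys" "zs' \<in> fib ys" and eq: "permute_list p zs = permute_list p zs'"
      have len: "length zs = length ys" "length zs' = length ys" 
        using zs length_map[of f zs] length_map[of f zs'] by (auto simp: fib_def simp del: length_map)
      have inv: "inv p permutes {..<length ys}" using p(1) by (rule permutes_inv)
      have "permute_list (inv p) (permute_list p zs) = zs" if "length zs = length ys" for zs :: "'a list"
        using permute_list_compose[of "inv p" zs p] inv permutes_inv_o[OF p(1)] that by simp
      then show "zs = zs'" using eq len by metis
    qed
    ultimately show ?thesis
      by (intro card_inj_on_le[of "permute_list p"]) (auto simp: fib_def T_def)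
  qed
  then have "card (fib ys') = card (fib ys)" if "ys' \<in> permutations_of_multiset (image_mset f N)" for ys'
    using that assms by (meson antisym)
  then have "(\<Sum>ys'\<in>permutations_of_multiset (image_mset f N). card (fib ys')) =
      card (fib ys) * card (permutations_of_multiset (image_mset f N))"
    by simp
  moreover have "card T = (\<Sum>ys'\<in>permutations_of_multiset (image_mset f N). card (fib ys'))"
  proof -
    have "T = (\<Union>ys'\<in>permutations_of_multiset (image_mset f N). fib ys')"
      by (auto simp: fib_def T_def permutations_of_multiset_def)
    also have "card \<dots> = (\<Sum>ys'\<in>permutations_of_multiset (image_mset f N). card (fib ys'))"
      by (rule card_UN_disjoint) (auto simp: fib_def T_def)
    finally show ?thesis .
  qed
  ultimately show ?thesis by (simp add: T_def fib_def)
qed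

text \<open>A type is determined by its counts, each in \<open>{0..n}\<close>. That there are only
  polynomially many is what makes sums over types harmless.\<close>

lemma card_multisets_of_size_le:
  "finite {M :: 'u::finite multiset. size M = n}"
  "card {M :: 'u::finite multiset. size M = n} \<le> (n + 1) ^ CARD('u)"
proof -
  have inj: "inj_on count {M :: 'u multiset. size M = n}"
    by (simp add: inj_on_def multiset_eq_iff)
  have sub: "count ` {M :: 'u multiset. size M = n} \<subseteq> UNIV \<rightarrow>\<^sub>E {0..n}"
    by (auto simp: count_le_size)
  have fin: "finite ((UNIV :: 'u set) \<rightarrow>\<^sub>E {0..n})" by (intro finite_PiE) auto
  show "finite {M :: 'u multiset. size M = n}"
    using inj sub fin by (rule inj_on_finite)
  have "card {M :: 'u multiset. size M = n} \<le> card ((UNIV :: 'u set) \<rightarrow>\<^sub>E {0..n})"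
    using inj sub fin by (rule card_inj_on_le)
  also have "\<dots> = (n + 1) ^ CARD('u)" by (simp add: card_PiE)
  finally show "card {M :: 'u multiset. size M = n} \<le> (n + 1) ^ CARD('u)" .
qed

text \<open>The class size is a multinomial coefficient. The leading terms of the factorial bounds
  combine to the entropy, the linear terms cancel because the counts add up to the size, and one
  error is left per factorial, whence \<open>CARD('u) + 1\<close>.\<close>

lemma log_card_permutations_of_multiset:
  fixes M :: "'u::finite multiset"
  assumes "M \<noteq> {#}"
  shows "\<bar>log 2 (card (permutations_of_multiset M)) - real (size M) * entropy2 (pmf_of_multiset M)\<bar>
     \<le> (CARD('u) + 1) * (log 2 (real (size M) + 1) + 2)"
proof -
  define n where "n = size M"
  have n: "n > 0" using assms by (simp add: n_def nonempty_has_size)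
  define L where "L k = ln (fact k) - (real k * ln (real k) - real k)" for k :: nat
  have L: "0 \<le> L k" "L k \<le> ln (real n + 1) + 1" if "k \<le> n" for k
  proof -
    show "0 \<le> L k" using ln_fact_lower[of k] by (simp add: L_def)
    have "L k \<le> ln (real k + 1) + 1" using ln_fact_upper[of k] by (simp add: L_def)
    also have "ln (real k + 1) \<le> ln (real n + 1)" using that by simp
    finally show "L k \<le> ln (real n + 1) + 1" by simp
  qed
  have sumc: "(\<Sum>u\<in>UNIV. real (count M u)) = real n"
    unfolding n_def size_multiset_overloaded_eq of_nat_sum
    by (rule sum.mono_neutral_right) (auto simp: not_in_iff)
  have "card (permutations_of_multiset M) * (\<Prod>u\<in>UNIV. fact (count M u)) = fact n"
  proof -
    have "(\<Prod>u\<in>UNIV. fact (count M u)) = (\<Prod>u\<in>set_mset M. fact (count M u) :: nat)"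
      by (rule prod.mono_neutral_right) (auto simp: not_in_iff)
    then show ?thesis using card_permutations_of_multiset_aux[of M] by (simp add: n_def)
  qed
  then have "real (card (permutations_of_multiset M) * (\<Prod>u\<in>UNIV. fact (count M u))) = real (fact n)"
    by (rule arg_cong)
  then have "real (card (permutations_of_multiset M)) * (\<Prod>u\<in>UNIV. fact (count M u)) = fact n"
    by simp
  then have "ln (real (card (permutations_of_multiset M)) * (\<Prod>u\<in>UNIV. fact (count M u))) = ln (fact n)"
    by simp
  moreover have "card (permutations_of_multiset M) > 0" by (simp add: card_gt_0_iff)
  ultimately have lnc: "ln (real (card (permutations_of_multiset M))) = ln (fact n) - (\<Sum>u\<in>UNIV. ln (fact (count M u)))"
    by (subst (asm) ln_mult_pos) (simp_all add: ln_prod prod_pos)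
  have "real n * entropy2 (pmf_of_multiset M) * ln 2 = - (\<Sum>u\<in>UNIV. real (count M u) * (ln (real (count M u)) - ln (real n)))"
  proof -
    have "real n * (pmf (pmf_of_multiset M) u * log 2 (pmf (pmf_of_multiset M) u)) * ln 2
       = real (count M u) * (ln (real (count M u)) - ln (real n))" for u
      using n assms by (cases "count M u = 0") (simp_all add: log_def ln_divide_pos flip: n_def)
    then show ?thesis
      by (simp add: entropy2_def sum_distrib_left sum_distrib_right)
  qed
  also have "\<dots> = real n * ln (real n) - (\<Sum>u\<in>UNIV. real (count M u) * ln (real (count M u)))"
    by (simp add: right_diff_distrib sum_subtractf sumc flip: sum_distrib_right)
  finally have ent: "real n * entropy2 (pmf_of_multiset M) * ln 2 = \<dots>" .
  have "ln (real (card (permutations_of_multiset M))) - real n * entropy2 (pmf_of_multiset M) * ln 2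
     = L n - (\<Sum>u\<in>UNIV. L (count M u))"
    unfolding lnc ent by (simp add: L_def sum_subtractf sumc)
  moreover have "\<bar>L n - (\<Sum>u\<in>UNIV. L (count M u))\<bar> \<le> (CARD('u) + 1) * (ln (real n + 1) + 1)"
  proof -
    have c: "count M u \<le> n" for u by (simp add: n_def count_le_size)
    have "(\<Sum>u\<in>UNIV. L (count M u)) \<le> (\<Sum>u\<in>(UNIV :: 'u set). ln (real n + 1) + 1)"
      by (intro sum_mono L c)
    moreover have "0 \<le> (\<Sum>u\<in>UNIV. L (count M u))" by (intro sum_nonneg L c)
    ultimately show ?thesis using L[of n] by (simp add: abs_le_iff algebra_simps)
  qed
  ultimately have "\<bar>ln (real (card (permutations_of_multiset M))) - real n * entropy2 (pmf_of_multiset M) * ln 2\<bar>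
     \<le> (CARD('u) + 1) * (ln (real n + 1) + 1)" by simp
  also have "\<dots> \<le> (CARD('u) + 1) * ((log 2 (real n + 1) + 2) * ln 2)"
  proof (rule mult_left_mono)
    \<comment> \<open>Doubling the additive constant absorbs the change from natural to binary
      logarithms.\<close>
    have "2 * ln 2 \<ge> (1 :: real)"
      using ln_le_minus_one[of "1 / 2 :: real"] by (simp add: ln_divide_pos)
    then show "ln (real n + 1) + 1 \<le> (log 2 (real n + 1) + 2) * ln 2"
      by (simp add: log_def distrib_right)
  qed simp
  finally have "\<bar>log 2 (card (permutations_of_multiset M)) - real n * entropy2 (pmf_of_multiset M)\<bar> * ln 2
     \<le> (CARD('u) + 1) * (log 2 (real n + 1) + 2) * ln 2"
    by (simp add: log_def abs_mult_pos left_diff_distrib mult.assoc)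
  then show ?thesis by (simp add: n_def)
qed

lemma map_pmf_of_multiset:
  fixes M :: "'u::finite multiset"
  assumes "M \<noteq> {#}"
  shows "map_pmf f (pmf_of_multiset M) = pmf_of_multiset (image_mset f M)"
proof (rule pmf_eqI)
  fix a
  have "(\<Sum>u\<in>f -` {a}. count M u) = (\<Sum>u\<in>f -` {a} \<inter> set_mset M. count M u)"
    by (rule sum.mono_neutral_right) (auto simp: not_in_iff)
  then show "pmf (map_pmf f (pmf_of_multiset M)) a = pmf (pmf_of_multiset (image_mset f M)) a"
    using assms by (simp add: pmf_map_finite count_image_mset flip: sum_divide_distrib of_nat_sum)
qed

lemma obtain_multiset_of_pmf:
  fixes q :: "'u::finite pmf"
  assumes "n > 0" "\<And>u. real n * pmf q u \<in> \<nat>"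
  obtains M where "size M = n" "pmf_of_multiset M = q"
proof -
  have "\<exists>k. real n * pmf q u = real k" for u
    using assms(2)[of u] by (auto elim: Nats_cases)
  then obtain k where k: "\<And>u. real n * pmf q u = real (k u)" by metis
  define M where "M = Abs_multiset k"
  have c: "count M = k" by (simp add: M_def Abs_multiset_inverse)
  have "real (size M) = (\<Sum>u\<in>UNIV. real (k u))"
    unfolding size_multiset_overloaded_eq of_nat_sum c
    by (rule sum.mono_neutral_left) (auto simp: not_in_iff c)
  also have "\<dots> = real n"
    by (simp add: sum_pmf_finite flip: k sum_distrib_left)
  finally have s: "size M = n" by simp
  then have "M \<noteq> {#}" using assms(1) by auto
  then have "pmf_of_multiset M = q"
    using assms(1) by (intro pmf_eqI) (simp add: s c field_simps flip: k)
  with s show ?thesis using that by blast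
qed

section \<open>Probabilities of types and the conditional ratio\<close>

lemma pmf_replicate_pmf_count:
  fixes P :: "'x::finite pmf"
  shows "length xs = n \<Longrightarrow> pmf (replicate_pmf n P) xs = (\<Prod>x\<in>UNIV. pmf P x ^ count (mset xs) x)"
proof (induction n arbitrary: xs)
  case 0
  then show ?case by simp
next
  case (Suc n)
  then obtain y ys where xs: "xs = y # ys" "length ys = n" by (cases xs) auto
  have inj: "inj (\<lambda>(x, xs). x # xs :: 'x list)" by (auto intro: injI)
  have "replicate_pmf (Suc n) P = map_pmf (\<lambda>(x, xs). x # xs) (pair_pmf P (replicate_pmf n P))"
    by (simp add: pair_pmf_def map_bind_pmf)
  then have "pmf (replicate_pmf (Suc n) P) xs = pmf P y * pmf (replicate_pmf n P) ys"
    using pmf_map_inj'[OF inj, of "pair_pmf P (replicate_pmf n P)" "(y, ys)"] xs by (simp add: pmf_pair)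
  also have "\<dots> = pmf P y * (\<Prod>x\<in>UNIV. pmf P x ^ count (mset ys) x)"
    using Suc.IH[OF xs(2)] by simp
  also have "\<dots> = (\<Prod>x\<in>UNIV. (if x = y then pmf P x else 1) * pmf P x ^ count (mset ys) x)"
    by (simp add: prod.distrib)
  also have "\<dots> = (\<Prod>x\<in>UNIV. pmf P x ^ count (mset xs) x)"
    by (intro prod.cong) (auto simp: xs)
  finally show ?case .
qed

text \<open>The i.i.d. probability of any single word of type \<open>M\<close>.\<close>

definition type_weight :: "'x::finite pmf \<Rightarrow> 'x multiset \<Rightarrow> real" where
  "type_weight P M = (\<Prod>x\<in>UNIV. pmf P x ^ count M x)"

text \<open>The error in bits charged to each factorial of a type class size.\<close>

definition type_error :: "nat \<Rightarrow> real" where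
  "type_error n = log 2 (real n + 1) + 2"

lemma type_error_nonneg: "0 \<le> type_error n"
  by (simp add: type_error_def)

lemma log_card_type_class:
  fixes M :: "'u::finite multiset"
  assumes "size M = n" "n > 0"
  shows "\<bar>log 2 (card (permutations_of_multiset M)) - real n * entropy2 (pmf_of_multiset M)\<bar>
     \<le> real (CARD('u) + 1) * type_error n"
proof -
  have "M \<noteq> {#}" using assms by auto
  then show ?thesis
    using log_card_permutations_of_multiset[of M] assms(1) by (simp add: type_error_def)
qed

lemma card_type_class_pos: "card (permutations_of_multiset M) > 0"
  by (simp add: card_gt_0_iff)

text \<open>The weight gives \<open>n\<close> times the mean of \<open>log 2 (pmf P x)\<close> under
  the type, and the class size gives \<open>n\<close> times its entropy; their sum is minus
  \<open>n\<close> times the divergence. Only the class size is inexact.\<close>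

lemma log_type_prob:
  fixes M :: "'x::finite multiset"
  assumes P: "set_pmf P = UNIV" and M: "size M = n" "n > 0"
  shows "type_weight P M > 0"
    "\<bar>log 2 (type_weight P M * card (permutations_of_multiset M)) + real n * KL_div (pmf_of_multiset M) P\<bar>
     \<le> real (CARD('x) + 1) * type_error n"
proof -
  have pos: "pmf P x > 0" for x using P by (simp add: pmf_positive_iff)
  then show w: "type_weight P M > 0" by (simp add: type_weight_def prod_pos)
  have "ln (type_weight P M) = (\<Sum>x\<in>UNIV. real (count M x) * ln (pmf P x))"
    unfolding type_weight_def using pos by (subst ln_prod) (simp_all add: ln_realpow pos less_imp_neq[THEN not_sym])
  then have "log 2 (type_weight P M) = (\<Sum>x\<in>UNIV. real (count M x) * log 2 (pmf P x))"
    by (simp add: log_def sum_divide_distrib)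
  also have "\<dots> = real n * (\<Sum>x\<in>UNIV. pmf (pmf_of_multiset M) x * log 2 (pmf P x))"
  proof -
    have "M \<noteq> {#}" using M by auto
    then have "real n * pmf (pmf_of_multiset M) x = real (count M x)" for x
      using M by simp
    then show ?thesis by (simp add: sum_distrib_left flip: mult.assoc)
  qed
  finally have "log 2 (type_weight P M * card (permutations_of_multiset M)) + real n * KL_div (pmf_of_multiset M) P
     = log 2 (card (permutations_of_multiset M)) - real n * entropy2 (pmf_of_multiset M)"
    using w card_type_class_pos[of M] P by (simp add: log_mult KL_div_entropy algebra_simps)
  then show "\<bar>log 2 (type_weight P M * card (permutations_of_multiset M)) + real n * KL_div (pmf_of_multiset M) P\<bar>
     \<le> real (CARD('x) + 1) * type_error n"
    using log_card_type_class[OF M] by simp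
qed

lemma log_card_type_class_le:
  fixes U :: "'c::finite multiset"
  assumes "size U = n" "n > 0" "CARD('c) \<le> k"
  shows "\<bar>log 2 (card (permutations_of_multiset U)) - real n * entropy2 (pmf_of_multiset U)\<bar>
     \<le> real (k + 1) * type_error n"
  by (rule order_trans[OF log_card_type_class[OF assms(1,2)]])
    (use assms(3) in \<open>intro mult_right_mono type_error_nonneg, simp\<close>)

text \<open>Each class size matches one entropy of \<open>I(X;V|Y)\<close>, and the 4 counts their
  errors. The ratio is the probability that a uniform \<open>v\<close> from its conditional class
  given \<open>y\<close> completes \<open>(x, y)\<close> to type \<open>W\<close>, and equally that
  a uniform \<open>x\<close> from its class given \<open>y\<close> completes
  \<open>(y, v)\<close>.\<close>

lemma log_cond_type_ratio:
  fixes W :: "(('x::finite \<times> 'y::finite) \<times> 'v::finite) multiset"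
  assumes W: "size W = n" "n > 0"
  shows "\<bar>log 2 (card (permutations_of_multiset W) * card (permutations_of_multiset (image_mset (\<lambda>((x, y), v). y) W)) /
      (card (permutations_of_multiset (image_mset fst W)) * card (permutations_of_multiset (image_mset (\<lambda>((x, y), v). (y, v)) W))))
     + real n * cond_mutual_info (pmf_of_multiset W)\<bar>
     \<le> 4 * (real (CARD(('x \<times> 'y) \<times> 'v) + 1) * type_error n)"
proof -
  have ne: "W \<noteq> {#}" using W by auto
  have sz: "size (image_mset f W) = n" for f :: "_ \<Rightarrow> 'c" using W by simp
  have c1: "1 \<le> CARD('x)" "1 \<le> CARD('y)" "1 \<le> CARD('v)" by (simp_all add: Suc_leI)
  have c: "CARD('y) \<le> CARD(('x \<times> 'y) \<times> 'v)" "CARD('x \<times> 'y) \<le> CARD(('x \<times> 'y) \<times> 'v)"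
    "CARD('y \<times> 'v) \<le> CARD(('x \<times> 'y) \<times> 'v)"
    using c1 by simp_all
  let ?C = "\<lambda>U. real (card (permutations_of_multiset U))"
  define a b c d where abcd: "a = ?C W" "b = ?C (image_mset (\<lambda>((x, y), v). y) W)" "c = ?C (image_mset fst W)"
    "d = ?C (image_mset (\<lambda>((x, y), v). (y, v)) W)"
  have pos: "a > 0" "b > 0" "c > 0" "d > 0"
    by (simp_all only: abcd of_nat_0_less_iff card_type_class_pos)
  have "log 2 (a * b / (c * d)) = log 2 a + log 2 b - log 2 c - log 2 d"
    using pos by (simp add: log_divide log_mult)
  moreover have "real n * cond_mutual_info (pmf_of_multiset W)
     = real n * entropy2 (pmf_of_multiset (image_mset fst W))
       + real n * entropy2 (pmf_of_multiset (image_mset (\<lambda>((x, y), v). (y, v)) W))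
       - real n * entropy2 (pmf_of_multiset W) - real n * entropy2 (pmf_of_multiset (image_mset (\<lambda>((x, y), v). y) W))"
    by (simp add: cond_mutual_info_entropy map_pmf_of_multiset[OF ne] algebra_simps)
  ultimately show ?thesis
    using log_card_type_class_le[of W n, OF W order_refl]
      log_card_type_class_le[of "image_mset (\<lambda>((x, y), v). y) W" n, OF sz W(2) c(1)]
      log_card_type_class_le[of "image_mset fst W" n, OF sz W(2) c(2)]
      log_card_type_class_le[of "image_mset (\<lambda>((x, y), v). (y, v)) W" n, OF sz W(2) c(3)]
    unfolding abcd[symmetric] of_nat_mult by linarith
qed

section \<open>Joint types of words\<close>

lemma sum_count_mset:
  fixes zs :: "'u::finite list" and h :: "'u \<Rightarrow> real"
  shows "(\<Sum>u\<in>UNIV. real (count (mset zs) u) * h u) = (\<Sum>i<length zs. h (zs ! i))"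
proof (induction zs)
  case (Cons z zs)
  have "(\<Sum>u\<in>UNIV. real (count (mset (z # zs)) u) * h u)
    = (\<Sum>u\<in>UNIV. (if u = z then h u else 0) + real (count (mset zs) u) * h u)"
    by (intro sum.cong) (auto simp: algebra_simps)
  also have "\<dots> = h z + (\<Sum>i<length zs. h (zs ! i))"
    by (simp add: sum.distrib Cons.IH)
  also have "\<dots> = (\<Sum>i<length (z # zs). h ((z # zs) ! i))"
    by (simp add: sum.lessThan_Suc_shift del: sum.lessThan_Suc)
  finally show ?case .
qed simp

lemma expectation_pmf_of_mset:
  fixes zs :: "'u::finite list" and h :: "'u \<Rightarrow> real"
  assumes "zs \<noteq> []"
  shows "measure_pmf.expectation (pmf_of_multiset (mset zs)) h = (\<Sum>i<length zs. h (zs ! i)) / length zs"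
  using assms by (simp add: expectation_finite sum_count_mset flip: sum_divide_distrib)

lemma image_mset_zip:
  assumes "length xs = length ys"
  shows "image_mset fst (mset (zip xs ys)) = mset xs" "image_mset snd (mset (zip xs ys)) = mset ys"
  using assms by (simp_all flip: mset_map)

text \<open>Average distortion is the expected cost under the joint type, so a feasible type means
  feasibility of each of its words, not merely on average.\<close>

lemma type_in_constrained:
  fixes d :: "'x::finite \<Rightarrow> 'y::finite \<Rightarrow> real"
  assumes "length xs = length ys" "xs \<noteq> []"
  shows "pmf_of_multiset (mset (zip xs ys)) \<in> constrained d D (pmf_of_multiset (mset xs))
    \<longleftrightarrow> avg_distortion d xs ys \<le> D"
proof -
  have ne: "zip xs ys \<noteq> []" using assms by (cases xs; cases ys) auto
  have "map_pmf fst (pmf_of_multiset (mset (zip xs ys))) = pmf_of_multiset (mset xs)"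
    using ne assms by (simp add: map_pmf_of_multiset image_mset_zip del: mset_zip_take_Cons_drop_twice)
  moreover have "measure_pmf.expectation (pmf_of_multiset (mset (zip xs ys))) (\<lambda>(a, b). d a b) = avg_distortion d xs ys"
    using assms ne by (simp add: expectation_pmf_of_mset avg_distortion_def)
  ultimately show ?thesis by (simp add: constrained_def)
qed

lemma type_in_constrained_fst:
  fixes d :: "'x::finite \<Rightarrow> 'v::finite \<Rightarrow> real" and xs :: "'x list" and ys :: "'y::finite list"
  assumes "length xs = length ys" "length vs = length xs" "xs \<noteq> []"
  shows "pmf_of_multiset (mset (zip (zip xs ys) vs)) \<in>
      constrained (\<lambda>(x, y) v. d x v) D (pmf_of_multiset (mset (zip xs ys)))
    \<longleftrightarrow> avg_distortion d xs vs \<le> D"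
proof -
  have ne: "zip xs ys \<noteq> []" using assms by (cases xs; cases ys) auto
  have "avg_distortion (\<lambda>(x, y) v. d x v) (zip xs ys) vs = avg_distortion d xs vs"
    using assms by (simp add: avg_distortion_def)
  then show ?thesis
    using type_in_constrained[of "zip xs ys" vs] assms ne by simp
qed

lemma pmf_of_multiset_inject:
  assumes "pmf_of_multiset M = pmf_of_multiset N" "size M = size N" "M \<noteq> {#}"
  shows "M = N"
proof (rule multiset_eqI)
  fix u
  have "N \<noteq> {#}" using assms by auto
  moreover have "pmf (pmf_of_multiset M) u = pmf (pmf_of_multiset N) u"
    by (simp only: assms(1))
  ultimately show "count M u = count N u" using assms(2,3) by simp
qed

lemma cond_type_class_card:
  assumes "image_mset fst N = mset xs"
  shows "card {ys. length ys = length xs \<and> mset (zip xs ys) = N} * card (permutations_of_multiset (mset xs))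
    = card (permutations_of_multiset N)"
proof -
  have "bij_betw (zip xs) {ys. length ys = length xs \<and> mset (zip xs ys) = N}
     {zs \<in> permutations_of_multiset N. map fst zs = xs}"
  proof (rule bij_betwI[where g = "map snd"])
    show "map snd \<in> {zs \<in> permutations_of_multiset N. map fst zs = xs} \<rightarrow> {ys. length ys = length xs \<and> mset (zip xs ys) = N}"
      by (auto simp: permutations_of_multiset_def zip_map_fst_snd)
    show "zip xs (map snd zs) = zs" if "zs \<in> {zs \<in> permutations_of_multiset N. map fst zs = xs}" for zs
      using that by (auto simp: zip_map_fst_snd)
  qed (auto simp: permutations_of_multiset_def)
  then have "card {ys. length ys = length xs \<and> mset (zip xs ys) = N} = card {zs \<in> permutations_of_multiset N. map fst zs = xs}"
    by (rule bij_betw_same_card)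
  then show ?thesis
    using card_map_fiber[of xs fst N] assms by (simp add: permutations_of_multiset_def)
qed

text \<open>The words \<open>xs\<close> inject into a fiber of the projection to
  \<open>(y, v)\<close>. Only an inequality holds in general: if \<open>(ys, vs)\<close> has the
  wrong type, there is no such \<open>xs\<close>.\<close>

lemma cond_type_class_card_le:
  fixes W :: "(('x \<times> 'y) \<times> 'v) multiset"
  assumes "length vs = length ys"
  shows "card {xs. length xs = length ys \<and> mset (zip (zip xs ys) vs) = W}
      * card (permutations_of_multiset (image_mset (\<lambda>((x, y), v). (y, v)) W)) \<le> card (permutations_of_multiset W)"
proof (cases "mset (zip ys vs) = image_mset (\<lambda>((x, y), v). (y, v)) W")
  case True
  let ?f = "\<lambda>((x, y), v). (y, v)"
  have "card {xs. length xs = length ys \<and> mset (zip (zip xs ys) vs) = W}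
      \<le> card {zs \<in> permutations_of_multiset W. map ?f zs = zip ys vs}"
  proof (rule card_inj_on_le)
    show "inj_on (\<lambda>xs. zip (zip xs ys) vs) {xs. length xs = length ys \<and> mset (zip (zip xs ys) vs) = W}"
    proof (rule inj_onI)
      fix xs xs' assume "xs \<in> {xs. length xs = length ys \<and> mset (zip (zip xs ys) vs) = W}"
        "xs' \<in> {xs. length xs = length ys \<and> mset (zip (zip xs ys) vs) = W}"
        "zip (zip xs ys) vs = zip (zip xs' ys) vs"
      then have "map fst (map fst (zip (zip xs ys) vs)) = map fst (map fst (zip (zip xs' ys) vs))"
        "length xs = length ys" "length xs' = length ys" by simp_all
      then show "xs = xs'" using assms by simp
    qed
    show "(\<lambda>xs. zip (zip xs ys) vs) ` {xs. length xs = length ys \<and> mset (zip (zip xs ys) vs) = W}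
       \<subseteq> {zs \<in> permutations_of_multiset W. map ?f zs = zip ys vs}"
      using assms by (auto simp: permutations_of_multiset_def intro!: nth_equalityI)
  qed simp
  then have "card {xs. length xs = length ys \<and> mset (zip (zip xs ys) vs) = W} * card (permutations_of_multiset (image_mset ?f W))
      \<le> card {zs \<in> permutations_of_multiset W. map ?f zs = zip ys vs} * card (permutations_of_multiset (image_mset ?f W))"
    by (rule mult_le_mono1)
  also have "card {zs \<in> permutations_of_multiset W. map ?f zs = zip ys vs} * card (permutations_of_multiset (image_mset ?f W))
      = card (permutations_of_multiset W)"
    using True by (intro card_map_fiber) (simp add: permutations_of_multiset_def)
  finally show ?thesis .
next
  case False
  have "{xs. length xs = length ys \<and> mset (zip (zip xs ys) vs) = W} = {}"
  proof (rule ccontr)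
    assume "\<not> ?thesis"
    then obtain xs where xs: "length xs = length ys" "mset (zip (zip xs ys) vs) = W" by blast
    have "map (\<lambda>((x, y), v). (y, v)) (zip (zip xs ys) vs) = zip ys vs"
      using assms xs(1) by (auto intro!: nth_equalityI)
    then show False using False xs(2) by (metis mset_map)
  qed
  then show ?thesis by (simp only: card.empty)
qed

section \<open>Lower bound on the success probability\<close>

abbreviation words :: "nat \<Rightarrow> 'a list set" where
  "words n \<equiv> {xs. length xs = n}"

lemma finite_words: "finite (words n :: 'a::finite list set)"
  using finite_lists_length_eq[of "UNIV :: 'a set" n] by simp

text \<open>The sum over \<open>ys\<close> is outermost because a guess depends on \<open>ys\<close>
  alone, so guesses can be optimized term by term.\<close>

lemma success_prob_sum:
  fixes P :: "'x::finite pmf" and f :: "'x list \<Rightarrow> 'y::finite list pmf"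
  assumes f: "f \<in> randomized_maps d D n"
  shows "success_prob P d\<^sub>e D\<^sub>e n f g = (\<Sum>ys\<in>words n. \<Sum>xs\<in>words n.
    pmf (replicate_pmf n P) xs * pmf (f xs) ys * of_bool (avg_distortion d\<^sub>e xs (g ys) \<le> D\<^sub>e))"
proof -
  let ?A = "{(xs, ys). avg_distortion d\<^sub>e xs (g ys) \<le> D\<^sub>e}"
  have f_sub: "set_pmf (f xs) \<subseteq> words n" if "length xs = n" for xs
    using f that by (auto simp: randomized_maps_def)
  have rep: "set_pmf (replicate_pmf n P) \<subseteq> words n" by (auto simp: set_replicate_pmf)
  have "success_prob P d\<^sub>e D\<^sub>e n f g = measure_pmf.expectation (joint_pmf (replicate_pmf n P) f) (indicator ?A)"
    by (simp add: success_prob_def)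
  also have "\<dots> = (\<Sum>xs\<in>words n. pmf (replicate_pmf n P) xs *
      measure_pmf.expectation (map_pmf (Pair xs) (f xs)) (indicator ?A))"
    unfolding joint_pmf_def
    by (subst pmf_expectation_bind[OF finite_words _ rep])
      (auto intro: finite_subset[OF f_sub finite_words])
  also have "\<dots> = (\<Sum>xs\<in>words n. \<Sum>ys\<in>words n.
    pmf (replicate_pmf n P) xs * pmf (f xs) ys * of_bool (avg_distortion d\<^sub>e xs (g ys) \<le> D\<^sub>e))"
  proof (intro sum.cong refl)
    fix xs :: "'x list" assume "xs \<in> words n"
    then have "measure_pmf.expectation (f xs) (\<lambda>ys. indicator ?A (xs, ys) :: real)
       = (\<Sum>ys\<in>words n. indicator ?A (xs, ys) * pmf (f xs) ys)"
      using f_sub[of xs] by (intro integral_measure_pmf_real finite_words) auto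
    then show "pmf (replicate_pmf n P) xs * measure_pmf.expectation (map_pmf (Pair xs) (f xs)) (indicator ?A)
       = (\<Sum>ys\<in>words n. pmf (replicate_pmf n P) xs * pmf (f xs) ys * of_bool (avg_distortion d\<^sub>e xs (g ys) \<le> D\<^sub>e))"
      unfolding integral_map_pmf
      by (simp only: sum_distrib_left) (intro sum.cong refl, simp add: indicator_def of_bool_def)
  qed
  also have "\<dots> = (\<Sum>ys\<in>words n. \<Sum>xs\<in>words n.
    pmf (replicate_pmf n P) xs * pmf (f xs) ys * of_bool (avg_distortion d\<^sub>e xs (g ys) \<le> D\<^sub>e))"
    by (rule sum.swap)
  finally show ?thesis .
qed

text \<open>The guesser draws \<open>vs\<close> with weight proportional to this ratio; the best guess does at least as
  well as this average.\<close>

definition type_ratio :: "'y list \<Rightarrow> 'v list \<Rightarrow> real" where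
  "type_ratio ys vs = card (permutations_of_multiset (mset ys)) / card (permutations_of_multiset (mset (zip ys vs)))"

lemma type_ratio_nonneg: "0 \<le> type_ratio ys vs"
  by (simp add: type_ratio_def)

text \<open>Over the \<open>vs\<close> of one joint type the ratios are uniform weights on a
  conditional type class and add up to at most 1. Normalizing the random guesser thus costs only the
  number of joint types.\<close>

lemma sum_type_ratio_le:
  fixes ys :: "'y::finite list"
  assumes "length ys = n"
  shows "(\<Sum>vs\<in>words n. type_ratio ys (vs :: 'v::finite list)) \<le> real ((n + 1) ^ CARD('y \<times> 'v))"
proof -
  let ?T = "{N :: ('y \<times> 'v) multiset. size N = n}"
  have "(\<Sum>vs\<in>words n. type_ratio ys (vs :: 'v list))
      = (\<Sum>N\<in>?T. \<Sum>vs\<in>{vs \<in> words n. mset (zip ys vs) = N}. type_ratio ys vs)"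
    using assms by (intro sum.group[symmetric] finite_words card_multisets_of_size_le(1)) auto
  also have "\<dots> \<le> (\<Sum>N\<in>?T. 1)"
  proof (rule sum_mono)
    fix N :: "('y \<times> 'v) multiset"
    show "(\<Sum>vs\<in>{vs \<in> words n. mset (zip ys vs) = N}. type_ratio ys vs) \<le> 1"
    proof (cases "image_mset fst N = mset ys")
      case True
      have "(\<Sum>vs\<in>{vs \<in> words n. mset (zip ys vs) = N}. type_ratio ys vs)
          = (\<Sum>vs\<in>{vs \<in> words n. mset (zip ys vs) = N}.
              card (permutations_of_multiset (mset ys)) / card (permutations_of_multiset N))"
        by (intro sum.cong) (auto simp: type_ratio_def)
      also have "\<dots> = real (card {vs. length vs = length ys \<and> mset (zip ys vs) = N} * card (permutations_of_multiset (mset ys)))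
          / card (permutations_of_multiset N)"
        using assms by simp
      also have "\<dots> \<le> 1"
        unfolding cond_type_class_card[OF True] by simp
      finally show ?thesis .
    next
      case False
      have "{vs \<in> words n. mset (zip ys vs) = N} = {}"
        using False assms by (auto simp: image_mset_zip)
      then show ?thesis by (simp only: sum.empty)
    qed
  qed
  also have "\<dots> \<le> real ((n + 1) ^ CARD('y \<times> 'v))"
    using card_multisets_of_size_le(2)[where 'u = "'y \<times> 'v", of n] by (simp only: sum_constant mult_1_right of_nat_le_iff)
  finally show ?thesis .
qed

section \<open>The two nested rates\<close>

locale lossy_guessing =
  fixes P :: "'x::finite pmf"
    and d :: "'x \<Rightarrow> 'y::finite \<Rightarrow> real"
    and d\<^sub>e :: "'x \<Rightarrow> 'v::finite \<Rightarrow> real"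
    and D D\<^sub>e :: real
  assumes full_support: "set_pmf P = UNIV"
    and feasible: "\<exists>y. d x y \<le> D"
    and feasible_e: "\<exists>v. d\<^sub>e x v \<le> D\<^sub>e"
begin

text \<open>Lifted to pairs, ignoring \<open>y\<close>, so that the inner problem is an instance of
  \<open>min_value\<close> whose prescribed marginal is the law of \<open>(x, y)\<close>.\<close>

definition cost :: "'x \<times> 'y \<Rightarrow> 'v \<Rightarrow> real" where
  "cost = (\<lambda>(x, y) v. d\<^sub>e x v)"

lemma feasible_cost: "\<exists>v. cost xy v \<le> D\<^sub>e"
  using feasible_e by (cases xy) (simp add: cost_def)

definition rate :: "('x \<times> 'y) pmf \<Rightarrow> real" where
  "rate = min_value cond_mutual_info cost D\<^sub>e"

text \<open>The maximum is a negated minimum, so that attainment and continuity of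
  \<open>min_value\<close> apply again.\<close>

definition max_rate :: "'x pmf \<Rightarrow> real" where
  "max_rate Q = - min_value (\<lambda>J. - rate J) d D Q"

definition objective :: "'x pmf \<Rightarrow> real" where
  "objective Q = KL_div Q P + max_rate Q"

lemma unif_cont_rate: "unif_cont rate"
  unfolding rate_def by (intro unif_cont_min_value unif_cont_cond_mutual_info feasible_cost)

lemma rate_le_max_rate:
  assumes "J \<in> constrained d D Q" shows "rate J \<le> max_rate Q"
  using min_value_le[of "\<lambda>J. - rate J" d D J Q, OF unif_cont_uminus[OF unif_cont_rate] feasible assms]
  by (simp add: max_rate_def)

lemma max_rate_attained:
  obtains J where "J \<in> constrained d D Q" "max_rate Q = rate J"
proof -
  obtain J where "J \<in> constrained d D Q" "min_value (\<lambda>J. - rate J) d D Q = - rate J"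
    using min_value_attained[of "\<lambda>J. - rate J" d D Q, OF unif_cont_uminus[OF unif_cont_rate] feasible]
    by metis
  then show ?thesis using that by (simp add: max_rate_def)
qed

lemma rate_attained:
  obtains q where "q \<in> constrained cost D\<^sub>e J" "rate J = cond_mutual_info q"
  using min_value_attained[of cond_mutual_info cost D\<^sub>e J, OF unif_cont_cond_mutual_info feasible_cost]
  unfolding rate_def by metis

lemma rate_le:
  "q \<in> constrained cost D\<^sub>e J \<Longrightarrow> rate J \<le> cond_mutual_info q"
  unfolding rate_def by (rule min_value_le[OF unif_cont_cond_mutual_info feasible_cost])

lemma unif_cont_max_rate: "unif_cont max_rate"
  unfolding max_rate_def[abs_def]
  by (intro unif_cont_uminus unif_cont_min_value unif_cont_rate feasible)

lemma unif_cont_objective: "unif_cont objective"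
  unfolding objective_def[abs_def]
  by (intro unif_cont_add unif_cont_KL_div full_support unif_cont_max_rate)

definition ratio_error :: "nat \<Rightarrow> real" where
  "ratio_error n = 4 * (real (CARD(('x \<times> 'y) \<times> 'v) + 1) * type_error n)"

lemma cond_ratio_bounds:
  fixes W :: "(('x \<times> 'y) \<times> 'v) multiset"
  assumes "size W = n" "n > 0"
  defines "t \<equiv> real (card (permutations_of_multiset W)) * real (card (permutations_of_multiset (image_mset (\<lambda>((x, y), v). y) W))) /
      (real (card (permutations_of_multiset (image_mset fst W))) * real (card (permutations_of_multiset (image_mset (\<lambda>((x, y), v). (y, v)) W))))"
  shows "2 powr (- real n * cond_mutual_info (pmf_of_multiset W) - ratio_error n) \<le> t"
    "t \<le> 2 powr (- real n * cond_mutual_info (pmf_of_multiset W) + ratio_error n)"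
proof -
  have t: "t > 0" by (simp add: t_def card_type_class_pos)
  have "\<bar>log 2 t + real n * cond_mutual_info (pmf_of_multiset W)\<bar> \<le> ratio_error n"
    using log_cond_type_ratio[OF assms(1,2)] by (simp only: t_def ratio_error_def of_nat_mult)
  then have "- real n * cond_mutual_info (pmf_of_multiset W) - ratio_error n \<le> log 2 t"
    "log 2 t \<le> - real n * cond_mutual_info (pmf_of_multiset W) + ratio_error n" by linarith+
  then have "2 powr (- real n * cond_mutual_info (pmf_of_multiset W) - ratio_error n) \<le> 2 powr (log 2 t)"
    "2 powr (log 2 t) \<le> 2 powr (- real n * cond_mutual_info (pmf_of_multiset W) + ratio_error n)"
    by simp_all
  then show "2 powr (- real n * cond_mutual_info (pmf_of_multiset W) - ratio_error n) \<le> t"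
    "t \<le> 2 powr (- real n * cond_mutual_info (pmf_of_multiset W) + ratio_error n)"
    using t by simp_all
qed

text \<open>The joint type of \<open>(xs, ys)\<close> is feasible, so its rate is at most
  \<open>max_rate\<close>, whatever the map chose. An optimal law is rounded to a type
  \<open>W\<close> without disturbing that joint type. Every \<open>vs\<close> completing to
  \<open>W\<close> succeeds with the same weight, and their number times this weight is the
  conditional ratio.\<close>

lemma sum_type_ratio_ge:
  assumes n: "n > 0" and len: "length xs = n" "length ys = n"
    and dist: "avg_distortion d xs ys \<le> D"
    and \<epsilon>: "\<And>p q :: (('x \<times> 'y) \<times> 'v) pmf. l1_dist p q \<le> 2 * real CARD(('x \<times> 'y) \<times> 'v) / real n \<Longrightarrow>
      \<bar>cond_mutual_info p - cond_mutual_info q\<bar> \<le> \<epsilon>"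
  shows "2 powr (- real n * (max_rate (pmf_of_multiset (mset xs)) + \<epsilon>) - ratio_error n)
    \<le> (\<Sum>vs\<in>words n. type_ratio ys vs * of_bool (avg_distortion d\<^sub>e xs vs \<le> D\<^sub>e))"
proof -
  define N where "N = mset (zip xs ys)"
  define J where "J = pmf_of_multiset N"
  have ne: "xs \<noteq> []" using n len by auto
  have Nsz: "size N = n" using len by (simp add: N_def)
  then have Nne: "N \<noteq> {#}" using n by auto
  have "J \<in> constrained d D (pmf_of_multiset (mset xs))"
    unfolding J_def N_def using dist len ne by (subst type_in_constrained) auto
  then have rJ: "rate J \<le> max_rate (pmf_of_multiset (mset xs))" by (rule rate_le_max_rate)
  obtain q where q: "q \<in> constrained cost D\<^sub>e J" "rate J = cond_mutual_info q"
    by (rule rate_attained)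
  have "real n * pmf J a \<in> \<nat>" for a
    using Nne Nsz n by (simp add: J_def)
  then obtain q' where q': "q' \<in> constrained cost D\<^sub>e J" "\<And>u. real n * pmf q' u \<in> \<nat>"
    "l1_dist q q' \<le> 2 * real CARD(('x \<times> 'y) \<times> 'v) / real n"
    using constrained_round[OF q(1) n] by blast
  obtain W where W: "size W = n" "pmf_of_multiset W = q'"
    using obtain_multiset_of_pmf[OF n q'(2)] by blast
  have Wne: "W \<noteq> {#}" using W n by auto
  have "pmf_of_multiset (image_mset fst W) = pmf_of_multiset N"
    using q'(1) by (simp add: constrained_def J_def W flip: map_pmf_of_multiset[OF Wne])
  then have W1: "image_mset fst W = N"
    by (rule pmf_of_multiset_inject) (use W Nsz Wne in auto)
  define A where "A = {vs. length vs = length (zip xs ys) \<and> mset (zip (zip xs ys) vs) = W}"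
  have A: "length vs = n" "avg_distortion d\<^sub>e xs vs \<le> D\<^sub>e" "mset (zip ys vs) = image_mset (\<lambda>((x, y), v). (y, v)) W"
    "mset ys = image_mset (\<lambda>((x, y), v). y) W"
    if "vs \<in> A" for vs
  proof -
    show l: "length vs = n" using that len by (simp add: A_def)
    have Wz: "mset (zip (zip xs ys) vs) = W" using that by (simp add: A_def)
    have "q' \<in> constrained (\<lambda>(x, y) v. d\<^sub>e x v) D\<^sub>e (pmf_of_multiset (mset (zip xs ys)))"
      using q'(1) by (simp add: cost_def J_def N_def)
    then show "avg_distortion d\<^sub>e xs vs \<le> D\<^sub>e"
      unfolding W(2)[symmetric] Wz[symmetric] using l len ne by (subst (asm) type_in_constrained_fst) auto
    have "map (\<lambda>((x, y), v). (y, v)) (zip (zip xs ys) vs) = zip ys vs"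
      using l len by (auto intro!: nth_equalityI)
    then show "mset (zip ys vs) = image_mset (\<lambda>((x, y), v). (y, v)) W"
      unfolding Wz[symmetric] by (metis mset_map)
    have "map (\<lambda>((x, y), v). y) (zip (zip xs ys) vs) = ys"
      using l len by (auto intro!: nth_equalityI)
    then show "mset ys = image_mset (\<lambda>((x, y), v). y) W"
      unfolding Wz[symmetric] by (metis mset_map)
  qed
  have cA: "card A * card (permutations_of_multiset N) = card (permutations_of_multiset W)"
    unfolding A_def using cond_type_class_card[of W "zip xs ys"] W1 by (simp add: N_def)
  let ?C = "\<lambda>U. real (card (permutations_of_multiset U))"
  have "real n * cond_mutual_info q' \<le> real n * (max_rate (pmf_of_multiset (mset xs)) + \<epsilon>)"
    using \<epsilon>[OF q'(3)] rJ q(2) by (intro mult_left_mono) auto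
  then have "2 powr (- real n * (max_rate (pmf_of_multiset (mset xs)) + \<epsilon>) - ratio_error n)
     \<le> 2 powr (- real n * cond_mutual_info (pmf_of_multiset W) - ratio_error n)"
    by (simp add: W(2))
  also have "\<dots> \<le> ?C W * ?C (image_mset (\<lambda>((x, y), v). y) W) /
      (?C (image_mset fst W) * ?C (image_mset (\<lambda>((x, y), v). (y, v)) W))"
    by (rule cond_ratio_bounds(1)[OF W(1) n])
  also have "\<dots> = real (card A) * (?C (image_mset (\<lambda>((x, y), v). y) W) / ?C (image_mset (\<lambda>((x, y), v). (y, v)) W))"
    using cA[symmetric] card_type_class_pos[of N] by (simp add: W1)
  also have "\<dots> = (\<Sum>vs\<in>A. type_ratio ys vs * of_bool (avg_distortion d\<^sub>e xs vs \<le> D\<^sub>e))"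
    by (simp add: type_ratio_def A)
  also have "\<dots> \<le> (\<Sum>vs\<in>words n. type_ratio ys vs * of_bool (avg_distortion d\<^sub>e xs vs \<le> D\<^sub>e))"
    by (rule sum_mono2[OF finite_words]) (auto simp: A(1) type_ratio_nonneg)
  finally show ?thesis .
qed

text \<open>For each \<open>ys\<close> the best guess is at least as good as the average weighted by
  \<open>type_ratio\<close>. Only source words of type \<open>M\<close> are kept: their total
  probability yields the divergence, and each is hit with total weight at least
  \<open>\<rho>\<close>.\<close>

lemma success_prob_ge:
  assumes n: "n > 0" and f: "f \<in> randomized_maps d D n" and M: "size M = n"
    and \<epsilon>: "\<And>p q :: (('x \<times> 'y) \<times> 'v) pmf. l1_dist p q \<le> 2 * real CARD(('x \<times> 'y) \<times> 'v) / real n \<Longrightarrow>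
      \<bar>cond_mutual_info p - cond_mutual_info q\<bar> \<le> \<epsilon>"
  shows "\<exists>g\<in>guessers n.
    2 powr (- real n * (objective (pmf_of_multiset M) + \<epsilon>) - ratio_error n - real (CARD('x) + 1) * type_error n)
      \<le> success_prob P d\<^sub>e D\<^sub>e n f g * real ((n + 1) ^ CARD('y \<times> 'v))"
proof -
  \<comment> \<open>The probability that \<open>ys\<close> is observed and the guess
    \<open>vs\<close> is accepted; maximizing it separately for each \<open>ys\<close> gives an
    optimal guesser.\<close>
  define S where "S ys vs = (\<Sum>xs\<in>words n. pmf (replicate_pmf n P) xs * pmf (f xs) ys * of_bool (avg_distortion d\<^sub>e xs vs \<le> D\<^sub>e))"
    for ys :: "'y list" and vs :: "'v list"
  have S0: "0 \<le> S ys vs" for ys vs by (simp add: S_def sum_nonneg)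
  have "\<exists>v\<in>words n. \<forall>vs\<in>words n. S ys vs \<le> S ys v" for ys
  proof -
    have ne: "words n \<noteq> ({} :: 'v list set)" using Ex_list_of_length[of n] by auto
    have "Max (S ys ` words n) \<in> S ys ` words n"
      using ne finite_words by (intro Max_in) auto
    then obtain v where "v \<in> words n" "Max (S ys ` words n) = S ys v" by (meson imageE)
    then show ?thesis using Max_ge[of "S ys ` words n"] finite_words by fastforce
  qed
  then obtain g where g: "\<And>ys. g ys \<in> words n" "\<And>ys vs. vs \<in> words n \<Longrightarrow> S ys vs \<le> S ys (g ys)"
    by metis
  have gG: "g \<in> guessers n" using g(1) by (simp add: guessers_def)
  let ?B = "real ((n + 1) ^ CARD('y \<times> 'v))"
  let ?Q = "pmf_of_multiset M"
  define \<rho> where "\<rho> = 2 powr (- real n * (max_rate ?Q + \<epsilon>) - ratio_error n)"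
  have f_sub: "set_pmf (f xs) \<subseteq> words n" and f_dist: "\<And>ys. ys \<in> set_pmf (f xs) \<Longrightarrow> avg_distortion d xs ys \<le> D"
    if "length xs = n" for xs
    using f that by (auto simp: randomized_maps_def)
  define TM where "TM = permutations_of_multiset M"
  have TM: "TM \<subseteq> words n" using M by (auto simp: TM_def permutations_of_multiset_def)
  have "type_weight P M * card TM * \<rho> = (\<Sum>xs\<in>TM. type_weight P M * \<rho>)" by simp
  also have "\<dots> = (\<Sum>xs\<in>TM. \<Sum>ys\<in>words n. pmf (replicate_pmf n P) xs * (pmf (f xs) ys * \<rho>))"
  proof (rule sum.cong[OF refl])
    fix xs assume xs: "xs \<in> TM"
    then have l: "length xs = n" "mset xs = M" using TM by (auto simp: TM_def permutations_of_multiset_def)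
    have "(\<Sum>ys\<in>words n. pmf (f xs) ys) = 1"
      by (rule sum_pmf_eq_1[OF finite_words f_sub[OF l(1)]])
    then have "(\<Sum>ys\<in>words n. pmf (replicate_pmf n P) xs * (pmf (f xs) ys * \<rho>)) = pmf (replicate_pmf n P) xs * \<rho>"
      by (simp flip: sum_distrib_left sum_distrib_right)
    then show "type_weight P M * \<rho> = (\<Sum>ys\<in>words n. pmf (replicate_pmf n P) xs * (pmf (f xs) ys * \<rho>))"
      using pmf_replicate_pmf_count[OF l(1), of P] l(2) by (simp add: type_weight_def)
  qed
  also have "\<dots> \<le> (\<Sum>xs\<in>TM. \<Sum>ys\<in>words n. pmf (replicate_pmf n P) xs * (pmf (f xs) ys *
      (\<Sum>vs\<in>words n. type_ratio ys vs * of_bool (avg_distortion d\<^sub>e xs vs \<le> D\<^sub>e))))"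
  proof (rule sum_mono, rule sum_mono, rule mult_left_mono)
    fix xs :: "'x list" and ys :: "'y list" assume "xs \<in> TM" and ys: "ys \<in> words n"
    then have l: "length xs = n" "mset xs = M" using TM by (auto simp: TM_def permutations_of_multiset_def)
    show "pmf (f xs) ys * \<rho> \<le> pmf (f xs) ys * (\<Sum>vs\<in>words n. type_ratio ys vs * of_bool (avg_distortion d\<^sub>e xs vs \<le> D\<^sub>e))"
    proof (cases "ys \<in> set_pmf (f xs)")
      case True
      have "\<rho> \<le> (\<Sum>vs\<in>words n. type_ratio ys vs * of_bool (avg_distortion d\<^sub>e xs vs \<le> D\<^sub>e))"
        unfolding \<rho>_def l(2)[symmetric] using ys
        by (intro sum_type_ratio_ge n l f_dist[OF l(1) True] \<epsilon>) auto
      then show ?thesis by (intro mult_left_mono) auto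
    qed (simp add: set_pmf_iff)
  qed simp
  also have "\<dots> \<le> (\<Sum>xs\<in>words n. \<Sum>ys\<in>words n. pmf (replicate_pmf n P) xs * (pmf (f xs) ys *
      (\<Sum>vs\<in>words n. type_ratio ys vs * of_bool (avg_distortion d\<^sub>e xs vs \<le> D\<^sub>e))))"
    by (rule sum_mono2[OF finite_words TM]) (auto intro!: sum_nonneg mult_nonneg_nonneg type_ratio_nonneg)
  also have "\<dots> = (\<Sum>ys\<in>words n. \<Sum>xs\<in>words n. \<Sum>vs\<in>words n. pmf (replicate_pmf n P) xs * (pmf (f xs) ys *
      (type_ratio ys vs * of_bool (avg_distortion d\<^sub>e xs vs \<le> D\<^sub>e))))"
    unfolding sum_distrib_left by (rule sum.swap)
  also have "\<dots> = (\<Sum>ys\<in>words n. \<Sum>vs\<in>words n. S ys vs * type_ratio ys vs)"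
  proof (rule sum.cong[OF refl])
    fix ys :: "'y list"
    have "(\<Sum>xs\<in>words n. \<Sum>vs\<in>words n. pmf (replicate_pmf n P) xs * (pmf (f xs) ys *
      (type_ratio ys vs * of_bool (avg_distortion d\<^sub>e xs vs \<le> D\<^sub>e)))) = (\<Sum>vs\<in>words n. \<Sum>xs\<in>words n. pmf (replicate_pmf n P) xs * (pmf (f xs) ys *
      (type_ratio ys vs * of_bool (avg_distortion d\<^sub>e xs vs \<le> D\<^sub>e))))" by (rule sum.swap)
    also have "\<dots> = (\<Sum>vs\<in>words n. S ys vs * type_ratio ys vs)"
      unfolding S_def sum_distrib_right by (intro sum.cong refl) (simp add: mult.assoc mult.commute)
    finally show "(\<Sum>xs\<in>words n. \<Sum>vs\<in>words n. pmf (replicate_pmf n P) xs * (pmf (f xs) ys *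
      (type_ratio ys vs * of_bool (avg_distortion d\<^sub>e xs vs \<le> D\<^sub>e)))) = (\<Sum>vs\<in>words n. S ys vs * type_ratio ys vs)" .
  qed
  also have "\<dots> \<le> (\<Sum>ys\<in>words n. S ys (g ys) * ?B)"
  proof (rule sum_mono)
    fix ys :: "'y list" assume "ys \<in> words n"
    have "(\<Sum>vs\<in>words n. S ys vs * type_ratio ys vs) \<le> (\<Sum>vs\<in>words n. S ys (g ys) * type_ratio ys (vs :: 'v list))"
      by (rule sum_mono, rule mult_right_mono, rule g(2)) (simp_all add: type_ratio_nonneg)
    also have "\<dots> = S ys (g ys) * (\<Sum>vs\<in>words n. type_ratio ys (vs :: 'v list))"
      by (simp add: sum_distrib_left)
    also have "\<dots> \<le> S ys (g ys) * ?B"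
      using \<open>ys \<in> words n\<close> by (intro mult_left_mono sum_type_ratio_le S0) auto
    finally show "(\<Sum>vs\<in>words n. S ys vs * type_ratio ys vs) \<le> S ys (g ys) * ?B" .
  qed
  also have "\<dots> = success_prob P d\<^sub>e D\<^sub>e n f g * ?B"
    unfolding success_prob_sum[OF f] S_def sum_distrib_right ..
  finally have main: "type_weight P M * card TM * \<rho> \<le> success_prob P d\<^sub>e D\<^sub>e n f g * ?B" .
  note w = log_type_prob[OF full_support M n]
  have pos: "type_weight P M * card TM > 0" using w(1) card_type_class_pos[of M] by (simp add: TM_def)
  have "2 powr (- real n * KL_div ?Q P - real (CARD('x) + 1) * type_error n) \<le> 2 powr (log 2 (type_weight P M * card TM))"
    using w(2) unfolding TM_def by simp
  then have "2 powr (- real n * KL_div ?Q P - real (CARD('x) + 1) * type_error n) \<le> type_weight P M * card TM"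
    using pos by simp
  then have "2 powr (- real n * KL_div ?Q P - real (CARD('x) + 1) * type_error n) * \<rho> \<le> type_weight P M * card TM * \<rho>"
    by (rule mult_right_mono) (simp add: \<rho>_def)
  also have "2 powr (- real n * KL_div ?Q P - real (CARD('x) + 1) * type_error n) * \<rho> =
    2 powr (- real n * (objective ?Q + \<epsilon>) - ratio_error n - real (CARD('x) + 1) * type_error n)"
    unfolding \<rho>_def powr_add[symmetric] objective_def by (simp add: algebra_simps)
  finally show ?thesis using main gG by (meson order_trans)
qed

end

section \<open>Upper bound on the success probability\<close>

context lossy_guessing begin

text \<open>The maximising channel, rounded to a joint type whose marginal is exactly \<open>M\<close>, so that every
  output word satisfies the distortion bound.\<close>

definition hiding_type :: "real \<Rightarrow> 'x multiset \<Rightarrow> ('x \<times> 'y) multiset" where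
  "hiding_type \<epsilon> M = (SOME N. size N = size M \<and> image_mset fst N = M \<and>
     pmf_of_multiset N \<in> constrained d D (pmf_of_multiset M) \<and>
     max_rate (pmf_of_multiset M) - \<epsilon> \<le> rate (pmf_of_multiset N))"

lemma hiding_type:
  assumes n: "n > 0" and M: "size M = n"
    and \<epsilon>: "\<And>p q :: ('x \<times> 'y) pmf. l1_dist p q \<le> 2 * real CARD('x \<times> 'y) / real n \<Longrightarrow> \<bar>rate p - rate q\<bar> \<le> \<epsilon>"
  shows "size (hiding_type \<epsilon> M) = n" "image_mset fst (hiding_type \<epsilon> M) = M"
     "pmf_of_multiset (hiding_type \<epsilon> M) \<in> constrained d D (pmf_of_multiset M)"
     "max_rate (pmf_of_multiset M) - \<epsilon> \<le> rate (pmf_of_multiset (hiding_type \<epsilon> M))"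
proof -
  have Mne: "M \<noteq> {#}" using M n by auto
  obtain J where J: "J \<in> constrained d D (pmf_of_multiset M)" "max_rate (pmf_of_multiset M) = rate J"
    by (rule max_rate_attained)
  have "real n * pmf (pmf_of_multiset M) a \<in> \<nat>" for a
    using Mne M n by simp
  then obtain q where q: "q \<in> constrained d D (pmf_of_multiset M)" "\<And>u. real n * pmf q u \<in> \<nat>"
    "l1_dist J q \<le> 2 * real CARD('x \<times> 'y) / real n"
    using constrained_round[OF J(1) n] by blast
  obtain N where N: "size N = n" "pmf_of_multiset N = q"
    using obtain_multiset_of_pmf[OF n q(2)] by blast
  have Nne: "N \<noteq> {#}" using N n by auto
  have "pmf_of_multiset (image_mset fst N) = pmf_of_multiset M"
    using q(1) by (simp add: constrained_def N flip: map_pmf_of_multiset[OF Nne])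
  then have N1: "image_mset fst N = M"
    by (rule pmf_of_multiset_inject) (use N M Nne in auto)
  have "size N = size M \<and> image_mset fst N = M \<and>
     pmf_of_multiset N \<in> constrained d D (pmf_of_multiset M) \<and>
     max_rate (pmf_of_multiset M) - \<epsilon> \<le> rate (pmf_of_multiset N)"
    using N1 q(1) \<epsilon>[OF q(3)] J(2) N M by auto
  then have "size (hiding_type \<epsilon> M) = size M \<and> image_mset fst (hiding_type \<epsilon> M) = M \<and>
     pmf_of_multiset (hiding_type \<epsilon> M) \<in> constrained d D (pmf_of_multiset M) \<and>
     max_rate (pmf_of_multiset M) - \<epsilon> \<le> rate (pmf_of_multiset (hiding_type \<epsilon> M))"
    unfolding hiding_type_def by (rule someI)
  then show "size (hiding_type \<epsilon> M) = n" "image_mset fst (hiding_type \<epsilon> M) = M"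
     "pmf_of_multiset (hiding_type \<epsilon> M) \<in> constrained d D (pmf_of_multiset M)"
     "max_rate (pmf_of_multiset M) - \<epsilon> \<le> rate (pmf_of_multiset (hiding_type \<epsilon> M))"
    using M by auto
qed

definition hiding_set :: "real \<Rightarrow> 'x list \<Rightarrow> 'y list set" where
  "hiding_set \<epsilon> xs = {ys. length ys = length xs \<and> mset (zip xs ys) = hiding_type \<epsilon> (mset xs)}"

definition hiding_map :: "real \<Rightarrow> 'x list \<Rightarrow> 'y list pmf" where
  "hiding_map \<epsilon> xs = pmf_of_set (hiding_set \<epsilon> xs)"

lemma finite_hiding_set: "finite (hiding_set \<epsilon> xs)"
  by (rule finite_subset[OF _ finite_words[of "length xs"]]) (auto simp: hiding_set_def)

text \<open>Pairs \<open>(xs, ys)\<close> of type \<open>N\<close> with a successful guess are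
  grouped by the type \<open>W\<close> of \<open>(xs, ys, g ys)\<close>. Each such \<open>W\<close>
  is feasible for the inner problem, so its mutual information is at least the rate of
  \<open>N\<close>. The bound is uniform in \<open>g\<close>, since for given \<open>ys\<close> the
  guess is one fixed word.\<close>

lemma card_successful_words_le:
  fixes N :: "('x \<times> 'y) multiset" and g :: "'y list \<Rightarrow> 'v list"
  assumes n: "n > 0" and g: "g \<in> guessers n" and N: "size N = n"
  shows "(\<Sum>ys\<in>words n. real (card {xs \<in> words n. mset (zip xs ys) = N \<and> avg_distortion d\<^sub>e xs (g ys) \<le> D\<^sub>e}))
    \<le> real (card (permutations_of_multiset N)) * (real ((n + 1) ^ CARD(('x \<times> 'y) \<times> 'v)) *
       2 powr (- real n * rate (pmf_of_multiset N) + ratio_error n))"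
proof -
  let ?C = "\<lambda>U. real (card (permutations_of_multiset U))"
  let ?NY = "image_mset snd N"
  define \<Omega> where "\<Omega> = {W :: (('x \<times> 'y) \<times> 'v) multiset. size W = n \<and> image_mset fst W = N \<and>
     pmf_of_multiset W \<in> constrained cost D\<^sub>e (pmf_of_multiset N)}"
  have \<Omega>_sub: "\<Omega> \<subseteq> {W. size W = n}" by (auto simp: \<Omega>_def)
  have fin\<Omega>: "finite \<Omega>" by (rule finite_subset[OF \<Omega>_sub card_multisets_of_size_le(1)])
  have card\<Omega>: "card \<Omega> \<le> (n + 1) ^ CARD(('x \<times> 'y) \<times> 'v)"
    by (rule order_trans[OF card_mono[OF card_multisets_of_size_le(1) \<Omega>_sub] card_multisets_of_size_le(2)])
  define good where "good ys = {xs \<in> words n. mset (zip xs ys) = N \<and> avg_distortion d\<^sub>e xs (g ys) \<le> D\<^sub>e}" for ys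
  let ?Y = "permutations_of_multiset ?NY"
  have Y: "?Y \<subseteq> words n"
    using N by (auto simp: permutations_of_multiset_def simp flip: size_mset)
  \<comment> \<open>Only \<open>ys\<close> of the marginal type \<open>?NY\<close> contribute; their
    number supplies the class size of \<open>y\<close> in the conditional ratio.\<close>
  have "(\<Sum>ys\<in>words n. real (card (good ys))) = (\<Sum>ys\<in>?Y. real (card (good ys)))"
  proof (rule sum.mono_neutral_right[OF finite_words Y], rule ballI)
    fix ys assume ys: "ys \<in> words n - ?Y"
    have "good ys = {}"
      using ys by (auto simp: good_def permutations_of_multiset_def image_mset_zip)
    then show "real (card (good ys)) = 0" by simp
  qed
  also have "\<dots> \<le> (\<Sum>ys\<in>?Y. \<Sum>W\<in>\<Omega>. ?C W / ?C (image_mset (\<lambda>((x, y), v). (y, v)) W))"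
  proof (rule sum_mono)
    fix ys assume "ys \<in> ?Y"
    then have len: "length ys = n" using Y by auto
    then have gl: "length (g ys) = n" using g by (auto simp: guessers_def)
    let ?A = "\<lambda>W. {xs :: 'x list. length xs = length ys \<and> mset (zip (zip xs ys) (g ys)) = W}"
    have "good ys \<subseteq> (\<Union>W\<in>\<Omega>. ?A W)"
    proof
      fix xs assume xs: "xs \<in> good ys"
      then have l: "length xs = n" "mset (zip xs ys) = N" "avg_distortion d\<^sub>e xs (g ys) \<le> D\<^sub>e"
        by (auto simp: good_def)
      then have "pmf_of_multiset (mset (zip (zip xs ys) (g ys))) \<in> constrained (\<lambda>(x, y) v. d\<^sub>e x v) D\<^sub>e (pmf_of_multiset (mset (zip xs ys)))"
        using len gl n by (subst type_in_constrained_fst) auto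
      then have "mset (zip (zip xs ys) (g ys)) \<in> \<Omega>"
        using l len gl by (simp add: \<Omega>_def cost_def image_mset_zip)
      then show "xs \<in> (\<Union>W\<in>\<Omega>. ?A W)" using l len by auto
    qed
    moreover have finA: "finite (?A W)" for W
      by (rule finite_subset[OF _ finite_words[of n]]) (auto simp: len)
    ultimately have "card (good ys) \<le> card (\<Union>W\<in>\<Omega>. ?A W)"
      using fin\<Omega> by (intro card_mono) auto
    also have "\<dots> \<le> (\<Sum>W\<in>\<Omega>. card (?A W))" by (rule card_UN_le[OF fin\<Omega>])
    finally have "real (card (good ys)) \<le> (\<Sum>W\<in>\<Omega>. real (card (?A W)))"
      by (simp flip: of_nat_sum)
    also have "\<dots> \<le> (\<Sum>W\<in>\<Omega>. ?C W / ?C (image_mset (\<lambda>((x, y), v). (y, v)) W))"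
    proof (rule sum_mono)
      fix W :: "(('x \<times> 'y) \<times> 'v) multiset"
      have "real (card (?A W)) * ?C (image_mset (\<lambda>((x, y), v). (y, v)) W) \<le> ?C W"
        using cond_type_class_card_le[of "g ys" ys W] len gl
        by (simp only: of_nat_mult[symmetric] of_nat_le_iff)
      then show "real (card (?A W)) \<le> ?C W / ?C (image_mset (\<lambda>((x, y), v). (y, v)) W)"
        by (simp only: pos_le_divide_eq card_type_class_pos of_nat_0_less_iff)
    qed
    finally show "real (card (good ys)) \<le> (\<Sum>W\<in>\<Omega>. ?C W / ?C (image_mset (\<lambda>((x, y), v). (y, v)) W))" .
  qed
  also have "\<dots> = (\<Sum>W\<in>\<Omega>. ?C ?NY * ?C W / ?C (image_mset (\<lambda>((x, y), v). (y, v)) W))"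
    by (simp add: sum_distrib_left)
  also have "\<dots> \<le> (\<Sum>W\<in>\<Omega>. ?C N * 2 powr (- real n * rate (pmf_of_multiset N) + ratio_error n))"
  proof (rule sum_mono)
    fix W assume W: "W \<in> \<Omega>"
    then have Wp: "size W = n" "image_mset fst W = N" "pmf_of_multiset W \<in> constrained cost D\<^sub>e (pmf_of_multiset N)"
      by (auto simp: \<Omega>_def)
    have "image_mset (\<lambda>((x, y), v). y) W = image_mset snd (image_mset fst W)"
      by (simp add: multiset.map_comp comp_def case_prod_unfold)
    then have WY: "image_mset (\<lambda>((x, y), v). y) W = ?NY" by (simp only: Wp(2))
    have "?C W * ?C ?NY / (?C N * ?C (image_mset (\<lambda>((x, y), v). (y, v)) W))
       \<le> 2 powr (- real n * cond_mutual_info (pmf_of_multiset W) + ratio_error n)"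
      using cond_ratio_bounds(2)[OF Wp(1) n] by (simp only: WY Wp(2))
    also have "\<dots> \<le> 2 powr (- real n * rate (pmf_of_multiset N) + ratio_error n)"
      using rate_le[OF Wp(3)] by (simp add: mult_left_mono)
    finally have "?C N * (?C W * ?C ?NY / (?C N * ?C (image_mset (\<lambda>((x, y), v). (y, v)) W)))
       \<le> ?C N * 2 powr (- real n * rate (pmf_of_multiset N) + ratio_error n)"
      by (intro mult_left_mono) simp_all
    then show "?C ?NY * ?C W / ?C (image_mset (\<lambda>((x, y), v). (y, v)) W)
       \<le> ?C N * 2 powr (- real n * rate (pmf_of_multiset N) + ratio_error n)"
      using card_type_class_pos[of N] by (simp add: mult.commute)
  qed
  also have "\<dots> = ?C N * (real (card \<Omega>) * 2 powr (- real n * rate (pmf_of_multiset N) + ratio_error n))"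
    by simp
  also have "\<dots> \<le> ?C N * (real ((n + 1) ^ CARD(('x \<times> 'y) \<times> 'v)) * 2 powr (- real n * rate (pmf_of_multiset N) + ratio_error n))"
    using card\<Omega> by (intro mult_left_mono mult_right_mono) (simp_all only: of_nat_le_iff powr_ge_zero of_nat_0_le_iff)
  finally show ?thesis by (simp add: good_def)
qed

text \<open>Given the source type, source and observed word are jointly uniform over the words of
  type \<open>hiding_type \<epsilon> M\<close>, so the preceding count bounds the success
  probability. The lower bound \<open>E\<close> gives all types a common exponent, and summing costs
  only their number.\<close>

lemma success_prob_le:
  assumes n: "n > 0"
    and \<epsilon>: "\<And>p q :: ('x \<times> 'y) pmf. l1_dist p q \<le> 2 * real CARD('x \<times> 'y) / real n \<Longrightarrow> \<bar>rate p - rate q\<bar> \<le> \<epsilon>"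
    and E: "\<And>Q. E \<le> objective Q"
  shows "hiding_map \<epsilon> \<in> randomized_maps d D n"
    and "g \<in> guessers n \<Longrightarrow> success_prob P d\<^sub>e D\<^sub>e n (hiding_map \<epsilon>) g
      \<le> real ((n + 1) ^ CARD('x)) * (real ((n + 1) ^ CARD(('x \<times> 'y) \<times> 'v)) *
        2 powr (- real n * (E - \<epsilon>) + ratio_error n + real (CARD('x) + 1) * type_error n))"
proof -
  let ?C = "\<lambda>U. real (card (permutations_of_multiset U))"
  let ?N = "hiding_type \<epsilon>"
  have cardH: "card (hiding_set \<epsilon> xs) * card (permutations_of_multiset (mset xs)) = card (permutations_of_multiset (?N (mset xs)))"
    if "length xs = n" for xs
    unfolding hiding_set_def
    using that by (intro cond_type_class_card hiding_type(2)[OF n _ \<epsilon>]) simp_all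
  have neH: "hiding_set \<epsilon> xs \<noteq> {}" if "length xs = n" for xs
    using cardH[OF that] card_type_class_pos[of "?N (mset xs)"] by auto
  show f: "hiding_map \<epsilon> \<in> randomized_maps d D n"
    unfolding randomized_maps_def
  proof (intro CollectI allI impI ballI)
    fix xs ys assume l: "length xs = n" and "ys \<in> set_pmf (hiding_map \<epsilon> xs)"
    then have "ys \<in> hiding_set \<epsilon> xs"
      using neH[OF l] finite_hiding_set by (simp add: hiding_map_def)
    then have ys: "length ys = n" "mset (zip xs ys) = ?N (mset xs)"
      using l by (simp_all add: hiding_set_def)
    have "pmf_of_multiset (mset (zip xs ys)) \<in> constrained d D (pmf_of_multiset (mset xs))"
      unfolding ys(2) by (rule hiding_type(3)[OF n _ \<epsilon>]) (simp_all add: l)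
    then show "length ys = n \<and> avg_distortion d xs ys \<le> D"
      using l ys n by (subst (asm) type_in_constrained) auto
  qed
  assume g: "g \<in> guessers n"
  let ?T = "{M :: 'x multiset. size M = n}"
  let ?ok = "\<lambda>xs ys. of_bool (avg_distortion d\<^sub>e xs (g ys) \<le> D\<^sub>e) :: real"
  have "success_prob P d\<^sub>e D\<^sub>e n (hiding_map \<epsilon>) g = (\<Sum>xs\<in>words n. \<Sum>ys\<in>words n.
      pmf (replicate_pmf n P) xs * pmf (hiding_map \<epsilon> xs) ys * ?ok xs ys)"
    unfolding success_prob_sum[OF f] by (rule sum.swap)
  also have "\<dots> = (\<Sum>M\<in>?T. \<Sum>xs\<in>{xs \<in> words n. mset xs = M}. \<Sum>ys\<in>words n.
      pmf (replicate_pmf n P) xs * pmf (hiding_map \<epsilon> xs) ys * ?ok xs ys)"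
    by (intro sum.group[symmetric] finite_words card_multisets_of_size_le(1)) auto
  also have "\<dots> \<le> (\<Sum>M\<in>?T. real ((n + 1) ^ CARD(('x \<times> 'y) \<times> 'v)) *
        2 powr (- real n * (E - \<epsilon>) + ratio_error n + real (CARD('x) + 1) * type_error n))"
  proof (rule sum_mono)
    fix M :: "'x multiset" assume "M \<in> ?T"
    then have M: "size M = n" by simp
    note N = hiding_type[OF n M \<epsilon>]
    let ?w = "type_weight P M"
    have w0: "0 \<le> ?w * (?C M / ?C (?N M))"
      using less_imp_le[OF log_type_prob(1)[OF full_support M n]] by (rule mult_nonneg_nonneg) simp
    \<comment> \<open>Conditional classes over words of one type have equal size, so all pairs of
      the hiding type are equally likely.\<close>
    have "pmf (replicate_pmf n P) xs * pmf (hiding_map \<epsilon> xs) ys * ?ok xs ys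
       = ?w * (?C M / ?C (?N M)) * of_bool (mset (zip xs ys) = ?N M \<and> avg_distortion d\<^sub>e xs (g ys) \<le> D\<^sub>e)"
      if xs: "xs \<in> {xs \<in> words n. mset xs = M}" and ys: "ys \<in> words n" for xs ys
    proof -
      have l: "length xs = n" "mset xs = M" "length ys = n" using xs ys by auto
      have "pmf (hiding_map \<epsilon> xs) ys = of_bool (mset (zip xs ys) = ?N M) / card (hiding_set \<epsilon> xs)"
        using neH[OF l(1)] finite_hiding_set l by (simp add: hiding_map_def) (simp add: hiding_set_def indicator_def)
      also have "1 / real (card (hiding_set \<epsilon> xs)) = ?C M / ?C (?N M)"
      proof -
        have "card (hiding_set \<epsilon> xs) > 0"
          using neH[OF l(1)] finite_hiding_set by (simp add: card_gt_0_iff)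
        then show ?thesis
          using cardH[OF l(1)] l(2) card_type_class_pos[of M] card_type_class_pos[of "?N M"]
          by (simp add: divide_simps mult.commute flip: of_nat_mult)
      qed
      then have "of_bool (mset (zip xs ys) = ?N M) / real (card (hiding_set \<epsilon> xs)) = ?C M / ?C (?N M) * of_bool (mset (zip xs ys) = ?N M)"
        by auto
      finally have "pmf (hiding_map \<epsilon> xs) ys = \<dots>" .
      moreover have "pmf (replicate_pmf n P) xs = ?w"
        using pmf_replicate_pmf_count[OF l(1), of P] l(2) by (simp add: type_weight_def)
      ultimately show ?thesis by auto
    qed
    then have "(\<Sum>xs\<in>{xs \<in> words n. mset xs = M}. \<Sum>ys\<in>words n. pmf (replicate_pmf n P) xs * pmf (hiding_map \<epsilon> xs) ys * ?ok xs ys)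
      = (\<Sum>xs\<in>{xs \<in> words n. mset xs = M}. \<Sum>ys\<in>words n.
         ?w * (?C M / ?C (?N M)) * of_bool (mset (zip xs ys) = ?N M \<and> avg_distortion d\<^sub>e xs (g ys) \<le> D\<^sub>e))"
      by (intro sum.cong refl) blast
    also have "\<dots> = ?w * (?C M / ?C (?N M)) * (\<Sum>ys\<in>words n. \<Sum>xs\<in>{xs \<in> words n. mset xs = M}.
         of_bool (mset (zip xs ys) = ?N M \<and> avg_distortion d\<^sub>e xs (g ys) \<le> D\<^sub>e))"
      unfolding sum_distrib_left by (rule sum.swap)
    also have "\<dots> \<le> ?w * (?C M / ?C (?N M)) * (\<Sum>ys\<in>words n.
         real (card {xs \<in> words n. mset (zip xs ys) = ?N M \<and> avg_distortion d\<^sub>e xs (g ys) \<le> D\<^sub>e}))"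
    proof (intro mult_left_mono sum_mono)
      fix ys :: "'y list"
      have "(\<Sum>xs\<in>{xs \<in> words n. mset xs = M}. of_bool (mset (zip xs ys) = ?N M \<and> avg_distortion d\<^sub>e xs (g ys) \<le> D\<^sub>e))
        \<le> (\<Sum>xs\<in>words n. of_bool (mset (zip xs ys) = ?N M \<and> avg_distortion d\<^sub>e xs (g ys) \<le> D\<^sub>e) :: real)"
        by (rule sum_mono2[OF finite_words]) auto
      also have "\<dots> = real (card {xs \<in> words n. mset (zip xs ys) = ?N M \<and> avg_distortion d\<^sub>e xs (g ys) \<le> D\<^sub>e})"
        by (subst sum_of_bool_eq) (simp_all add: finite_words Int_def)
      finally show "(\<Sum>xs\<in>{xs \<in> words n. mset xs = M}. of_bool (mset (zip xs ys) = ?N M \<and> avg_distortion d\<^sub>e xs (g ys) \<le> D\<^sub>e))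
        \<le> real (card {xs \<in> words n. mset (zip xs ys) = ?N M \<and> avg_distortion d\<^sub>e xs (g ys) \<le> D\<^sub>e})" .
    qed (rule w0)
    also have "\<dots> \<le> ?w * (?C M / ?C (?N M)) * (?C (?N M) * (real ((n + 1) ^ CARD(('x \<times> 'y) \<times> 'v)) *
       2 powr (- real n * rate (pmf_of_multiset (?N M)) + ratio_error n)))"
      by (rule mult_left_mono[OF card_successful_words_le[OF n g N(1)] w0])
    also have "\<dots> = ?w * ?C M * (real ((n + 1) ^ CARD(('x \<times> 'y) \<times> 'v)) *
       2 powr (- real n * rate (pmf_of_multiset (?N M)) + ratio_error n))"
      using card_type_class_pos[of "?N M"] by simp
    also have "\<dots> \<le> 2 powr (- real n * KL_div (pmf_of_multiset M) P + real (CARD('x) + 1) * type_error n) *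
       (real ((n + 1) ^ CARD(('x \<times> 'y) \<times> 'v)) *
       2 powr (- real n * rate (pmf_of_multiset (?N M)) + ratio_error n))"
    proof (rule mult_right_mono)
      have "?w * ?C M > 0" using log_type_prob(1)[OF full_support M n] card_type_class_pos[of M] by simp
      then have "?w * ?C M = 2 powr (log 2 (?w * ?C M))" by simp
      also have "\<dots> \<le> 2 powr (- real n * KL_div (pmf_of_multiset M) P + real (CARD('x) + 1) * type_error n)"
        using log_type_prob(2)[OF full_support M n] by simp
      finally show "?w * ?C M \<le> \<dots>" .
    qed simp
    also have "\<dots> = real ((n + 1) ^ CARD(('x \<times> 'y) \<times> 'v)) *
        2 powr (- real n * (KL_div (pmf_of_multiset M) P + rate (pmf_of_multiset (?N M))) + ratio_error n + real (CARD('x) + 1) * type_error n)"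
      by (simp add: algebra_simps powr_add powr_diff)
    also have "\<dots> \<le> real ((n + 1) ^ CARD(('x \<times> 'y) \<times> 'v)) *
        2 powr (- real n * (E - \<epsilon>) + ratio_error n + real (CARD('x) + 1) * type_error n)"
    proof (rule mult_left_mono)
      have "E - \<epsilon> \<le> KL_div (pmf_of_multiset M) P + rate (pmf_of_multiset (?N M))"
        using N(4) E[of "pmf_of_multiset M"] by (simp add: objective_def)
      then have "real n * (E - \<epsilon>) \<le> real n * (KL_div (pmf_of_multiset M) P + rate (pmf_of_multiset (?N M)))"
        by (rule mult_left_mono) simp
      then show "2 powr (- real n * (KL_div (pmf_of_multiset M) P + rate (pmf_of_multiset (?N M))) + ratio_error n + real (CARD('x) + 1) * type_error n)
        \<le> 2 powr (- real n * (E - \<epsilon>) + ratio_error n + real (CARD('x) + 1) * type_error n)"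
        by simp
    qed simp
    finally show "(\<Sum>xs\<in>{xs \<in> words n. mset xs = M}. \<Sum>ys\<in>words n. pmf (replicate_pmf n P) xs * pmf (hiding_map \<epsilon> xs) ys * ?ok xs ys)
      \<le> real ((n + 1) ^ CARD(('x \<times> 'y) \<times> 'v)) *
        2 powr (- real n * (E - \<epsilon>) + ratio_error n + real (CARD('x) + 1) * type_error n)" .
  qed
  also have "\<dots> = real (card ?T) * (real ((n + 1) ^ CARD(('x \<times> 'y) \<times> 'v)) *
        2 powr (- real n * (E - \<epsilon>) + ratio_error n + real (CARD('x) + 1) * type_error n))" by simp
  also have "\<dots> \<le> real ((n + 1) ^ CARD('x)) * (real ((n + 1) ^ CARD(('x \<times> 'y) \<times> 'v)) *
        2 powr (- real n * (E - \<epsilon>) + ratio_error n + real (CARD('x) + 1) * type_error n))"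
    using card_multisets_of_size_le(2)[where 'u = 'x, of n]
    by (intro mult_right_mono) (simp_all only: of_nat_le_iff powr_ge_zero of_nat_0_le_iff mult_nonneg_nonneg)
  finally show "success_prob P d\<^sub>e D\<^sub>e n (hiding_map \<epsilon>) g
      \<le> real ((n + 1) ^ CARD('x)) * (real ((n + 1) ^ CARD(('x \<times> 'y) \<times> 'v)) *
        2 powr (- real n * (E - \<epsilon>) + ratio_error n + real (CARD('x) + 1) * type_error n))" .
qed

end

section \<open>Attainment and the limit\<close>

lemma continuous_on_Max:
  fixes h :: "'i \<Rightarrow> 'a::topological_space \<Rightarrow> real"
  assumes "finite I" "I \<noteq> {}" "\<And>i. i \<in> I \<Longrightarrow> continuous_on S (h i)"
  shows "continuous_on S (\<lambda>x. Max ((\<lambda>i. h i x) ` I))"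
  using assms
proof (induction I rule: finite_ne_induct)
  case (insert i I)
  then have "continuous_on S (\<lambda>x. max (h i x) (Max ((\<lambda>i. h i x) ` I)))"
    by (intro continuous_on_max) auto
  then show ?case using insert.hyps by simp
qed simp

definition kernel_prob ::
    "'x pmf \<Rightarrow> ('x \<Rightarrow> 'v \<Rightarrow> real) \<Rightarrow> real \<Rightarrow> nat \<Rightarrow> ('x list \<times> 'y list \<Rightarrow> real) \<Rightarrow> ('y list \<Rightarrow> 'v list) \<Rightarrow> real" where
  "kernel_prob P d\<^sub>e D\<^sub>e n F g = (\<Sum>ys\<in>words n. \<Sum>xs\<in>words n.
    pmf (replicate_pmf n P) xs * F (xs, ys) * of_bool (avg_distortion d\<^sub>e xs (g ys) \<le> D\<^sub>e))"

text \<open>Maps as conditional probability tables, pinned to 0 at infeasible pairs and at words of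
  other lengths. The values at other lengths are free in \<open>randomized_maps\<close>; pinning
  them makes each feasible map a single point.\<close>

definition kernels :: "('x \<Rightarrow> 'y \<Rightarrow> real) \<Rightarrow> real \<Rightarrow> nat \<Rightarrow> ('x list \<times> 'y list \<Rightarrow> real) set" where
  "kernels d D n = (\<Pi>\<^sub>E (xs, ys)\<in>UNIV. if length xs = n \<and> length ys = n \<and> avg_distortion d xs ys \<le> D then {0..1} else {0})
     \<inter> (\<Inter>xs\<in>words n. {F. (\<Sum>ys\<in>words n. F (xs, ys)) = 1})"

text \<open>The box is compact by Tychonoff's theorem, and the row sums are continuous in the
  product topology, so they cut out a closed part.\<close>

lemma compact_kernels: "compact (kernels d D n)"
proof -
  let ?S = "\<lambda>(xs, ys). if length xs = n \<and> length ys = n \<and> avg_distortion d xs ys \<le> D then {0..1} else {0 :: real}"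
  have "compactin (product_topology (\<lambda>_. euclidean) UNIV) (Pi\<^sub>E UNIV ?S)"
    by (subst compactin_PiE) (auto simp: compactin_euclidean_iff)
  then have "compact (Pi\<^sub>E UNIV ?S)"
    by (simp add: compactin_euclidean_iff euclidean_product_topology)
  moreover have "closed (\<Inter>xs\<in>words n. {F :: 'a list \<times> 'b list \<Rightarrow> real. (\<Sum>ys\<in>words n. F (xs, ys)) = 1})"
    by (intro closed_INT ballI closed_Collect_eq continuous_on_sum continuous_on_product_coordinates continuous_on_const)
  ultimately show ?thesis
    unfolding kernels_def by (rule compact_Int_closed)
qed

lemma kernel_of_map:
  fixes f :: "'x::finite list \<Rightarrow> 'y::finite list pmf"
  assumes f: "f \<in> randomized_maps d D n"
  defines "F \<equiv> \<lambda>(xs, ys). if length xs = n then pmf (f xs) ys else 0"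
  shows "F \<in> kernels d D n" "success_prob P d\<^sub>e D\<^sub>e n f g = kernel_prob P d\<^sub>e D\<^sub>e n F g"
proof -
  have f_sub: "set_pmf (f xs) \<subseteq> words n" if "length xs = n" for xs
    using f that by (auto simp: randomized_maps_def)
  have "F (xs, ys) \<in> (if length xs = n \<and> length ys = n \<and> avg_distortion d xs ys \<le> D then {0..1} else {0})" for xs ys
    using f by (auto simp: F_def randomized_maps_def pmf_le_1 pmf_eq_0_set_pmf)
  moreover have "(\<Sum>ys\<in>words n. F (xs, ys)) = 1" if "length xs = n" for xs
    using sum_pmf_eq_1[OF finite_words f_sub[OF that]] that by (simp add: F_def)
  ultimately show "F \<in> kernels d D n" by (auto simp: kernels_def)
  show "success_prob P d\<^sub>e D\<^sub>e n f g = kernel_prob P d\<^sub>e D\<^sub>e n F g"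
    unfolding success_prob_sum[OF f] kernel_prob_def by (intro sum.cong refl) (simp add: F_def)
qed

lemma map_of_kernel:
  fixes F :: "'x::finite list \<times> 'y::finite list \<Rightarrow> real"
  assumes F: "F \<in> kernels d D n"
  obtains f where "f \<in> randomized_maps d D n"
    "\<And>P d\<^sub>e D\<^sub>e g. success_prob P d\<^sub>e D\<^sub>e n f g = kernel_prob P d\<^sub>e D\<^sub>e n F g"
proof -
  have F1: "F (xs, ys) \<in> (if length xs = n \<and> length ys = n \<and> avg_distortion d xs ys \<le> D then {0..1} else {0})" for xs ys
    using F unfolding kernels_def by (auto simp: PiE_iff split: prod.splits)
  have F0: "0 \<le> F (xs, ys)" for xs ys using F1[of xs ys] by (auto split: if_splits)
  have F2: "F (xs, ys) = 0" if "\<not> (length xs = n \<and> length ys = n \<and> avg_distortion d xs ys \<le> D)" for xs ys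
    using F1[of xs ys] that by (simp split: if_splits)
  have F3: "(\<Sum>ys\<in>words n. F (xs, ys)) = 1" if "length xs = n" for xs
    using F that by (auto simp: kernels_def)
  define f where "f xs = embed_pmf (\<lambda>ys. F (xs, ys))" for xs
  have pf: "pmf (f xs) ys = F (xs, ys)" if "length xs = n" for xs ys
    unfolding f_def
  proof (rule pmf_embed_pmf)
    have "(\<integral>\<^sup>+ ys. ennreal (F (xs, ys)) \<partial>count_space UNIV) = (\<Sum>ys\<in>words n. ennreal (F (xs, ys)))"
      using F2 by (intro nn_integral_count_space'[OF finite_words]) auto
    also have "\<dots> = 1" by (simp add: sum_ennreal F0 F3[OF that])
    finally show "(\<integral>\<^sup>+ ys. ennreal (F (xs, ys)) \<partial>count_space UNIV) = 1" .
  qed (rule F0)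
  have f: "f \<in> randomized_maps d D n"
    using F2 pf by (fastforce simp: randomized_maps_def set_pmf_iff)
  have "success_prob P d\<^sub>e D\<^sub>e n f g = kernel_prob P d\<^sub>e D\<^sub>e n F g" for P d\<^sub>e D\<^sub>e g
    unfolding success_prob_sum[OF f] kernel_prob_def by (intro sum.cong refl) (simp add: pf)
  with f show ?thesis using that by blast
qed

text \<open>Guessers act only on words of length \<open>n\<close>, so finitely many restrictions
  suffice and the best guess is a \<open>Max\<close> of finitely many values.\<close>

lemma kernel_prob_image_guessers:
  fixes F :: "'x::finite list \<times> 'y::finite list \<Rightarrow> real" and d\<^sub>e :: "'x \<Rightarrow> 'v::finite \<Rightarrow> real"
  shows "kernel_prob P d\<^sub>e D\<^sub>e n F ` guessers n = kernel_prob P d\<^sub>e D\<^sub>e n F ` (words n \<rightarrow>\<^sub>E words n)"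
    (is "?L = ?R")
proof
  show "?L \<subseteq> ?R"
  proof
    fix r assume "r \<in> ?L"
    then obtain g where g: "g \<in> guessers n" "r = kernel_prob P d\<^sub>e D\<^sub>e n F g" by blast
    have "kernel_prob P d\<^sub>e D\<^sub>e n F g = kernel_prob P d\<^sub>e D\<^sub>e n F (restrict g (words n))"
      unfolding kernel_prob_def by (intro sum.cong refl) simp
    moreover have "restrict g (words n) \<in> words n \<rightarrow>\<^sub>E words n"
      using g(1) by (auto simp: guessers_def)
    ultimately show "r \<in> ?R" using g(2) by blast
  qed
  show "?R \<subseteq> ?L" by (auto simp: guessers_def intro!: imageI)
qed

context lossy_guessing begin

lemma randomized_maps_nonempty:
  assumes "n > 0" shows "randomized_maps d D n \<noteq> {}"
proof -
  obtain m where m: "\<And>x. d x (m x) \<le> D" using feasible by metis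
  have "avg_distortion d xs (map m xs) \<le> D" if "length xs = n" for xs
  proof -
    have "(\<Sum>i<n. d (xs ! i) (map m xs ! i)) \<le> (\<Sum>i<n. D)"
      using that m by (intro sum_mono) simp
    then show ?thesis using assms that by (simp add: avg_distortion_def divide_le_eq mult.commute)
  qed
  then have "(\<lambda>xs. return_pmf (map m xs)) \<in> randomized_maps d D n"
    by (simp add: randomized_maps_def)
  then show ?thesis by blast
qed

text \<open>The best success probability is a maximum of finitely many continuous functions of the
  table, minimized over a nonempty compact set. The last clause also provides a best guesser against
  every other map, which the inner \<open>LEAST\<close> needs for each competitor.\<close>

lemma minimax_attained:
  assumes n: "n > 0"
  obtains f g where "f \<in> randomized_maps d D n" "g \<in> guessers n"
    "\<And>g'. g' \<in> guessers n \<Longrightarrow> success_prob P d\<^sub>e D\<^sub>e n f g' \<le> success_prob P d\<^sub>e D\<^sub>e n f g"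
    "\<And>f'. f' \<in> randomized_maps d D n \<Longrightarrow>
       \<exists>g'\<in>guessers n. success_prob P d\<^sub>e D\<^sub>e n f g \<le> success_prob P d\<^sub>e D\<^sub>e n f' g' \<and>
        (\<forall>g''\<in>guessers n. success_prob P d\<^sub>e D\<^sub>e n f' g'' \<le> success_prob P d\<^sub>e D\<^sub>e n f' g')"
proof -
  let ?G = "words n \<rightarrow>\<^sub>E words n :: ('y list \<Rightarrow> 'v list) set"
  define \<Psi> where "\<Psi> F = Max ((\<lambda>g. kernel_prob P d\<^sub>e D\<^sub>e n F g) ` ?G)" for F :: "'x list \<times> 'y list \<Rightarrow> real"
  have wne: "words n \<noteq> ({} :: 'v list set)" using Ex_list_of_length[of n] by auto
  have finG: "finite ?G" by (intro finite_PiE finite_words)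
  have neG: "?G \<noteq> {}" using wne by (simp add: PiE_eq_empty_iff)
  have "continuous_on (kernels d D n) \<Psi>"
    unfolding \<Psi>_def kernel_prob_def
    by (intro continuous_on_Max finG neG continuous_on_sum continuous_on_mult continuous_on_const
        continuous_on_product_coordinates[THEN continuous_on_subset]) auto
  moreover have "kernels d D n \<noteq> {}"
    using randomized_maps_nonempty[OF n] kernel_of_map(1)[of _ d D n] by blast
  ultimately obtain F where F: "F \<in> kernels d D n" "\<And>F'. F' \<in> kernels d D n \<Longrightarrow> \<Psi> F \<le> \<Psi> F'"
    using continuous_attains_inf[OF compact_kernels, of d D n \<Psi>] by blast
  have best: "\<exists>g\<in>guessers n. kernel_prob P d\<^sub>e D\<^sub>e n F g = \<Psi> F \<and> (\<forall>g'\<in>guessers n. kernel_prob P d\<^sub>e D\<^sub>e n F g' \<le> kernel_prob P d\<^sub>e D\<^sub>e n F g)" for F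
  proof -
    have *: "\<Psi> F = Max (kernel_prob P d\<^sub>e D\<^sub>e n F ` guessers n)"
      by (simp add: \<Psi>_def kernel_prob_image_guessers)
    have fin: "finite (kernel_prob P d\<^sub>e D\<^sub>e n F ` (guessers n :: ('y list \<Rightarrow> 'v list) set))"
      unfolding kernel_prob_image_guessers using finG by simp
    moreover have "kernel_prob P d\<^sub>e D\<^sub>e n F ` (guessers n :: ('y list \<Rightarrow> 'v list) set) \<noteq> {}"
      unfolding kernel_prob_image_guessers using neG by simp
    ultimately have "\<Psi> F \<in> kernel_prob P d\<^sub>e D\<^sub>e n F ` guessers n"
      unfolding * by (rule Max_in)
    then obtain g where "g \<in> guessers n" "\<Psi> F = kernel_prob P d\<^sub>e D\<^sub>e n F g" by blast
    moreover have "kernel_prob P d\<^sub>e D\<^sub>e n F g' \<le> \<Psi> F" if "g' \<in> guessers n" for g'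
      unfolding * using fin that by (intro Max_ge) auto
    ultimately show ?thesis by auto
  qed
  obtain f where f: "f \<in> randomized_maps d D n"
    "\<And>g. success_prob P d\<^sub>e D\<^sub>e n f g = kernel_prob P d\<^sub>e D\<^sub>e n F g"
    using map_of_kernel[OF F(1)] by metis
  obtain g where g: "g \<in> guessers n" "kernel_prob P d\<^sub>e D\<^sub>e n F g = \<Psi> F"
    "\<forall>g'\<in>guessers n. kernel_prob P d\<^sub>e D\<^sub>e n F g' \<le> kernel_prob P d\<^sub>e D\<^sub>e n F g"
    using best by blast
  have "\<exists>g'\<in>guessers n. success_prob P d\<^sub>e D\<^sub>e n f g \<le> success_prob P d\<^sub>e D\<^sub>e n f' g' \<and>
        (\<forall>g''\<in>guessers n. success_prob P d\<^sub>e D\<^sub>e n f' g'' \<le> success_prob P d\<^sub>e D\<^sub>e n f' g')"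
    if f': "f' \<in> randomized_maps d D n" for f'
  proof -
    define F' where "F' = (\<lambda>(xs, ys). if length xs = n then pmf (f' xs) ys else 0)"
    have F': "F' \<in> kernels d D n" "\<And>g. success_prob P d\<^sub>e D\<^sub>e n f' g = kernel_prob P d\<^sub>e D\<^sub>e n F' g"
      unfolding F'_def by (rule kernel_of_map[OF f'])+
    obtain g' where g': "g' \<in> guessers n" "kernel_prob P d\<^sub>e D\<^sub>e n F' g' = \<Psi> F'"
      "\<forall>g''\<in>guessers n. kernel_prob P d\<^sub>e D\<^sub>e n F' g'' \<le> kernel_prob P d\<^sub>e D\<^sub>e n F' g'"
      using best by blast
    have "kernel_prob P d\<^sub>e D\<^sub>e n F g \<le> kernel_prob P d\<^sub>e D\<^sub>e n F' g'"
      using F(2)[OF F'(1)] g(2) g'(2) by simp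
    then show ?thesis using g'(1,3) unfolding f(2) F'(2) by blast
  qed
  then show ?thesis using that[OF f(1) g(1)] g(3) f(2) by auto
qed

text \<open>\<open>neg_log2\<close> reverses order on nonnegative reals, including at 0 where it is
  \<infinity>, so a map minimizing the best success probability attains the \<open>GREATEST\<close>
  of the \<open>LEAST\<close> exponents.\<close>

lemma exponent_at_eq:
  assumes n: "n > 0"
  obtains f g where "f \<in> randomized_maps d D n" "g \<in> guessers n"
    "\<And>g'. g' \<in> guessers n \<Longrightarrow> success_prob P d\<^sub>e D\<^sub>e n f g' \<le> success_prob P d\<^sub>e D\<^sub>e n f g"
    "\<And>f'. f' \<in> randomized_maps d D n \<Longrightarrow>
       \<exists>g'\<in>guessers n. success_prob P d\<^sub>e D\<^sub>e n f g \<le> success_prob P d\<^sub>e D\<^sub>e n f' g'"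
    "exponent_at P d d\<^sub>e D D\<^sub>e n = ereal (1 / real n) * neg_log2 (success_prob P d\<^sub>e D\<^sub>e n f g)"
proof -
  define h where "h p = ereal (1 / real n) * neg_log2 p" for p
  have h: "h q \<le> h p" if "0 \<le> p" "p \<le> q" for p q
    unfolding h_def using that by (intro ereal_mult_left_mono) (auto simp: neg_log2_def)
  have s0: "0 \<le> success_prob P d\<^sub>e D\<^sub>e n f g" for f :: "'x list \<Rightarrow> 'y list pmf" and g
    by (simp add: success_prob_def)
  obtain f g where fg: "f \<in> randomized_maps d D n" "g \<in> guessers n"
    "\<And>g'. g' \<in> guessers n \<Longrightarrow> success_prob P d\<^sub>e D\<^sub>e n f g' \<le> success_prob P d\<^sub>e D\<^sub>e n f g"
    "\<And>f'. f' \<in> randomized_maps d D n \<Longrightarrow>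
       \<exists>g'\<in>guessers n. success_prob P d\<^sub>e D\<^sub>e n f g \<le> success_prob P d\<^sub>e D\<^sub>e n f' g' \<and>
        (\<forall>g''\<in>guessers n. success_prob P d\<^sub>e D\<^sub>e n f' g'' \<le> success_prob P d\<^sub>e D\<^sub>e n f' g')"
    using minimax_attained[OF n] by metis
  have least: "(LEAST e'. \<exists>g\<in>guessers n. e' = h (success_prob P d\<^sub>e D\<^sub>e n f' g)) = h (success_prob P d\<^sub>e D\<^sub>e n f' g')"
    if "g' \<in> guessers n" "\<forall>g''\<in>guessers n. success_prob P d\<^sub>e D\<^sub>e n f' g'' \<le> success_prob P d\<^sub>e D\<^sub>e n f' g'"
    for f' :: "'x list \<Rightarrow> 'y list pmf" and g'
    using that by (intro Least_equality) (auto intro: h s0)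
  have "exponent_at P d d\<^sub>e D D\<^sub>e n = h (success_prob P d\<^sub>e D\<^sub>e n f g)"
    unfolding exponent_at_def h_def[symmetric]
  proof (rule Greatest_equality)
    show "\<exists>f'\<in>randomized_maps d D n. h (success_prob P d\<^sub>e D\<^sub>e n f g) =
       (LEAST e'. \<exists>g\<in>guessers n. e' = h (success_prob P d\<^sub>e D\<^sub>e n f' g))"
      using fg least[of g f] by (metis (no_types, lifting))
  next
    fix e assume "\<exists>f'\<in>randomized_maps d D n. e = (LEAST e'. \<exists>g\<in>guessers n. e' = h (success_prob P d\<^sub>e D\<^sub>e n f' g))"
    then obtain f' where f': "f' \<in> randomized_maps d D n"
      "e = (LEAST e'. \<exists>g\<in>guessers n. e' = h (success_prob P d\<^sub>e D\<^sub>e n f' g))" by blast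
    obtain g' where g': "g' \<in> guessers n" "success_prob P d\<^sub>e D\<^sub>e n f g \<le> success_prob P d\<^sub>e D\<^sub>e n f' g'"
      "\<forall>g''\<in>guessers n. success_prob P d\<^sub>e D\<^sub>e n f' g'' \<le> success_prob P d\<^sub>e D\<^sub>e n f' g'"
      using fg(4)[OF f'(1)] by blast
    show "e \<le> h (success_prob P d\<^sub>e D\<^sub>e n f g)"
      unfolding f'(2) least[OF g'(1,3)] by (rule h[OF s0 g'(2)])
  qed
  then show ?thesis
    using that[of f g] fg unfolding h_def by blast
qed

end

section \<open>Vanishing of the error terms\<close>

lemma scaled_neg_log2_powr:
  assumes "n > 0"
  shows "ereal (1 / real n) * neg_log2 (2 powr (- real n * a)) = ereal a"
  using assms by (simp add: neg_log2_def)

lemma scaled_neg_log2_antimono: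
  assumes "0 \<le> p" "p \<le> q"
  shows "ereal (1 / real n) * neg_log2 q \<le> ereal (1 / real n) * neg_log2 p"
  using assms by (intro ereal_mult_left_mono) (auto simp: neg_log2_def)

lemma eventually_log_error_le:
  fixes k c \<epsilon> :: real
  assumes "\<epsilon> > 0"
  shows "eventually (\<lambda>n. k * log 2 (real n + 1) + c * type_error n \<le> \<epsilon> * real n) sequentially"
proof -
  have "(\<lambda>n. log 2 (real n + 1) / real n) \<longlonglongrightarrow> 0" by real_asymp
  moreover have "(\<lambda>n. 2 / real n) \<longlonglongrightarrow> 0" by real_asymp
  ultimately have "(\<lambda>n. (k + c) * (log 2 (real n + 1) / real n) + c * (2 / real n)) \<longlonglongrightarrow> (k + c) * 0 + c * 0"
    by (intro tendsto_intros)
  then have "eventually (\<lambda>n. (k + c) * (log 2 (real n + 1) / real n) + c * (2 / real n) < \<epsilon>) sequentially"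
    by (rule order_tendstoD) (use assms in simp)
  then show ?thesis
    using eventually_gt_at_top[of 0]
  proof eventually_elim
    case (elim n)
    have "k * log 2 (real n + 1) + c * type_error n
       = real n * ((k + c) * (log 2 (real n + 1) / real n) + c * (2 / real n))"
      using elim(2) by (simp add: type_error_def field_simps)
    also have "\<dots> \<le> real n * \<epsilon>" using elim by (intro mult_left_mono) auto
    finally show ?case by (simp add: mult.commute)
  qed
qed

lemma power_eq_powr_log2: "real ((n + 1) ^ j) = 2 powr (real j * log 2 (real n + 1))"
proof -
  have "2 powr (real j * log 2 (real n + 1)) = (2 powr log 2 (real n + 1)) powr real j"
    by (simp only: powr_powr mult.commute)
  also have "2 powr log 2 (real n + 1) = real n + 1" by simp
  also have "(real n + 1) powr real j = (real n + 1) ^ j" by (rule powr_realpow) simp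
  finally show ?thesis by (simp add: add.commute)
qed

lemma small_l1_eventually:
  assumes "unif_cont \<Phi>" "\<epsilon> > 0"
  shows "eventually (\<lambda>n. \<forall>p q. l1_dist p q \<le> C / real n \<longrightarrow> \<bar>\<Phi> p - \<Phi> q\<bar> \<le> \<epsilon>) sequentially"
proof -
  obtain \<delta> where d: "\<delta> > 0" "\<And>p q. l1_dist p q < \<delta> \<Longrightarrow> \<bar>\<Phi> p - \<Phi> q\<bar> < \<epsilon>"
    using unif_contD[OF assms] by blast
  have "(\<lambda>n. C / real n) \<longlonglongrightarrow> 0" by (rule lim_const_over_n)
  then have "eventually (\<lambda>n. C / real n < \<delta>) sequentially"
    using d(1) by (rule order_tendstoD)
  then show ?thesis
  proof eventually_elim
    case (elim n)
    then show ?case using d(2) by (meson le_less_trans less_imp_le)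
  qed
qed

text \<open>A law is a joint law over a one-point first alphabet; with zero cost,
  \<open>constrained_round\<close> becomes plain rounding to a type.\<close>

lemma ex_type_near:
  fixes Q :: "'u::finite pmf"
  assumes "n > 0"
  obtains M where "size M = n" "l1_dist Q (pmf_of_multiset M) \<le> 2 * real CARD('u) / real n"
proof -
  let ?q = "map_pmf (Pair ()) Q"
  have "?q \<in> constrained (\<lambda>_ _. 0) 0 (return_pmf ())"
    by (simp add: constrained_def map_pmf_comp map_pmf_const)
  moreover have "real n * pmf (return_pmf ()) a \<in> \<nat>" for a by simp
  ultimately obtain q where q: "\<And>u. real n * pmf q u \<in> \<nat>" "l1_dist ?q q \<le> 2 * real CARD(unit \<times> 'u) / real n"
    using constrained_round[OF _ assms] by metis
  have "pmf (map_pmf snd q) u = pmf q ((), u)" for u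
  proof -
    have "snd -` {u} = {((), u)}" by auto
    then show ?thesis by (simp add: pmf_map_finite)
  qed
  then obtain M where M: "size M = n" "pmf_of_multiset M = map_pmf snd q"
    using obtain_multiset_of_pmf[OF assms, of "map_pmf snd q"] q(1) by metis
  have "l1_dist Q (map_pmf snd q) \<le> l1_dist ?q q"
    using l1_dist_map_pmf[of snd ?q q] by (simp add: map_pmf_comp)
  then show ?thesis using that M q(2) by simp
qed

context lossy_guessing begin

text \<open>An optimal map is at least as good as \<open>hiding_map\<close>. Half of
  \<open>\<epsilon>\<close> pays for rounding the joint type, the other half for the polynomial
  factors.\<close>

lemma exponent_at_ge:
  assumes E: "\<And>Q. E \<le> objective Q" and "\<epsilon> > 0"
  shows "eventually (\<lambda>n. ereal (E - \<epsilon>) \<le> exponent_at P d d\<^sub>e D D\<^sub>e n) sequentially"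
proof -
  \<comment> \<open>\<open>k\<close> collects the degrees of the two type counts, \<open>c\<close>
    the multiples of \<open>type_error\<close>.\<close>
  define k where "k = real CARD('x) + real CARD(('x \<times> 'y) \<times> 'v)"
  define c where "c = 4 * real (CARD(('x \<times> 'y) \<times> 'v) + 1) + real (CARD('x) + 1)"
  have e: "\<epsilon> / 2 > 0" using assms(2) by simp
  show ?thesis
    using small_l1_eventually[OF unif_cont_rate e, of "2 * real CARD('x \<times> 'y)"]
      eventually_log_error_le[OF e, of k c] eventually_gt_at_top[of 0]
  proof eventually_elim
    case (elim n)
    then have n: "n > 0" and small: "\<And>p q :: ('x \<times> 'y) pmf. l1_dist p q \<le> 2 * real CARD('x \<times> 'y) / real n \<Longrightarrow> \<bar>rate p - rate q\<bar> \<le> \<epsilon> / 2"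
      by blast+
    obtain f g where fg: "f \<in> randomized_maps d D n" "g \<in> guessers n"
      "\<And>g'. g' \<in> guessers n \<Longrightarrow> success_prob P d\<^sub>e D\<^sub>e n f g' \<le> success_prob P d\<^sub>e D\<^sub>e n f g"
      "\<And>f'. f' \<in> randomized_maps d D n \<Longrightarrow>
       \<exists>g'\<in>guessers n. success_prob P d\<^sub>e D\<^sub>e n f g \<le> success_prob P d\<^sub>e D\<^sub>e n f' g'"
      "exponent_at P d d\<^sub>e D D\<^sub>e n = ereal (1 / real n) * neg_log2 (success_prob P d\<^sub>e D\<^sub>e n f g)"
      using exponent_at_eq[OF n] by blast
    have hm: "hiding_map (\<epsilon> / 2) \<in> randomized_maps d D n"
      by (rule success_prob_le(1)[OF n _ E]) (rule small)
    obtain g' where g': "g' \<in> guessers n" "success_prob P d\<^sub>e D\<^sub>e n f g \<le> success_prob P d\<^sub>e D\<^sub>e n (hiding_map (\<epsilon> / 2)) g'"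
      using fg(4)[OF hm] by blast
    note g'(2)
    also have "success_prob P d\<^sub>e D\<^sub>e n (hiding_map (\<epsilon> / 2)) g' \<le> real ((n + 1) ^ CARD('x)) * (real ((n + 1) ^ CARD(('x \<times> 'y) \<times> 'v)) *
        2 powr (- real n * (E - \<epsilon> / 2) + ratio_error n + real (CARD('x) + 1) * type_error n))"
      by (rule success_prob_le(2)[OF n _ E g'(1)]) (rule small)
    also have "\<dots> = 2 powr (- real n * (E - \<epsilon> / 2) + (k * log 2 (real n + 1) + c * type_error n))"
      unfolding power_eq_powr_log2 powr_add[symmetric] k_def c_def ratio_error_def
      by (simp add: algebra_simps)
    also have "\<dots> \<le> 2 powr (- real n * (E - \<epsilon>))"
      using elim(2) by (simp add: algebra_simps)
    finally have "ereal (1 / real n) * neg_log2 (2 powr (- real n * (E - \<epsilon>)))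
       \<le> ereal (1 / real n) * neg_log2 (success_prob P d\<^sub>e D\<^sub>e n f g)"
      by (intro scaled_neg_log2_antimono) (simp add: success_prob_def)
    then show ?case unfolding fg(5) scaled_neg_log2_powr[OF n] .
  qed
qed

text \<open>The three parts of \<open>\<epsilon>\<close> pay for rounding the optimal law of the
  triple, for replacing \<open>Q\<close> by a type of length \<open>n\<close>, and for the
  polynomial factors. \<open>Q\<close> is arbitrary here and is chosen optimally only in the
  limit.\<close>

lemma exponent_at_le:
  assumes "\<epsilon> > 0"
  shows "eventually (\<lambda>n. exponent_at P d d\<^sub>e D D\<^sub>e n \<le> ereal (objective Q + \<epsilon>)) sequentially"
proof -
  define k where "k = real CARD('y \<times> 'v)"
  define c where "c = 4 * real (CARD(('x \<times> 'y) \<times> 'v) + 1) + real (CARD('x) + 1)"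
  have e: "\<epsilon> / 3 > 0" using assms by simp
  have "eventually (\<lambda>n. \<forall>p q :: (('x \<times> 'y) \<times> 'v) pmf. l1_dist p q \<le> 2 * real CARD(('x \<times> 'y) \<times> 'v) / real n
      \<longrightarrow> \<bar>cond_mutual_info p - cond_mutual_info q\<bar> \<le> \<epsilon> / 3) sequentially"
    by (rule small_l1_eventually[OF unif_cont_cond_mutual_info e])
  then show ?thesis
    using
      small_l1_eventually[OF unif_cont_objective e, of "2 * real CARD('x)"]
      eventually_log_error_le[OF e, of k c] eventually_gt_at_top[of 0]
  proof eventually_elim
    case (elim n)
    then have n: "n > 0" and small: "\<And>p q :: (('x \<times> 'y) \<times> 'v) pmf. l1_dist p q \<le> 2 * real CARD(('x \<times> 'y) \<times> 'v) / real n
        \<Longrightarrow> \<bar>cond_mutual_info p - cond_mutual_info q\<bar> \<le> \<epsilon> / 3"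
      by blast+
    obtain M where M: "size M = n" "l1_dist Q (pmf_of_multiset M) \<le> 2 * real CARD('x) / real n"
      using ex_type_near[OF n] by blast
    have obj: "objective (pmf_of_multiset M) \<le> objective Q + \<epsilon> / 3"
      using elim(2)[rule_format, OF M(2)] by linarith
    obtain f g where fg: "f \<in> randomized_maps d D n" "g \<in> guessers n"
      "\<And>g'. g' \<in> guessers n \<Longrightarrow> success_prob P d\<^sub>e D\<^sub>e n f g' \<le> success_prob P d\<^sub>e D\<^sub>e n f g"
      "\<And>f'. f' \<in> randomized_maps d D n \<Longrightarrow>
       \<exists>g'\<in>guessers n. success_prob P d\<^sub>e D\<^sub>e n f g \<le> success_prob P d\<^sub>e D\<^sub>e n f' g'"
      "exponent_at P d d\<^sub>e D D\<^sub>e n = ereal (1 / real n) * neg_log2 (success_prob P d\<^sub>e D\<^sub>e n f g)"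
      using exponent_at_eq[OF n] by blast
    have "\<exists>g\<in>guessers n.
      2 powr (- real n * (objective (pmf_of_multiset M) + \<epsilon> / 3) - ratio_error n - real (CARD('x) + 1) * type_error n)
      \<le> success_prob P d\<^sub>e D\<^sub>e n f g * real ((n + 1) ^ CARD('y \<times> 'v))"
      by (rule success_prob_ge[OF n fg(1) M(1)]) (rule small)
    then obtain g' where g': "g' \<in> guessers n"
      "2 powr (- real n * (objective (pmf_of_multiset M) + \<epsilon> / 3) - ratio_error n - real (CARD('x) + 1) * type_error n)
      \<le> success_prob P d\<^sub>e D\<^sub>e n f g' * real ((n + 1) ^ CARD('y \<times> 'v))" ..
    have pw: "real ((n + 1) ^ CARD('y \<times> 'v)) = 2 powr (k * log 2 (real n + 1))"
      unfolding k_def by (rule power_eq_powr_log2)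
    have "real n * objective (pmf_of_multiset M) \<le> real n * (objective Q + \<epsilon> / 3)"
      using obj by (intro mult_left_mono) auto
    then have "- real n * (objective Q + \<epsilon>) + k * log 2 (real n + 1)
       \<le> - real n * (objective (pmf_of_multiset M) + \<epsilon> / 3) - ratio_error n - real (CARD('x) + 1) * type_error n"
      using elim(3) by (simp add: c_def ratio_error_def algebra_simps)
    then have "2 powr (- real n * (objective Q + \<epsilon>) + k * log 2 (real n + 1))
       \<le> 2 powr (- real n * (objective (pmf_of_multiset M) + \<epsilon> / 3) - ratio_error n - real (CARD('x) + 1) * type_error n)"
      by (rule powr_mono) simp
    also note g'(2)
    finally have "2 powr (- real n * (objective Q + \<epsilon>) + k * log 2 (real n + 1))
       \<le> success_prob P d\<^sub>e D\<^sub>e n f g' * 2 powr (k * log 2 (real n + 1))"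
      unfolding pw .
    then have "2 powr (- real n * (objective Q + \<epsilon>)) \<le> success_prob P d\<^sub>e D\<^sub>e n f g'"
      unfolding powr_add by simp
    also have "\<dots> \<le> success_prob P d\<^sub>e D\<^sub>e n f g" by (rule fg(3)[OF g'(1)])
    finally have "ereal (1 / real n) * neg_log2 (success_prob P d\<^sub>e D\<^sub>e n f g)
       \<le> ereal (1 / real n) * neg_log2 (2 powr (- real n * (objective Q + \<epsilon>)))"
      by (intro scaled_neg_log2_antimono) simp_all
    then show ?case unfolding fg(5) scaled_neg_log2_powr[OF n] .
  qed
qed

section \<open>Identification of the rates and the limit\<close>

lemma cond_rate_distortion_eq: "cond_rate_distortion d\<^sub>e J D\<^sub>e = rate J"
proof -
  have cost: "(\<lambda>((x, y), v). d\<^sub>e x v) = (\<lambda>(a :: 'x \<times> 'y, b). cost a b)"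
    by (auto simp: cost_def)
  have constr: "q \<in> constrained cost D\<^sub>e J \<longleftrightarrow>
     (\<exists>W. q = joint_pmf J W \<and> measure_pmf.expectation (joint_pmf J W) (\<lambda>((x, y), v). d\<^sub>e x v) \<le> D\<^sub>e)" for q
    using joint_pmf_iff_marginal[of q J] unfolding constrained_def cost by auto
  have "(LEAST r. \<exists>W. measure_pmf.expectation (joint_pmf J W) (\<lambda>((x, y), v). d\<^sub>e x v) \<le> D\<^sub>e \<and>
        r = cond_mutual_info (joint_pmf J W)) = rate J"
  proof (rule Least_equality)
    obtain q where q: "q \<in> constrained cost D\<^sub>e J" "rate J = cond_mutual_info q"
      by (rule rate_attained)
    then obtain W where "q = joint_pmf J W"
        "measure_pmf.expectation (joint_pmf J W) (\<lambda>((x, y), v). d\<^sub>e x v) \<le> D\<^sub>e"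
      using iffD1[OF constr q(1)] by blast
    with q(2) show "\<exists>W. measure_pmf.expectation (joint_pmf J W) (\<lambda>((x, y), v). d\<^sub>e x v) \<le> D\<^sub>e \<and>
        rate J = cond_mutual_info (joint_pmf J W)"
      by (intro exI[of _ W]) simp
  next
    fix r assume "\<exists>W. measure_pmf.expectation (joint_pmf J W) (\<lambda>((x, y), v). d\<^sub>e x v) \<le> D\<^sub>e \<and>
        r = cond_mutual_info (joint_pmf J W)"
    then obtain W where W: "measure_pmf.expectation (joint_pmf J W) (\<lambda>((x, y), v). d\<^sub>e x v) \<le> D\<^sub>e"
        "r = cond_mutual_info (joint_pmf J W)" by blast
    show "rate J \<le> r"
      unfolding W(2) by (rule rate_le, rule iffD2[OF constr]) (use W(1) in blast)
  qed
  then show ?thesis by (simp add: cond_rate_distortion_def)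
qed

lemma max_rate_distortion_eq: "max_rate_distortion d d\<^sub>e Q D D\<^sub>e = max_rate Q"
proof -
  have constr: "J \<in> constrained d D Q \<longleftrightarrow>
     (\<exists>K. J = joint_pmf Q K \<and> measure_pmf.expectation (joint_pmf Q K) (\<lambda>(x, y). d x y) \<le> D)" for J
    using joint_pmf_iff_marginal[of J Q] unfolding constrained_def by auto
  show ?thesis
    unfolding max_rate_distortion_def cond_rate_distortion_eq
  proof (rule Greatest_equality)
    obtain J where J: "J \<in> constrained d D Q" "max_rate Q = rate J"
      by (rule max_rate_attained)
    then obtain K where "J = joint_pmf Q K"
        "measure_pmf.expectation (joint_pmf Q K) (\<lambda>(x, y). d x y) \<le> D"
      using iffD1[OF constr J(1)] by blast
    with J(2) show "\<exists>K. measure_pmf.expectation (joint_pmf Q K) (\<lambda>(x, y). d x y) \<le> D \<and> max_rate Q = rate (joint_pmf Q K)"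
      by (intro exI[of _ K]) simp
  next
    fix r assume "\<exists>K. measure_pmf.expectation (joint_pmf Q K) (\<lambda>(x, y). d x y) \<le> D \<and> r = rate (joint_pmf Q K)"
    then obtain K where K: "measure_pmf.expectation (joint_pmf Q K) (\<lambda>(x, y). d x y) \<le> D"
        "r = rate (joint_pmf Q K)" by blast
    show "r \<le> max_rate Q"
      unfolding K(2) by (rule rate_le_max_rate, rule iffD2[OF constr]) (use K(1) in blast)
  qed
qed

text \<open>The continuous objective has a minimizer over the simplex. Its value is the uniform
  lower bound needed for one direction, and the minimizer itself is the law used in the
  other.\<close>

lemma exponent_at_tendsto:
  "exponent_at P d d\<^sub>e D D\<^sub>e \<longlonglongrightarrow>
    ereal (LEAST e. \<exists>Q. e = KL_div Q P + max_rate_distortion d d\<^sub>e Q D D\<^sub>e)"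
proof -
  obtain Q where Q: "\<And>Q'. objective Q \<le> objective Q'"
    using unif_cont_attains_inf[OF unif_cont_objective, of UNIV] by auto
  have "(LEAST e. \<exists>Q. e = KL_div Q P + max_rate_distortion d d\<^sub>e Q D D\<^sub>e) = objective Q"
    unfolding max_rate_distortion_eq
    by (rule Least_equality) (auto simp: objective_def[symmetric] intro: Q)
  moreover have "exponent_at P d d\<^sub>e D D\<^sub>e \<longlonglongrightarrow> ereal (objective Q)"
  proof (rule order_tendstoI)
    fix a assume "a < ereal (objective Q)"
    then obtain b where b: "a < ereal b" "ereal b < ereal (objective Q)" 
      using ereal_dense2 by blast
    then have "objective Q - b > 0" by simp
    from exponent_at_ge[OF Q this]
    show "eventually (\<lambda>n. a < exponent_at P d d\<^sub>e D D\<^sub>e n) sequentially"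
      by eventually_elim (use b(1) in \<open>simp add: less_le_trans\<close>)
  next
    fix a assume "ereal (objective Q) < a"
    then obtain b where b: "ereal b < a" "ereal (objective Q) < ereal b" 
      using ereal_dense2 by blast
    then have "b - objective Q > 0" by simp
    from exponent_at_le[OF this, of Q]
    show "eventually (\<lambda>n. exponent_at P d d\<^sub>e D D\<^sub>e n < a) sequentially"
      by eventually_elim (use b(1) in \<open>simp add: le_less_trans\<close>)
  qed
  ultimately show ?thesis by simp
qed

end

lemma min_distortion_leD:
  fixes d :: "'a::finite \<Rightarrow> 'b::finite \<Rightarrow> real"
  assumes "min_distortion d \<le> D"
  shows "\<exists>b. d a b \<le> D"
proof -
  have "Min (range (d a)) \<in> range (d a)" by (rule Min_in) auto
  then obtain b where b: "Min (range (d a)) = d a b" by (meson imageE)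
  have "Min (range (d a)) \<le> min_distortion d"
    unfolding min_distortion_def by (rule Max_ge) auto
  then have "d a b \<le> D" using assms b by simp
  then show ?thesis ..
qed

theorem theorem1:
  fixes P :: "'x::finite pmf"
    and d :: "'x \<Rightarrow> 'y::finite \<Rightarrow> real"
    and d\<^sub>e :: "'x \<Rightarrow> 'v::finite \<Rightarrow> real"
    and D D\<^sub>e :: real
  assumes "set_pmf P = UNIV"
    and "\<And>x y. 0 \<le> d x y"
    and "\<And>x v. 0 \<le> d\<^sub>e x v"
    and "min_distortion d \<le> D"
    and "min_distortion d\<^sub>e \<le> D\<^sub>e"
  shows "convergent (exponent_at P d d\<^sub>e D D\<^sub>e) \<and>
    exponent P d d\<^sub>e D D\<^sub>e =
      ereal (LEAST e. \<exists>Q :: 'x pmf. e = KL_div Q P + max_rate_distortion d d\<^sub>e Q D D\<^sub>e)"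
proof -
  interpret lossy_guessing P d d\<^sub>e D D\<^sub>e
    by unfold_locales (use assms min_distortion_leD in blast)+
  show ?thesis
    using exponent_at_tendsto by (auto simp: exponent_def convergent_def intro: limI)
qed

end
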